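(* Let $M$ be a closed manifold of dimension $n$ with Riemannian metrics $g(t)$ evolving by the Ricci flow $\frac{\partial}{\partial t}g(t)=-2\,\mathrm{Ric}(g(t))$ for $t\in[0,T]$ and satisfying $$0\le\mathrm{Ric}\le K_2g$$ on $M\times[0,T]$ for a constant $K_2\ge0$. Let $a\in\mathbb R$. If $u$ is a positive solution on $M\times[0,T]$ of $$(\Delta-q(x,t)-\partial_t)u(x,t)=a\,u(x,t)\log(u(x,t)),$$ and $q$ satisfies $\Delta q\le\theta$ on $M\times[0,T]$ for a constant $\theta\ge0$, then $$\frac{|\nabla u|^2}{u^2}-\frac{u_t}{u}-q-a\log u\le\frac n{2t}+nK_2+\sqrt{n\theta}+\frac n2|a|$$ on $M\times(0,T]$.
   Context: $\nabla$, $\Delta$, $\mathrm{Ric}$, $|\cdot|$ at time $t$ are taken with respect to $g(t)$, a smooth family of Riemannian metrics on $M$. $q(x,t)$ is a function on $M\times[0,T]$ which is $C^2$ in $x$ and $C^1$ in $t$. Solutions $u$ are smooth in $x$ and $t$; $u_t=\partial_tu$. *)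

theory Defs
  imports "HOL-Analysis.Analysis"
begin

section \<open>Functions of class C k\<close>

text \<open>
  The set \<open>S\<close> is either open, a compact interval, or a product of an open set with a compact
  interval of times. In the last two cases the derivative within \<open>S\<close> is one-sided in time at
  the two end points, and the derivatives are required to be continuous up to the end points.
\<close>

primrec Ck_on :: "nat \<Rightarrow> 'v::real_normed_vector set \<Rightarrow> ('v \<Rightarrow> 'w::real_normed_vector) \<Rightarrow> bool" where
  "Ck_on 0 S f \<longleftrightarrow> continuous_on S f"
| "Ck_on (Suc k) S f \<longleftrightarrow>
     f differentiable_on S \<and> (\<forall>v. Ck_on k S (\<lambda>x. frechet_derivative f (at x within S) v))"

definition smooth_on :: "'v::real_normed_vector set \<Rightarrow> ('v \<Rightarrow> 'w::real_normed_vector) \<Rightarrow> bool" where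
  "smooth_on S f \<longleftrightarrow> (\<forall>k. Ck_on k S f)"


section \<open>Closed manifolds\<close>

text \<open>
  A chart is a pair of a domain and a coordinate map; only the values of the map on the domain
  matter. The dimension of the manifold is \<open>CARD('n)\<close>.
\<close>

type_synonym ('a, 'n) chart = "'a set \<times> ('a \<Rightarrow> real ^ 'n)"

abbreviation dom_of :: "('a, 'n::finite) chart \<Rightarrow> 'a set" where
  "dom_of c \<equiv> fst c"

abbreviation coords :: "('a, 'n::finite) chart \<Rightarrow> 'a \<Rightarrow> real ^ 'n" where
  "coords c \<equiv> snd c"

definition range_of :: "('a, 'n::finite) chart \<Rightarrow> (real ^ 'n) set" where
  "range_of c = coords c ` dom_of c"

definition point_of :: "('a, 'n::finite) chart \<Rightarrow> real ^ 'n \<Rightarrow> 'a" where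
  "point_of c = inv_into (dom_of c) (coords c)"

definition is_chart :: "'a::t2_space set \<Rightarrow> ('a, 'n::finite) chart \<Rightarrow> bool" where
  "is_chart M c \<longleftrightarrow>
     openin (top_of_set M) (dom_of c) \<and> open (range_of c) \<and>
     homeomorphism (dom_of c) (range_of c) (coords c) (point_of c)"

text \<open>The change of coordinates from \<open>c\<close> to \<open>d\<close>.\<close>

definition transition :: "('a, 'n::finite) chart \<Rightarrow> ('a, 'n) chart \<Rightarrow> real ^ 'n \<Rightarrow> real ^ 'n" where
  "transition c d = (\<lambda>x. coords d (point_of c x))"

definition smooth_atlas :: "'a::t2_space set \<Rightarrow> ('a, 'n::finite) chart set \<Rightarrow> bool" where
  "smooth_atlas M A \<longleftrightarrow>
     (\<forall>c\<in>A. is_chart M c) \<and> (\<Union>c\<in>A. dom_of c) = M \<and>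
     (\<forall>c\<in>A. \<forall>d\<in>A. smooth_on (coords c ` (dom_of c \<inter> dom_of d)) (transition c d))"

text \<open>
  Second countability need not be required: it follows from compactness. Connectedness is not
  required.
\<close>

definition closed_manifold :: "'a::t2_space set \<Rightarrow> ('a, 'n::finite) chart set \<Rightarrow> bool" where
  "closed_manifold M A \<longleftrightarrow> compact M \<and> smooth_atlas M A"

definition smooth_on_spacetime ::
    "('a, 'n::finite) chart set \<Rightarrow> real \<Rightarrow> (real \<Rightarrow> 'a \<Rightarrow> real) \<Rightarrow> bool" where
  "smooth_on_spacetime A T u \<longleftrightarrow>
     (\<forall>c\<in>A. smooth_on (range_of c \<times> {0..T}) (\<lambda>(x, t). u t (point_of c x)))"

text \<open>The condition on \<open>q\<close> is imposed in \<open>x\<close> and in \<open>t\<close> separately.\<close>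

definition C2_space_C1_time ::
    "'a set \<Rightarrow> ('a, 'n::finite) chart set \<Rightarrow> real \<Rightarrow> (real \<Rightarrow> 'a \<Rightarrow> real) \<Rightarrow> bool" where
  "C2_space_C1_time M A T q \<longleftrightarrow>
     (\<forall>t\<in>{0..T}. \<forall>c\<in>A. Ck_on 2 (range_of c) (\<lambda>x. q t (point_of c x))) \<and>
     (\<forall>p\<in>M. Ck_on 1 {0..T} (\<lambda>t. q t p))"


section \<open>Riemannian metrics\<close>

text \<open>
  A field of bilinear forms is given by its component matrices: \<open>g c p\<close> is the matrix of
  \<open>g\<close> at \<open>p\<close> in the coordinates of \<open>c\<close>. The last clause below is the transformation law of a
  covariant 2-tensor.
\<close>

type_synonym ('a, 'n) bilinear_field = "('a, 'n) chart \<Rightarrow> 'a \<Rightarrow> real ^ 'n ^ 'n"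

definition riemannian_metric ::
    "('a, 'n::finite) chart set \<Rightarrow> ('a, 'n) bilinear_field \<Rightarrow> bool" where
  "riemannian_metric A g \<longleftrightarrow>
     (\<forall>c\<in>A. \<forall>p\<in>dom_of c. transpose (g c p) = g c p) \<and>
     (\<forall>c\<in>A. \<forall>p\<in>dom_of c. \<forall>v. v \<noteq> 0 \<longrightarrow> 0 < v \<bullet> (g c p *v v)) \<and>
     (\<forall>c\<in>A. smooth_on (range_of c) (\<lambda>x. g c (point_of c x))) \<and>
     (\<forall>c\<in>A. \<forall>d\<in>A. \<forall>p\<in>dom_of c \<inter> dom_of d.
        let J = frechet_derivative (transition c d) (at (coords c p))
        in \<forall>v w. v \<bullet> (g c p *v w) = J v \<bullet> (g d p *v J w))"

definition smooth_family_of_metrics ::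
    "('a, 'n::finite) chart set \<Rightarrow> real \<Rightarrow> (real \<Rightarrow> ('a, 'n) bilinear_field) \<Rightarrow> bool" where
  "smooth_family_of_metrics A T g \<longleftrightarrow>
     (\<forall>t\<in>{0..T}. riemannian_metric A (g t)) \<and>
     (\<forall>c\<in>A. smooth_on (range_of c \<times> {0..T}) (\<lambda>(x, t). g t c (point_of c x)))"


section \<open>Levi-Civita connection, curvature, gradient and Laplacian\<close>

text \<open>
  All objects are given by their expressions in the coordinates of a chart \<open>c\<close>. In the
  definitions with an argument \<open>x\<close>, this is a point of \<open>range_of c\<close>; in those with an
  argument \<open>p\<close>, a point of the manifold. The values of \<open>laplacian\<close> and \<open>grad_norm_sq\<close> do not
  depend on the chart around \<open>p\<close>, and \<open>ricci\<close> is again a field of bilinear forms. Statements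
  about them are therefore made in every chart of the atlas.
\<close>

definition partial :: "'n::finite \<Rightarrow> (real ^ 'n \<Rightarrow> real) \<Rightarrow> real ^ 'n \<Rightarrow> real" where
  "partial i F x = frechet_derivative F (at x) (axis i 1)"

definition metric_comp ::
    "('a, 'n::finite) chart \<Rightarrow> ('a, 'n) bilinear_field \<Rightarrow> 'n \<Rightarrow> 'n \<Rightarrow> real ^ 'n \<Rightarrow> real" where
  "metric_comp c g i j x = g c (point_of c x) $ i $ j"

definition inverse_metric_comp ::
    "('a, 'n::finite) chart \<Rightarrow> ('a, 'n) bilinear_field \<Rightarrow> 'n \<Rightarrow> 'n \<Rightarrow> real ^ 'n \<Rightarrow> real" where
  "inverse_metric_comp c g i j x = matrix_inv (g c (point_of c x)) $ i $ j"

text \<open>\<open>christoffel c g k i j\<close> has \<open>k\<close> as its upper index.\<close>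

definition christoffel ::
    "('a, 'n::finite) chart \<Rightarrow> ('a, 'n) bilinear_field \<Rightarrow> 'n \<Rightarrow> 'n \<Rightarrow> 'n \<Rightarrow> real ^ 'n \<Rightarrow> real" where
  "christoffel c g k i j x =
     (1 / 2) * (\<Sum>l\<in>UNIV. inverse_metric_comp c g k l x *
        (partial i (metric_comp c g j l) x + partial j (metric_comp c g i l) x
          - partial l (metric_comp c g i j) x))"

text \<open>
  \<open>riemann c g l i j k\<close> is the coefficient of the \<open>l\<close>-th coordinate field in the value at the
  \<open>k\<close>-th coordinate field of the curvature operator
  \<open>R(\<partial>\<^sub>i, \<partial>\<^sub>j) = \<nabla>\<^sub>i \<nabla>\<^sub>j - \<nabla>\<^sub>j \<nabla>\<^sub>i\<close>. With this sign the trace over \<open>i = l\<close> is positive on round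
  spheres.
\<close>

definition riemann ::
    "('a, 'n::finite) chart \<Rightarrow> ('a, 'n) bilinear_field \<Rightarrow> 'n \<Rightarrow> 'n \<Rightarrow> 'n \<Rightarrow> 'n \<Rightarrow> real ^ 'n \<Rightarrow> real" where
  "riemann c g l i j k x =
     partial i (christoffel c g l j k) x - partial j (christoffel c g l i k) x
     + (\<Sum>m\<in>UNIV. christoffel c g l i m x * christoffel c g m j k x
                  - christoffel c g l j m x * christoffel c g m i k x)"

definition ricci :: "('a, 'n::finite) bilinear_field \<Rightarrow> ('a, 'n) bilinear_field" where
  "ricci g c p = (\<chi> j k. \<Sum>i\<in>UNIV. riemann c g i i j k (coords c p))"

definition gradient ::
    "('a, 'n::finite) chart \<Rightarrow> ('a, 'n) bilinear_field \<Rightarrow> ('a \<Rightarrow> real) \<Rightarrow> 'a \<Rightarrow> real ^ 'n" where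
  "gradient c g f p =
     matrix_inv (g c p) *v (\<chi> i. partial i (\<lambda>x. f (point_of c x)) (coords c p))"

definition grad_norm_sq ::
    "('a, 'n::finite) chart \<Rightarrow> ('a, 'n) bilinear_field \<Rightarrow> ('a \<Rightarrow> real) \<Rightarrow> 'a \<Rightarrow> real" where
  "grad_norm_sq c g f p = gradient c g f p \<bullet> (g c p *v gradient c g f p)"

definition hessian ::
    "('a, 'n::finite) chart \<Rightarrow> ('a, 'n) bilinear_field \<Rightarrow> ('a \<Rightarrow> real) \<Rightarrow> 'n \<Rightarrow> 'n \<Rightarrow> real ^ 'n \<Rightarrow> real" where
  "hessian c g f i j x =
     partial i (partial j (\<lambda>y. f (point_of c y))) x
     - (\<Sum>k\<in>UNIV. christoffel c g k i j x * partial k (\<lambda>y. f (point_of c y)) x)"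

definition laplacian ::
    "('a, 'n::finite) chart \<Rightarrow> ('a, 'n) bilinear_field \<Rightarrow> ('a \<Rightarrow> real) \<Rightarrow> 'a \<Rightarrow> real" where
  "laplacian c g f p =
     (\<Sum>i\<in>UNIV. \<Sum>j\<in>UNIV. inverse_metric_comp c g i j (coords c p) * hessian c g f i j (coords c p))"


section \<open>Ricci flow\<close>

definition time_deriv :: "real \<Rightarrow> (real \<Rightarrow> 'a \<Rightarrow> real) \<Rightarrow> real \<Rightarrow> 'a \<Rightarrow> real" where
  "time_deriv T u t p = vector_derivative (\<lambda>s. u s p) (at t within {0..T})"

definition ricci_flow ::
    "('a, 'n::finite) chart set \<Rightarrow> real \<Rightarrow> (real \<Rightarrow> ('a, 'n) bilinear_field) \<Rightarrow> bool" where
  "ricci_flow A T g \<longleftrightarrow>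
     smooth_family_of_metrics A T g \<and>
     (\<forall>t\<in>{0..T}. \<forall>c\<in>A. \<forall>p\<in>dom_of c.
        ((\<lambda>s. g s c p) has_vector_derivative (-2) *\<^sub>R ricci (g t) c p) (at t within {0..T}))"

definition bilinear_le ::
    "('a, 'n::finite) chart set \<Rightarrow> ('a, 'n) bilinear_field \<Rightarrow> ('a, 'n) bilinear_field \<Rightarrow> bool" where
  "bilinear_le A h k \<longleftrightarrow>
     (\<forall>c\<in>A. \<forall>p\<in>dom_of c. \<forall>v. v \<bullet> (h c p *v v) \<le> v \<bullet> (k c p *v v))"

end

theory Submission
  imports Defs
begin

text \<open>
  Put \<open>f = ln u\<close> and \<open>h = \<Delta> f\<close>. The equation for \<open>u\<close> becomes
  \<open>f\<^sub>t = \<Delta> f + |\<nabla>f|\<^sup>2 - q - a f\<close>, so the left-hand side of the estimate is just \<open>-h\<close>. Under the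
  Ricci flow \<open>\<partial>\<^sub>t (\<Delta> f) = \<Delta> f\<^sub>t + 2 \<langle>Ric, \<nabla>\<^sup>2 f\<rangle>\<close>, where the contracted Bianchi identity cancels the
  derivatives of \<open>Ric\<close>; together with the Bochner formula this gives
  \<open>h\<^sub>t = \<Delta> h + 2 \<langle>\<nabla>f, \<nabla>h\<rangle> + 2 |\<nabla>\<^sup>2 f|\<^sup>2 + 2 \<langle>Ric, \<nabla>\<^sup>2 f\<rangle> + 2 Ric(\<nabla>f, \<nabla>f) - \<Delta> q - a h\<close>.
  Completing the square and using \<open>0 \<le> Ric \<le> K g\<close>, the two middle terms are at least
  \<open>2/n (h + R/2)\<^sup>2 - n K\<^sup>2 / 2\<close> with \<open>0 \<le> R \<le> n K\<close>. If \<open>\<kappa>\<close> denotes the part of the bound that does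
  not depend on \<open>t\<close>, a maximum of \<open>t (-h - \<kappa>)\<close> over \<open>M \<times> [0, t\<^sub>1]\<close> with \<open>t\<^sub>1 < T\<close> which exceeds \<open>n/2\<close>
  contradicts this inequality. The time \<open>T\<close> itself is reached by continuity.
\<close>

section \<open>Smooth functions on open sets\<close>

text \<open>Tensor identities are proved on open sets of space-time, where derivatives are two-sided
  and time is one more direction; up to the end times only continuity is kept. In a chart the
  connection is one matrix per direction, which turns metric compatibility, the Bianchi identity and
  the evolution equations into matrix identities. The divergence sees the connection only through
  traces, the logarithmic derivatives of the volume density, so the evolution of a single
  Christoffel symbol is never computed. Although \<open>h\<close> is computed in charts, the maximum
  is global: the equation trades the Laplacian of \<open>u\<close> for its time derivative, and only
  the norm of the gradient has to be compared between charts. In \<open>\<kappa>\<close> one half of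
  \<open>n K\<close> absorbs \<open>R / 2\<close> and the other half the defect
  \<open>n K^2 / 2\<close>; \<open>sqrt (n \<theta>)\<close> absorbs the bound on the Laplacian of
  \<open>q\<close>, and \<open>n |a| / 2\<close> the term \<open>a h\<close>. At a maximum this
  leaves \<open>2 x^2 / n <= x / t\<close> for \<open>x = - h - \<kappa>\<close>.\<close>

abbreviation dd :: "'v::real_normed_vector \<Rightarrow> ('v \<Rightarrow> 'w::real_normed_vector) \<Rightarrow> 'v \<Rightarrow> 'w" where
  "dd v f x \<equiv> frechet_derivative f (at x) v"

lemma has_derivative_within_cong:
  assumes "x \<in> S" "\<And>y. y \<in> S \<Longrightarrow> f y = g y"
  shows "(f has_derivative f') (at x within S) \<longleftrightarrow> (g has_derivative f') (at x within S)"
  using has_derivative_transform[OF assms(1), of f g f'] has_derivative_transform[OF assms(1), of g f f']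
    assms(2) by auto

lemma frechet_derivative_within_cong:
  assumes "x \<in> S" "\<And>y. y \<in> S \<Longrightarrow> f y = g y"
  shows "frechet_derivative f (at x within S) = frechet_derivative g (at x within S)"
  using has_derivative_within_cong[OF assms] unfolding frechet_derivative_def by simp

lemma dd_cong:
  assumes "open W" "x \<in> W" "\<And>y. y \<in> W \<Longrightarrow> f y = g y"
  shows "dd v f x = dd v g x"
  using frechet_derivative_within_cong[OF assms(2,3)] at_within_open[OF assms(2,1)] by simp

lemma Ck_on_cong:
  assumes "Ck_on k S f" "\<And>x. x \<in> S \<Longrightarrow> f x = g x"
  shows "Ck_on k S g"
  using assms
proof (induction k arbitrary: f g)
  case 0
  then show ?case by (simp cong: continuous_on_cong)
next
  case (Suc k)
  have "g differentiable_on S"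
    using Suc.prems has_derivative_within_cong[of _ S f g]
    unfolding differentiable_on_def differentiable_def Ck_on.simps by auto
  moreover have "Ck_on k S (\<lambda>x. frechet_derivative g (at x within S) v)" for v
  proof (rule Suc.IH)
    show "Ck_on k S (\<lambda>x. frechet_derivative f (at x within S) v)"
      using Suc.prems by simp
    show "frechet_derivative f (at x within S) v = frechet_derivative g (at x within S) v"
      if "x \<in> S" for x
      using frechet_derivative_within_cong[OF that Suc.prems(2)] by simp
  qed
  ultimately show ?case by simp
qed

lemma Ck_on_SucD: "Ck_on (Suc k) S f \<Longrightarrow> Ck_on k S f"
proof (induction k arbitrary: f)
  case 0
  then show ?case by (simp add: differentiable_imp_continuous_on)
next
  case (Suc k)
  then show ?case by (metis Ck_on.simps(2))
qed

text \<open>At points of an open set the derivative within the set is the ordinary one, so all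
  calculus below can be done with \<open>dd\<close>.\<close>

lemma Ck_on_Suc_open:
  assumes "open S"
  shows "Ck_on (Suc k) S f \<longleftrightarrow> f differentiable_on S \<and> (\<forall>v. Ck_on k S (dd v f))"
proof -
  have "Ck_on k S (\<lambda>x. frechet_derivative f (at x within S) v) \<longleftrightarrow> Ck_on k S (dd v f)" for v
    using Ck_on_cong[of k S "\<lambda>x. frechet_derivative f (at x within S) v" "dd v f"]
      Ck_on_cong[of k S "dd v f" "\<lambda>x. frechet_derivative f (at x within S) v"]
      at_within_open[OF _ assms] by auto
  then show ?thesis by simp
qed

text \<open>\<open>S\<close> need not be open: the lemma passes from a chart times a closed time
  interval to the open slab of interior times, where derivatives become two-sided.\<close>

lemma Ck_on_subset_open:
  assumes "Ck_on k S f" "open W" "W \<subseteq> S"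
  shows "Ck_on k W f"
  using assms(1)
proof (induction k arbitrary: f)
  case 0
  then show ?case using assms(3) continuous_on_subset by auto
next
  case (Suc k)
  have "Ck_on k W (dd v f)" for v
  proof (rule Ck_on_cong)
    show "Ck_on k W (\<lambda>x. frechet_derivative f (at x within S) v)"
      using Suc by simp
    show "frechet_derivative f (at x within S) v = dd v f x" if "x \<in> W" for x
      using that assms by (metis at_within_interior interior_maximal subsetD)
  qed
  moreover have "f differentiable_on W"
    using Suc.prems assms(3) differentiable_on_subset by auto
  ultimately show ?case using Ck_on_Suc_open[OF assms(2)] by blast
qed

lemma smooth_on_subset_open: "smooth_on S f \<Longrightarrow> open W \<Longrightarrow> W \<subseteq> S \<Longrightarrow> smooth_on W f"
  unfolding smooth_on_def using Ck_on_subset_open by blast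

lemma smooth_on_cong: "smooth_on S f \<Longrightarrow> (\<And>x. x \<in> S \<Longrightarrow> f x = g x) \<Longrightarrow> smooth_on S g"
  unfolding smooth_on_def using Ck_on_cong by blast

lemma smooth_on_imp_continuous_on: "smooth_on S f \<Longrightarrow> continuous_on S f"
  unfolding smooth_on_def using Ck_on.simps(1) by blast

lemma smooth_on_imp_differentiable_within:
  "smooth_on S f \<Longrightarrow> x \<in> S \<Longrightarrow> f differentiable (at x within S)"
  unfolding smooth_on_def differentiable_on_def using Ck_on.simps(2) differentiable_on_def by blast

lemma smooth_on_frechet_derivative_within:
  "smooth_on S f \<Longrightarrow> smooth_on S (\<lambda>x. frechet_derivative f (at x within S) v)"
  unfolding smooth_on_def using Ck_on.simps(2) by blast

lemma smooth_on_dd: "open S \<Longrightarrow> smooth_on S f \<Longrightarrow> smooth_on S (dd v f)"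
  unfolding smooth_on_def using Ck_on_Suc_open by blast

lemma smooth_on_imp_differentiable:
  "open S \<Longrightarrow> smooth_on S f \<Longrightarrow> x \<in> S \<Longrightarrow> f differentiable (at x)"
  using smooth_on_imp_differentiable_within at_within_open by metis

lemma smooth_on_has_derivative:
  "open S \<Longrightarrow> smooth_on S f \<Longrightarrow> x \<in> S \<Longrightarrow> (f has_derivative (\<lambda>v. dd v f x)) (at x)"
  using smooth_on_imp_differentiable frechet_derivative_works by blast

lemma has_derivative_imp_dd: "(f has_derivative f') (at x) \<Longrightarrow> dd v f x = f' v"
  using frechet_derivative_at by metis

lemma differentiable_onI_open:
  "open S \<Longrightarrow> (\<And>x. x \<in> S \<Longrightarrow> (f has_derivative f' x) (at x)) \<Longrightarrow> f differentiable_on S"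
  by (meson differentiableI differentiable_at_withinI differentiable_on_def)

text \<open>Any explicit formula for the derivative may be used to climb one order, without
  mentioning the chosen \<open>frechet_derivative\<close>.\<close>

lemma Ck_on_SucI_open:
  assumes "open S" "\<And>x. x \<in> S \<Longrightarrow> (f has_derivative f' x) (at x)"
    "\<And>v. Ck_on k S (\<lambda>x. f' x v)"
  shows "Ck_on (Suc k) S f"
  unfolding Ck_on_Suc_open[OF assms(1)]
proof (intro conjI allI)
  show "f differentiable_on S" using assms differentiable_onI_open by blast
  show "Ck_on k S (dd v f)" for v
    by (rule Ck_on_cong[OF assms(3)[of v]]) (use assms(2) has_derivative_imp_dd in metis)
qed

lemma Ck_on_has_derivative_open:
  assumes "open S" "Ck_on (Suc k) S f" "x \<in> S"
  shows "(f has_derivative (\<lambda>v. dd v f x)) (at x)"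
  using assms Ck_on_Suc_open differentiable_on_def frechet_derivative_works
  by (metis at_within_open)

lemma Ck_on_const: "open S \<Longrightarrow> Ck_on k S (\<lambda>x. c)"
proof (induction k arbitrary: c)
  case (Suc k)
  then show ?case
    using Ck_on_SucI_open[of S "\<lambda>x. c" "\<lambda>x v. 0"] by simp
qed simp

lemma Ck_on_add:
  assumes "open S" "Ck_on k S f" "Ck_on k S g"
  shows "Ck_on k S (\<lambda>x. f x + g x)"
  using assms(2,3)
proof (induction k arbitrary: f g)
  case 0
  then show ?case by (simp add: continuous_on_add)
next
  case (Suc k)
  show ?case
  proof (rule Ck_on_SucI_open[OF assms(1)])
    show "((\<lambda>x. f x + g x) has_derivative (\<lambda>v. dd v f x + dd v g x)) (at x)" if "x \<in> S" for x
      using Suc.prems that by (intro has_derivative_add Ck_on_has_derivative_open[OF assms(1)])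
    show "Ck_on k S (\<lambda>x. dd v f x + dd v g x)" for v
      using Suc Ck_on_Suc_open[OF assms(1)] by blast
  qed
qed

lemma Ck_on_bounded_linear:
  assumes "open S" "bounded_linear L" "Ck_on k S f"
  shows "Ck_on k S (\<lambda>x. L (f x))"
  using assms(3)
proof (induction k arbitrary: f)
  case 0
  then show ?case using bounded_linear.continuous_on[OF assms(2)] by simp
next
  case (Suc k)
  show ?case
  proof (rule Ck_on_SucI_open[OF assms(1)])
    show "((\<lambda>x. L (f x)) has_derivative (\<lambda>v. L (dd v f x))) (at x)" if "x \<in> S" for x
      using Suc.prems that
      by (intro bounded_linear.has_derivative[OF assms(2)] Ck_on_has_derivative_open[OF assms(1)])
    show "Ck_on k S (\<lambda>x. L (dd v f x))" for v
      using Suc Ck_on_Suc_open[OF assms(1)] by blast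
  qed
qed

text \<open>The product rule pairs one function with a derivative of the other, so the induction
  runs over all pairs at once. Products of scalars, matrices and vectors, scalings and inner
  products are all instances.\<close>

lemma Ck_on_bounded_bilinear:
  assumes "open S" "bounded_bilinear B" "Ck_on k S f" "Ck_on k S g"
  shows "Ck_on k S (\<lambda>x. B (f x) (g x))"
  using assms(3,4)
proof (induction k arbitrary: f g)
  case 0
  then show ?case using bounded_bilinear.continuous_on[OF assms(2)] by simp
next
  case (Suc k)
  show ?case
  proof (rule Ck_on_SucI_open[OF assms(1)])
    show "((\<lambda>x. B (f x) (g x)) has_derivative (\<lambda>v. B (f x) (dd v g x) + B (dd v f x) (g x))) (at x)"
      if "x \<in> S" for x
      using Suc.prems that
      by (intro bounded_bilinear.FDERIV[OF assms(2)] Ck_on_has_derivative_open[OF assms(1)])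
    show "Ck_on k S (\<lambda>x. B (f x) (dd v g x) + B (dd v f x) (g x))" for v
    proof -
      have "Ck_on k S f" "Ck_on k S g" "Ck_on k S (dd v f)" "Ck_on k S (dd v g)"
        using Suc.prems Ck_on_SucD Ck_on_Suc_open[OF assms(1)] by blast+
      then show ?thesis
        using Suc.IH by (intro Ck_on_add[OF assms(1)])
    qed
  qed
qed

text \<open>The derivative is a product of \<open>inverse f\<close>, a derivative of
  \<open>f\<close>, and \<open>inverse f\<close> again; the induction hypothesis applies to the
  reciprocal itself.\<close>

lemma Ck_on_inverse:
  fixes f :: "'v::real_normed_vector \<Rightarrow> real"
  assumes "open S" "Ck_on k S f" "\<And>x. x \<in> S \<Longrightarrow> f x \<noteq> 0"
  shows "Ck_on k S (\<lambda>x. inverse (f x))"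
  using assms(2)
proof (induction k)
  case 0
  then show ?case using assms(3) by (simp add: continuous_on_inverse)
next
  case (Suc k)
  note mult = Ck_on_bounded_bilinear[OF assms(1) bounded_bilinear_mult]
  show ?case
  proof (rule Ck_on_SucI_open[OF assms(1)])
    show "((\<lambda>x. inverse (f x)) has_derivative (\<lambda>v. - (inverse (f x) * dd v f x * inverse (f x)))) (at x)"
      if "x \<in> S" for x
      using Deriv.has_derivative_inverse[OF assms(3)[OF that]
          Ck_on_has_derivative_open[OF assms(1) Suc.prems that]] .
    show "Ck_on k S (\<lambda>x. - (inverse (f x) * dd v f x * inverse (f x)))" for v
    proof -
      have "Ck_on k S (\<lambda>x. inverse (f x))" "Ck_on k S (dd v f)"
        using Suc.prems Suc.IH Ck_on_SucD Ck_on_Suc_open[OF assms(1)] by blast+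
      then show ?thesis
        by (intro Ck_on_bounded_linear[OF assms(1) bounded_linear_minus[OF bounded_linear_ident]] mult)
    qed
  qed
qed

lemma Ck_on_ln:
  fixes f :: "'v::real_normed_vector \<Rightarrow> real"
  assumes "open S" "Ck_on k S f" "\<And>x. x \<in> S \<Longrightarrow> f x > 0"
  shows "Ck_on k S (\<lambda>x. ln (f x))"
proof (cases k)
  case 0
  then show ?thesis using assms(2,3)
    by (auto intro!: continuous_on_ln) (metis less_irrefl)
next
  case (Suc k')
  note mult = Ck_on_bounded_bilinear[OF assms(1) bounded_bilinear_mult]
  show ?thesis unfolding Suc
  proof (rule Ck_on_SucI_open[OF assms(1)])
    show "((\<lambda>x. ln (f x)) has_derivative (\<lambda>v. dd v f x * inverse (f x))) (at x)"
      if "x \<in> S" for x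
      using Ck_on_has_derivative_open[OF assms(1)] assms that unfolding Suc
      by (intro has_derivative_ln) blast+
    show "Ck_on k' S (\<lambda>x. dd v f x * inverse (f x))" for v
    proof -
      have "Ck_on k' S f" "Ck_on k' S (dd v f)"
        using assms(2) Ck_on_SucD Ck_on_Suc_open[OF assms(1)] unfolding Suc by blast+
      moreover have "f x \<noteq> 0" if "x \<in> S" for x
        using assms(3) that by force
      ultimately show ?thesis
        by (intro mult Ck_on_inverse[OF assms(1)]) auto
    qed
  qed
qed

lemma smooth_on_const [simp]: "open S \<Longrightarrow> smooth_on S (\<lambda>x. c)"
  by (simp add: smooth_on_def Ck_on_const)

lemma smooth_on_add:
  "open S \<Longrightarrow> smooth_on S f \<Longrightarrow> smooth_on S g \<Longrightarrow> smooth_on S (\<lambda>x. f x + g x)"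
  by (simp add: smooth_on_def Ck_on_add)

lemma smooth_on_bounded_linear:
  "open S \<Longrightarrow> bounded_linear L \<Longrightarrow> smooth_on S f \<Longrightarrow> smooth_on S (\<lambda>x. L (f x))"
  by (simp add: smooth_on_def Ck_on_bounded_linear)

lemma smooth_on_bounded_bilinear:
  "open S \<Longrightarrow> bounded_bilinear B \<Longrightarrow> smooth_on S f \<Longrightarrow> smooth_on S g \<Longrightarrow>
    smooth_on S (\<lambda>x. B (f x) (g x))"
  by (simp add: smooth_on_def Ck_on_bounded_bilinear)

lemma smooth_on_inverse:
  fixes f :: "'v::real_normed_vector \<Rightarrow> real"
  shows "open S \<Longrightarrow> smooth_on S f \<Longrightarrow> (\<And>x. x \<in> S \<Longrightarrow> f x \<noteq> 0) \<Longrightarrow> smooth_on S (\<lambda>x. inverse (f x))"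
  by (simp add: smooth_on_def Ck_on_inverse)

lemma smooth_on_ln:
  fixes f :: "'v::real_normed_vector \<Rightarrow> real"
  shows "open S \<Longrightarrow> smooth_on S f \<Longrightarrow> (\<And>x. x \<in> S \<Longrightarrow> f x > 0) \<Longrightarrow> smooth_on S (\<lambda>x. ln (f x))"
  by (simp add: smooth_on_def Ck_on_ln)

lemma smooth_on_minus: "open S \<Longrightarrow> smooth_on S f \<Longrightarrow> smooth_on S (\<lambda>x. - f x)"
  using smooth_on_bounded_linear[OF _ bounded_linear_minus[OF bounded_linear_ident]] by blast

lemma smooth_on_diff:
  "open S \<Longrightarrow> smooth_on S f \<Longrightarrow> smooth_on S g \<Longrightarrow> smooth_on S (\<lambda>x. f x - g x)"
  using smooth_on_add[of S f "\<lambda>x. - g x"] smooth_on_minus by force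

lemma smooth_on_sum:
  assumes "open S" "finite I" "\<And>i. i \<in> I \<Longrightarrow> smooth_on S (f i)"
  shows "smooth_on S (\<lambda>x. \<Sum>i\<in>I. f i x)"
  using assms(2,3) by (induction I) (simp_all add: assms(1) smooth_on_add)

lemma smooth_on_mult:
  fixes f g :: "'v::real_normed_vector \<Rightarrow> real"
  shows "open S \<Longrightarrow> smooth_on S f \<Longrightarrow> smooth_on S g \<Longrightarrow> smooth_on S (\<lambda>x. f x * g x)"
  by (rule smooth_on_bounded_bilinear[OF _ bounded_bilinear_mult])

lemma smooth_on_prod:
  fixes f :: "'i \<Rightarrow> 'v::real_normed_vector \<Rightarrow> real"
  assumes "open S" "finite I" "\<And>i. i \<in> I \<Longrightarrow> smooth_on S (f i)"
  shows "smooth_on S (\<lambda>x. \<Prod>i\<in>I. f i x)"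
  using assms(2,3) by (induction I) (simp_all add: assms(1) smooth_on_mult)

section \<open>Matrix-valued functions and the inverse matrix\<close>

lemma bounded_linear_axis: "bounded_linear (axis i :: 'b::euclidean_space \<Rightarrow> 'b ^ 'n::finite)"
  by (intro linear_conv_bounded_linear[THEN iffD1] linearI) (auto simp: axis_def vec_eq_iff)

lemma vec_lambda_eq_sum_axis: "(\<chi> i. a i) = (\<Sum>i\<in>UNIV. axis i (a i :: 'b::comm_monoid_add))"
  by (simp add: vec_eq_iff axis_def)

lemma smooth_on_vec_nth: "open S \<Longrightarrow> smooth_on S f \<Longrightarrow> smooth_on S (\<lambda>x. f x $ i)"
  by (rule smooth_on_bounded_linear[OF _ bounded_linear_vec_nth])

lemma smooth_on_vec_lambda:
  fixes f :: "'n::finite \<Rightarrow> 'v::real_normed_vector \<Rightarrow> 'b::euclidean_space"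
  shows "open S \<Longrightarrow> (\<And>i. smooth_on S (f i)) \<Longrightarrow> smooth_on S (\<lambda>x. \<chi> i. f i x)"
  unfolding vec_lambda_eq_sum_axis
  by (intro smooth_on_sum smooth_on_bounded_linear[OF _ bounded_linear_axis]) auto

lemma bounded_bilinear_matrix_mult:
  "bounded_bilinear ((**) :: real^'n::finite^'m::finite \<Rightarrow> real^'k::finite^'n \<Rightarrow> real^'k^'m)"
  unfolding bilinear_conv_bounded_bilinear[symmetric] bilinear_def
  by (auto intro!: linearI simp: matrix_matrix_mult_def vec_eq_iff sum.distrib algebra_simps sum_distrib_left)

lemma bounded_bilinear_matrix_vector_mult:
  "bounded_bilinear ((*v) :: real^'n::finite^'m::finite \<Rightarrow> real^'n \<Rightarrow> real^'m)"
  unfolding bilinear_conv_bounded_bilinear[symmetric] bilinear_def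
  by (auto intro!: linearI simp: matrix_vector_mult_def vec_eq_iff sum.distrib algebra_simps sum_distrib_left)

lemma bounded_linear_transpose:
  "bounded_linear (transpose :: real^'n::finite^'m::finite \<Rightarrow> real^'m^'n)"
  by (intro linear_conv_bounded_linear[THEN iffD1] linearI) (auto simp: transpose_def vec_eq_iff)

text \<open>Cramer's rule writes each entry of the inverse as a polynomial in the entries divided by
  the determinant, from which smoothness and continuity can be read off.\<close>

lemma matrix_inv_component_cramer:
  fixes B :: "real^'n::finite^'n"
  assumes "det B \<noteq> 0"
  shows "matrix_inv B $ k $ j =
    det (\<chi> i l. if l = k then axis j 1 $ i else B $ i $ l) * inverse (det B)"
proof -
  have "B ** matrix_inv B = mat 1"
    using assms invertible_det_nz[of B] unfolding invertible_def matrix_inv_def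
    by (metis (mono_tags, lifting) someI_ex)
  then have "B *v (matrix_inv B *v axis j 1) = axis j 1"
    by (simp add: matrix_vector_mul_assoc)
  then have "matrix_inv B *v axis j 1 =
      (\<chi> k. det (\<chi> i l. if l = k then axis j 1 $ i else B $ i $ l) / det B)"
    using cramer[OF assms] by blast
  moreover have "matrix_inv B $ k $ j = (matrix_inv B *v axis j 1) $ k"
    by (simp add: matrix_vector_mult_basis column_def)
  ultimately show ?thesis by (simp add: field_class.field_divide_inverse)
qed

lemma smooth_on_det:
  fixes F :: "'v::real_normed_vector \<Rightarrow> real^'n::finite^'n"
  assumes "open S" "\<And>i j. smooth_on S (\<lambda>x. F x $ i $ j)"
  shows "smooth_on S (\<lambda>x. det (F x))"
  unfolding det_def
  by (intro smooth_on_sum smooth_on_mult smooth_on_prod assms) (auto simp: assms(1))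

lemma smooth_on_matrix_inv:
  fixes F :: "'v::real_normed_vector \<Rightarrow> real^'n::finite^'n"
  assumes "open S" "smooth_on S F" "\<And>x. x \<in> S \<Longrightarrow> invertible (F x)"
  shows "smooth_on S (\<lambda>x. matrix_inv (F x))"
proof -
  have nz: "det (F x) \<noteq> 0" if "x \<in> S" for x
    using that assms(3) invertible_det_nz by blast
  have F: "smooth_on S (\<lambda>x. F x $ i $ j)" for i j
    by (intro smooth_on_vec_nth assms)
  have "smooth_on S (\<lambda>x. matrix_inv (F x) $ k $ j)" for k j
  proof (rule smooth_on_cong)
    have "smooth_on S (\<lambda>x. (\<chi> i l. if l = k then axis j 1 $ i else F x $ i $ l) $ i $ l)" for i l
      using F by (cases "l = k") (auto simp: assms(1))
    then show "smooth_on S (\<lambda>x. det (\<chi> i l. if l = k then axis j 1 $ i else F x $ i $ l) * inverse (det (F x)))"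
      by (intro smooth_on_mult smooth_on_inverse smooth_on_det assms(1) F nz)
  qed (simp add: matrix_inv_component_cramer[OF nz])
  then have "smooth_on S (\<lambda>x. \<chi> k j. matrix_inv (F x) $ k $ j)"
    by (intro smooth_on_vec_lambda assms(1))
  then show ?thesis by simp
qed

text \<open>The set is arbitrary because the inverse metric must be continuous up to the end times,
  on a slab that is not open.\<close>

lemma continuous_on_matrix_inv:
  fixes F :: "'v::topological_space \<Rightarrow> real^'n::finite^'n"
  assumes "continuous_on S F" "\<And>x. x \<in> S \<Longrightarrow> invertible (F x)"
  shows "continuous_on S (\<lambda>x. matrix_inv (F x) $ k $ j)"
proof -
  have nz: "det (F x) \<noteq> 0" if "x \<in> S" for x
    using that assms(2) invertible_det_nz by blast
  have F: "continuous_on S (\<lambda>x. F x $ i $ j)" for i j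
    by (intro continuous_intros assms)
  have det: "continuous_on S (\<lambda>x. det (H x))" if "\<And>i j. continuous_on S (\<lambda>x. H x $ i $ j)"
    for H :: "'v \<Rightarrow> real^'n^'n"
    unfolding det_def by (intro continuous_intros that)
  have "continuous_on S (\<lambda>x. (\<chi> i l. if l = k then axis j 1 $ i else F x $ i $ l) $ i $ l)" for i l
    using F by (cases "l = k") auto
  then have "continuous_on S (\<lambda>x. det (\<chi> i l. if l = k then axis j 1 $ i else F x $ i $ l) * inverse (det (F x)))"
    using nz by (intro continuous_on_mult continuous_on_inverse det F) auto
  then show ?thesis
    by (rule continuous_on_eq) (simp add: matrix_inv_component_cramer[OF nz])
qed

section \<open>Rules for directional derivatives\<close>

lemma dd_bounded_linear:
  assumes "bounded_linear L" "f differentiable (at x)"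
  shows "dd v (\<lambda>x. L (f x)) x = L (dd v f x)"
  using bounded_linear.has_derivative[OF assms(1) assms(2)[unfolded frechet_derivative_works]]
  by (rule has_derivative_imp_dd)

lemma dd_bounded_bilinear:
  assumes "bounded_bilinear B" "f differentiable (at x)" "g differentiable (at x)"
  shows "dd v (\<lambda>x. B (f x) (g x)) x = B (f x) (dd v g x) + B (dd v f x) (g x)"
  using bounded_bilinear.FDERIV[OF assms(1) assms(2,3)[unfolded frechet_derivative_works]]
  by (rule has_derivative_imp_dd)

lemma dd_const [simp]: "dd v (\<lambda>x. c) x = 0"
  using has_derivative_imp_dd[OF has_derivative_const] .

lemma dd_add:
  assumes "f differentiable (at x)" "g differentiable (at x)"
  shows "dd v (\<lambda>x. f x + g x) x = dd v f x + dd v g x"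
  using has_derivative_add[OF assms[unfolded frechet_derivative_works]]
  by (rule has_derivative_imp_dd)

lemma dd_diff:
  assumes "f differentiable (at x)" "g differentiable (at x)"
  shows "dd v (\<lambda>x. f x - g x) x = dd v f x - dd v g x"
  using has_derivative_diff[OF assms[unfolded frechet_derivative_works]]
  by (rule has_derivative_imp_dd)

lemma dd_minus:
  assumes "f differentiable (at x)"
  shows "dd v (\<lambda>x. - f x) x = - dd v f x"
  using has_derivative_minus[OF assms[unfolded frechet_derivative_works]]
  by (rule has_derivative_imp_dd)

lemma dd_sum:
  assumes "\<And>i. i \<in> I \<Longrightarrow> f i differentiable (at x)"
  shows "dd v (\<lambda>x. \<Sum>i\<in>I. f i x) x = (\<Sum>i\<in>I. dd v (f i) x)"
  using has_derivative_sum[of I f, OF assms[unfolded frechet_derivative_works]]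
  by (rule has_derivative_imp_dd)

lemma dd_inverse:
  fixes f :: "'v::real_normed_vector \<Rightarrow> real"
  assumes "f differentiable (at x)" "f x \<noteq> 0"
  shows "dd v (\<lambda>x. inverse (f x)) x = - (inverse (f x) * dd v f x * inverse (f x))"
  using Deriv.has_derivative_inverse[OF assms(2) assms(1)[unfolded frechet_derivative_works]]
  by (rule has_derivative_imp_dd)

lemma dd_ln:
  fixes f :: "'v::real_normed_vector \<Rightarrow> real"
  assumes "f differentiable (at x)" "f x > 0"
  shows "dd v (\<lambda>x. ln (f x)) x = dd v f x * inverse (f x)"
  using has_derivative_ln[OF assms(2) assms(1)[unfolded frechet_derivative_works]]
  by (rule has_derivative_imp_dd)

lemma dd_vec_nth: "f differentiable (at x) \<Longrightarrow> dd v (\<lambda>x. f x $ i) x = dd v f x $ i"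
  by (rule dd_bounded_linear[OF bounded_linear_vec_nth])

section \<open>Symmetry of second derivatives\<close>

lemma smooth_on_line_deriv:
  fixes F :: "'v::real_normed_vector \<Rightarrow> real"
  assumes "open W" "smooth_on W F" "z + r *\<^sub>R v \<in> W"
  shows "((\<lambda>r. F (z + r *\<^sub>R v)) has_real_derivative dd v F (z + r *\<^sub>R v)) (at r)"
proof -
  have "((\<lambda>r. z + r *\<^sub>R v) has_derivative (\<lambda>h. h *\<^sub>R v)) (at r)"
    by (auto intro!: derivative_eq_intros)
  from has_derivative_compose[OF this smooth_on_has_derivative[OF assms]]
  have "((\<lambda>r. F (z + r *\<^sub>R v)) has_derivative (\<lambda>h. dd (h *\<^sub>R v) F (z + r *\<^sub>R v))) (at r)" .
  moreover have "dd (h *\<^sub>R v) F (z + r *\<^sub>R v) = dd v F (z + r *\<^sub>R v) * h" for h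
    using has_derivative_bounded_linear[OF smooth_on_has_derivative[OF assms]]
    by (simp add: linear_cmul bounded_linear.linear)
  ultimately show ?thesis
    by (simp add: has_field_derivative_def)
qed

text \<open>The mean value theorem is applied twice: along \<open>v\<close> to the difference of
  \<open>F\<close> across \<open>s w\<close>, then along \<open>w\<close> to the derivative
  \<open>dd v F\<close>.\<close>

lemma second_difference_mvt:
  fixes F :: "'v::real_normed_vector \<Rightarrow> real"
  assumes "open W" "smooth_on W F" "0 < s"
    and "\<And>a b. 0 \<le> a \<Longrightarrow> a \<le> s \<Longrightarrow> 0 \<le> b \<Longrightarrow> b \<le> s \<Longrightarrow> z + a *\<^sub>R v + b *\<^sub>R w \<in> W"
  obtains a b where "0 < a" "a < s" "0 < b" "b < s"
    "F (z + s *\<^sub>R v + s *\<^sub>R w) - F (z + s *\<^sub>R v) - F (z + s *\<^sub>R w) + F z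
      = s\<^sup>2 * dd w (dd v F) (z + a *\<^sub>R v + b *\<^sub>R w)"
proof -
  have "((\<lambda>r. F (z + s *\<^sub>R w + r *\<^sub>R v) - F (z + r *\<^sub>R v)) has_real_derivative
      dd v F (z + s *\<^sub>R w + r *\<^sub>R v) - dd v F (z + r *\<^sub>R v)) (at r)" if "0 \<le> r" "r \<le> s" for r
    using assms(4)[OF that, of 0] assms(4)[OF that, of s] assms(3)
    by (intro DERIV_diff smooth_on_line_deriv[OF assms(1,2)]) (auto simp: algebra_simps)
  from MVT2[OF assms(3) this] obtain a where a: "0 < a" "a < s"
    "F (z + s *\<^sub>R w + s *\<^sub>R v) - F (z + s *\<^sub>R v) - (F (z + s *\<^sub>R w) - F z)
      = s * (dd v F (z + s *\<^sub>R w + a *\<^sub>R v) - dd v F (z + a *\<^sub>R v))"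
    by auto
  have "((\<lambda>r. dd v F (z + a *\<^sub>R v + r *\<^sub>R w)) has_real_derivative
      dd w (dd v F) (z + a *\<^sub>R v + r *\<^sub>R w)) (at r)" if "0 \<le> r" "r \<le> s" for r
    using assms(4)[of a r] a that
    by (intro smooth_on_line_deriv[OF assms(1) smooth_on_dd[OF assms(1,2)]]) auto
  from MVT2[OF assms(3) this] obtain b where b: "0 < b" "b < s"
    "dd v F (z + a *\<^sub>R v + s *\<^sub>R w) - dd v F (z + a *\<^sub>R v)
      = s * dd w (dd v F) (z + a *\<^sub>R v + b *\<^sub>R w)"
    by auto
  have "F (z + s *\<^sub>R v + s *\<^sub>R w) - F (z + s *\<^sub>R v) - F (z + s *\<^sub>R w) + F z
      = s\<^sup>2 * dd w (dd v F) (z + a *\<^sub>R v + b *\<^sub>R w)"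
    using a(3) b(3) by (simp add: power2_eq_square algebra_simps)
  with a b that show ?thesis by blast
qed

text \<open>The second difference over a small parallelogram is symmetric in \<open>v\<close> and
  \<open>w\<close>, and both mixed derivatives, taken at nearby points, represent it. Continuity
  brings the points back to \<open>z\<close>.\<close>

lemma dd_commute_real:
  fixes F :: "'v::real_normed_vector \<Rightarrow> real"
  assumes W: "open W" and F: "smooth_on W F" and z: "z \<in> W"
  shows "dd w (dd v F) z = dd v (dd w F) z"
proof (rule ccontr)
  assume neq: "dd w (dd v F) z \<noteq> dd v (dd w F) z"
  \<comment> \<open>Half of the supposed gap: two equal numbers, each closer than \<open>e\<close>
    to one of the two values at \<open>z\<close>, leave no room for the gap.\<close>
  define e where "e = \<bar>dd w (dd v F) z - dd v (dd w F) z\<bar> / 2"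
  have e: "e > 0" using neq by (simp add: e_def)
  have cont: "isCont (dd w (dd v F)) z" for v w
    using smooth_on_imp_continuous_on[OF smooth_on_dd[OF W smooth_on_dd[OF W F]]] W z
    by (simp add: continuous_on_eq_continuous_at)
  obtain d1 where d1: "d1 > 0" "\<And>x. dist x z < d1 \<Longrightarrow> dist (dd w (dd v F) x) (dd w (dd v F) z) < e"
    using cont e unfolding continuous_at_eps_delta by blast
  obtain d2 where d2: "d2 > 0" "\<And>x. dist x z < d2 \<Longrightarrow> dist (dd v (dd w F) x) (dd v (dd w F) z) < e"
    using cont e unfolding continuous_at_eps_delta by blast
  obtain d3 where d3: "d3 > 0" "ball z d3 \<subseteq> W"
    using W z open_contains_ball by blast
  define d where "d = min d1 (min d2 d3)"
  have d: "d > 0" "d \<le> d1" "d \<le> d2" "d \<le> d3" using d1 d2 d3 by (auto simp: d_def)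
  \<comment> \<open>Small enough for the whole parallelogram to stay within \<open>d / 2\<close> of
    \<open>z\<close>; the summand 1 covers \<open>v = w = 0\<close>.\<close>
  define s where "s = d / (2 * (norm v + norm w + 1))"
  have s: "s > 0" using d by (simp add: s_def pos_add_strict add_nonneg_pos)
  have near: "dist (z + (a *\<^sub>R v + b *\<^sub>R w)) z < d" if "0 \<le> a" "a \<le> s" "0 \<le> b" "b \<le> s" for a b
  proof -
    have "norm (a *\<^sub>R v + b *\<^sub>R w) \<le> a * norm v + b * norm w"
      using that norm_triangle_ineq[of "a *\<^sub>R v" "b *\<^sub>R w"] by simp
    also have "\<dots> \<le> s * norm v + s * norm w"
      using that by (intro add_mono mult_right_mono) auto
    also have "\<dots> \<le> s * (norm v + norm w + 1)"
      using s by (simp add: algebra_simps)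
    also have "\<dots> = d / 2"
      using norm_ge_zero[of v] norm_ge_zero[of w] unfolding s_def by (simp add: field_simps add_nonneg_eq_0_iff)
    finally show ?thesis using d by (simp add: dist_norm)
  qed
  have inW: "z + a *\<^sub>R v + b *\<^sub>R w \<in> W" if "0 \<le> a" "a \<le> s" "0 \<le> b" "b \<le> s" for a b
  proof -
    have "z + (a *\<^sub>R v + b *\<^sub>R w) \<in> ball z d3"
      using near[OF that] d by (simp add: dist_commute)
    then show ?thesis using d3 by (metis add.assoc subsetD)
  qed
  obtain a b where ab: "0 < a" "a < s" "0 < b" "b < s"
    "F (z + s *\<^sub>R v + s *\<^sub>R w) - F (z + s *\<^sub>R v) - F (z + s *\<^sub>R w) + F z
      = s\<^sup>2 * dd w (dd v F) (z + a *\<^sub>R v + b *\<^sub>R w)"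
    using second_difference_mvt[OF W F s inW] by blast
  obtain b' a' where ab': "0 < b'" "b' < s" "0 < a'" "a' < s"
    "F (z + s *\<^sub>R w + s *\<^sub>R v) - F (z + s *\<^sub>R w) - F (z + s *\<^sub>R v) + F z
      = s\<^sup>2 * dd v (dd w F) (z + b' *\<^sub>R w + a' *\<^sub>R v)"
  proof (rule second_difference_mvt[OF W F s, of z w v])
    show "z + a *\<^sub>R w + b *\<^sub>R v \<in> W" if "0 \<le> a" "a \<le> s" "0 \<le> b" "b \<le> s" for a b
      using inW[OF that(3,4,1,2)] by (simp add: add_ac)
  qed blast
  have "s\<^sup>2 * dd w (dd v F) (z + a *\<^sub>R v + b *\<^sub>R w) = s\<^sup>2 * dd v (dd w F) (z + b' *\<^sub>R w + a' *\<^sub>R v)"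
    using ab(5) ab'(5) by (simp add: algebra_simps)
  then have "dd w (dd v F) (z + (a *\<^sub>R v + b *\<^sub>R w)) = dd v (dd w F) (z + (a' *\<^sub>R v + b' *\<^sub>R w))"
    using s by (simp add: add_ac)
  moreover have "dist (dd w (dd v F) (z + (a *\<^sub>R v + b *\<^sub>R w))) (dd w (dd v F) z) < e"
    using near[of a b] ab d d1 by auto
  moreover have "dist (dd v (dd w F) (z + (a' *\<^sub>R v + b' *\<^sub>R w))) (dd v (dd w F) z) < e"
    using near[of a' b'] ab' d d2 by auto
  ultimately show False
    unfolding e_def dist_real_def by argo
qed

text \<open>Pairing with a fixed vector reduces the claim to real functions, and the pairings
  determine the value. It is needed for matrix fields such as the metric and the connection.\<close>

lemma dd_commute:
  fixes F :: "'v::real_normed_vector \<Rightarrow> 'w::real_inner"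
  assumes W: "open W" and F: "smooth_on W F" and z: "z \<in> W"
  shows "dd w (dd v F) z = dd v (dd w F) z"
proof -
  have lin: "bounded_linear (\<lambda>x :: 'w. x \<bullet> c)" for c
    by (rule bounded_linear_inner_left)
  have one: "dd v (\<lambda>x. G x \<bullet> c) x = dd v G x \<bullet> c" if "smooth_on W G" "x \<in> W" for v c x and G :: "'v \<Rightarrow> 'w"
    using dd_bounded_linear[OF lin smooth_on_imp_differentiable[OF W that]] .
  have two: "dd w (dd v (\<lambda>x. F x \<bullet> c)) z = dd w (dd v F) z \<bullet> c" for v w c
  proof -
    have "dd w (dd v (\<lambda>x. F x \<bullet> c)) z = dd w (\<lambda>x. dd v F x \<bullet> c) z"
      by (rule dd_cong[OF W z]) (rule one[OF F])
    also have "\<dots> = dd w (dd v F) z \<bullet> c"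
      by (rule one[OF smooth_on_dd[OF W F] z])
    finally show ?thesis .
  qed
  have "dd w (dd v F) z \<bullet> c = dd v (dd w F) z \<bullet> c" for c
    using dd_commute_real[OF W smooth_on_bounded_linear[OF W lin[of c] F] z, where v = v and w = w]
    unfolding two .
  then show ?thesis
    using vector_eq_rdot by blast
qed

section \<open>The Levi-Civita connection in local coordinates\<close>

interpretation matmul: bounded_bilinear
  "(**) :: real^'n::finite^'m::finite \<Rightarrow> real^'k::finite^'n \<Rightarrow> real^'k^'m"
  by (rule bounded_bilinear_matrix_mult)

interpretation matvec: bounded_bilinear "(*v) :: real^'n::finite^'m::finite \<Rightarrow> real^'n \<Rightarrow> real^'m"
  by (rule bounded_bilinear_matrix_vector_mult)

lemmas matmul_simps = matmul.add_left matmul.add_right matmul.diff_left matmul.diff_right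
  matmul.minus_left matmul.minus_right matrix_mul_assoc

lemma transpose_add: "transpose (A + B) = transpose A + transpose (B :: real^'n::finite^'m::finite)"
  and transpose_diff: "transpose (A - B) = transpose A - transpose (B :: real^'n::finite^'m::finite)"
  by (simp_all add: transpose_def vec_eq_iff)

text \<open>
  The indices of \<open>p m i l k\<close> stand for a curvature tensor with the last two indices raised, and
  \<open>dp\<close> for its partial derivatives.
\<close>

lemma contract_bianchi:
  fixes p :: "'n::finite \<Rightarrow> 'n \<Rightarrow> 'n \<Rightarrow> 'n \<Rightarrow> real"
    and dp :: "'n \<Rightarrow> 'n \<Rightarrow> 'n \<Rightarrow> 'n \<Rightarrow> 'n \<Rightarrow> real" and \<gamma> :: "'n \<Rightarrow> 'n \<Rightarrow> 'n \<Rightarrow> real"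
  assumes bianchi: "\<And>i m. dp m i j i m + (\<Sum>a\<in>UNIV. \<gamma> m i a * p i j a m) + (\<Sum>a\<in>UNIV. p i j i a * \<gamma> m m a)
      + (dp i j m i m + (\<Sum>a\<in>UNIV. \<gamma> i i a * p j m a m) + (\<Sum>a\<in>UNIV. p j m i a * \<gamma> i m a))
      + (dp j m i i m + (\<Sum>a\<in>UNIV. \<gamma> j i a * p m i a m) + (\<Sum>a\<in>UNIV. p m i i a * \<gamma> j m a)) = 0"
    and p1: "\<And>i j l k. p i j l k = - p j i l k" and p2: "\<And>i j l k. p i j l k = - p i j k l"
    and dp1: "\<And>m i j l k. dp m i j l k = - dp m j i l k" and dp2: "\<And>m i j l k. dp m i j l k = - dp m i j k l"
    and \<gamma>: "\<And>i k j. \<gamma> i k j = \<gamma> j k i"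
  shows "2 * (\<Sum>m\<in>UNIV. \<Sum>i\<in>UNIV. dp m i j i m)
      + 2 * (\<Sum>m\<in>UNIV. \<Sum>a\<in>UNIV. \<gamma> m m a * (\<Sum>i\<in>UNIV. p i j i a))
      - 2 * (\<Sum>m\<in>UNIV. \<Sum>a\<in>UNIV. (\<Sum>i\<in>UNIV. p i a i m) * \<gamma> m a j)
    = (\<Sum>m\<in>UNIV. \<Sum>i\<in>UNIV. dp j i m i m)"
proof -
  let ?S = "\<lambda>f :: 'n \<Rightarrow> 'n \<Rightarrow> real. \<Sum>m\<in>UNIV. \<Sum>i\<in>UNIV. f m i"
  have swap: "?S f = ?S (\<lambda>m i. f i m)" for f
    by (rule sum.swap)
  have "?S (\<lambda>m i. dp m i j i m + (\<Sum>a\<in>UNIV. \<gamma> m i a * p i j a m) + (\<Sum>a\<in>UNIV. p i j i a * \<gamma> m m a)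
      + (dp i j m i m + (\<Sum>a\<in>UNIV. \<gamma> i i a * p j m a m) + (\<Sum>a\<in>UNIV. p j m i a * \<gamma> i m a))
      + (dp j m i i m + (\<Sum>a\<in>UNIV. \<gamma> j i a * p m i a m) + (\<Sum>a\<in>UNIV. p m i i a * \<gamma> j m a))) = 0"
    using bianchi by simp
  then have total: "?S (\<lambda>m i. dp m i j i m) + ?S (\<lambda>m i. \<Sum>a\<in>UNIV. \<gamma> m i a * p i j a m)
      + ?S (\<lambda>m i. \<Sum>a\<in>UNIV. p i j i a * \<gamma> m m a)
      + (?S (\<lambda>m i. dp i j m i m) + ?S (\<lambda>m i. \<Sum>a\<in>UNIV. \<gamma> i i a * p j m a m)
        + ?S (\<lambda>m i. \<Sum>a\<in>UNIV. p j m i a * \<gamma> i m a))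
      + (?S (\<lambda>m i. dp j m i i m) + ?S (\<lambda>m i. \<Sum>a\<in>UNIV. \<gamma> j i a * p m i a m)
        + ?S (\<lambda>m i. \<Sum>a\<in>UNIV. p m i i a * \<gamma> j m a)) = 0"
    by (simp only: sum.distrib)
  have pp: "p j m a k = p m j k a" for m a k
    using p1[of j m a k] p2[of m j a k] by simp
  have dpp: "dp i j m a k = dp i m j k a" for i m a k
    using dp1[of i j m a k] dp2[of i m j a k] by simp
  \<comment> \<open>The connection is symmetric in the two summation indices \<open>m\<close> and
    \<open>a\<close> while \<open>p\<close> is antisymmetric in them; exchanging their names shows
    that the sum equals its own negative. The second sum vanishes for the same reason.\<close>
  have 1: "?S (\<lambda>m i. \<Sum>a\<in>UNIV. \<gamma> m i a * p i j a m) = 0"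
  proof -
    let ?X = "?S (\<lambda>m i. \<Sum>a\<in>UNIV. \<gamma> m i a * p i j a m)"
    have "?X = (\<Sum>i\<in>UNIV. \<Sum>m\<in>UNIV. \<Sum>a\<in>UNIV. \<gamma> m i a * p i j a m)" by (rule sum.swap)
    also have "\<dots> = (\<Sum>i\<in>UNIV. \<Sum>a\<in>UNIV. \<Sum>m\<in>UNIV. \<gamma> m i a * p i j a m)" by (intro sum.cong refl sum.swap)
    also have "\<dots> = (\<Sum>i\<in>UNIV. \<Sum>a\<in>UNIV. \<Sum>m\<in>UNIV. - (\<gamma> a i m * p i j m a))"
      by (intro sum.cong refl) (subst p2, subst \<gamma>, simp)
    also have "\<dots> = - ?X"
      unfolding sum_negf by (subst sum.swap) simp
    finally show ?thesis by simp
  qed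
  have 2: "?S (\<lambda>m i. \<Sum>a\<in>UNIV. p j m i a * \<gamma> i m a) = 0"
  proof -
    let ?X = "?S (\<lambda>m i. \<Sum>a\<in>UNIV. p j m i a * \<gamma> i m a)"
    have "?X = (\<Sum>m\<in>UNIV. \<Sum>a\<in>UNIV. \<Sum>i\<in>UNIV. p j m i a * \<gamma> i m a)" by (intro sum.cong refl sum.swap)
    also have "\<dots> = (\<Sum>m\<in>UNIV. \<Sum>a\<in>UNIV. \<Sum>i\<in>UNIV. - (p j m a i * \<gamma> a m i))"
      by (intro sum.cong refl) (subst p2, subst \<gamma>, simp)
    also have "\<dots> = - ?X"
      unfolding sum_negf by simp
    finally show ?thesis by simp
  qed
  \<comment> \<open>Sums 3 and 4 are the same contraction, and so are 5 and 6 and the two derivative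
    sums in 7. These coincidences produce the factors 2 of the claim.\<close>
  have 3: "?S (\<lambda>m i. \<Sum>a\<in>UNIV. p i j i a * \<gamma> m m a)
      = (\<Sum>m\<in>UNIV. \<Sum>a\<in>UNIV. \<gamma> m m a * (\<Sum>i\<in>UNIV. p i j i a))"
  proof -
    have "?S (\<lambda>m i. \<Sum>a\<in>UNIV. p i j i a * \<gamma> m m a) = (\<Sum>m\<in>UNIV. \<Sum>a\<in>UNIV. \<Sum>i\<in>UNIV. p i j i a * \<gamma> m m a)"
      by (intro sum.cong refl sum.swap)
    then show ?thesis by (simp add: sum_distrib_left mult.commute)
  qed
  have 4: "?S (\<lambda>m i. \<Sum>a\<in>UNIV. \<gamma> i i a * p j m a m)
      = (\<Sum>m\<in>UNIV. \<Sum>a\<in>UNIV. \<gamma> m m a * (\<Sum>i\<in>UNIV. p i j i a))"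
  proof -
    have "?S (\<lambda>m i. \<Sum>a\<in>UNIV. \<gamma> i i a * p j m a m) = (\<Sum>i\<in>UNIV. \<Sum>m\<in>UNIV. \<Sum>a\<in>UNIV. \<gamma> i i a * p j m a m)"
      by (rule sum.swap)
    also have "\<dots> = (\<Sum>i\<in>UNIV. \<Sum>a\<in>UNIV. \<Sum>m\<in>UNIV. \<gamma> i i a * p j m a m)" by (intro sum.cong refl sum.swap)
    also have "\<dots> = (\<Sum>i\<in>UNIV. \<Sum>a\<in>UNIV. \<Sum>m\<in>UNIV. \<gamma> i i a * p m j m a)"
      unfolding pp ..
    finally show ?thesis by (simp add: sum_distrib_left)
  qed
  have 5: "?S (\<lambda>m i. \<Sum>a\<in>UNIV. \<gamma> j i a * p m i a m)
      = - (\<Sum>m\<in>UNIV. \<Sum>a\<in>UNIV. (\<Sum>i\<in>UNIV. p i a i m) * \<gamma> m a j)"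
  proof -
    have "?S (\<lambda>m i. \<Sum>a\<in>UNIV. \<gamma> j i a * p m i a m) = ?S (\<lambda>m i. \<Sum>a\<in>UNIV. - (p m i m a * \<gamma> a i j))"
      by (intro sum.cong refl) (subst p2, subst \<gamma>, simp)
    also have "\<dots> = (\<Sum>i\<in>UNIV. \<Sum>a\<in>UNIV. \<Sum>m\<in>UNIV. - (p m i m a * \<gamma> a i j))"
      by (subst sum.swap) (intro sum.cong refl sum.swap)
    also have "\<dots> = (\<Sum>a\<in>UNIV. \<Sum>i\<in>UNIV. \<Sum>m\<in>UNIV. - (p m i m a * \<gamma> a i j))"
      by (rule sum.swap)
    finally show ?thesis by (simp add: sum_distrib_right sum_negf)
  qed
  have 6: "?S (\<lambda>m i. \<Sum>a\<in>UNIV. p m i i a * \<gamma> j m a)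
      = - (\<Sum>m\<in>UNIV. \<Sum>a\<in>UNIV. (\<Sum>i\<in>UNIV. p i a i m) * \<gamma> m a j)"
  proof -
    have "?S (\<lambda>m i. \<Sum>a\<in>UNIV. p m i i a * \<gamma> j m a) = ?S (\<lambda>m i. \<Sum>a\<in>UNIV. - (p i m i a * \<gamma> a m j))"
      by (intro sum.cong refl) (subst p1, subst \<gamma>, simp)
    also have "\<dots> = (\<Sum>m\<in>UNIV. \<Sum>a\<in>UNIV. \<Sum>i\<in>UNIV. - (p i m i a * \<gamma> a m j))"
      by (intro sum.cong refl sum.swap)
    also have "\<dots> = (\<Sum>a\<in>UNIV. \<Sum>m\<in>UNIV. \<Sum>i\<in>UNIV. - (p i m i a * \<gamma> a m j))"
      by (rule sum.swap)
    finally show ?thesis by (simp add: sum_distrib_right sum_negf)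
  qed
  have 7: "?S (\<lambda>m i. dp i j m i m) = ?S (\<lambda>m i. dp m i j i m)"
    unfolding dpp by (rule sum.swap)
  have 8: "?S (\<lambda>m i. dp j m i i m) = - ?S (\<lambda>m i. dp j i m i m)"
    unfolding sum_negf[symmetric] by (intro sum.cong refl) (rule dp1)
  show ?thesis
    using total unfolding 1 2 3 4 5 6 7 8 by linarith
qed

text \<open>The additive part of \<open>bianchi\<close>, with all matrix products as atoms.\<close>

lemma bianchi_group_identity1:
  fixes A :: "'g::ab_group_add"
  shows "A - B + ((c + d) - (f + g)) + ((p - q + (r - s)) - (t - u + (v - w)))
    = A - B + (c + d - f - g) + (p - q - t + u) + (r - s - v + w)"
  by simp

lemma bianchi_group_identity2:
  fixes A :: "'g::ab_group_add"
  shows "A - B + (a + b - c - d) + (p - q - t + u) + (r - s - v + w)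
     + (A' - A + (a' + t - p - d') + (p' - a - t' + d) + (v - s' - v' + s))
     + (B - A' + (q + t' - p' - u) + (c - a' - b + d') + (v' - w - r + s')) = 0"
  by (simp add: algebra_simps)

text \<open>
  \<open>W\<close> will be an open set in space-time, while the \<open>e i\<close> span only the spatial directions. The entry
  \<open>\<Gamma> i z $ k $ j\<close> is the Christoffel symbol with upper index \<open>k\<close> and lower indices \<open>i\<close>, \<open>j\<close>, so that
  \<open>\<Gamma> i z\<close> acts on vectors as the zeroth-order part of the covariant derivative in direction \<open>i\<close>.
\<close>

locale metric_patch =
  fixes W :: "'e::real_normed_vector set" and e :: "'n::finite \<Rightarrow> 'e"
    and G N :: "'e \<Rightarrow> real^'n^'n" and \<Gamma> :: "'n \<Rightarrow> 'e \<Rightarrow> real^'n^'n"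
  assumes open_W: "open W"
    and smooth_G: "smooth_on W G" and smooth_N: "smooth_on W N" and smooth_\<Gamma>: "\<And>i. smooth_on W (\<Gamma> i)"
    and G_sym: "\<And>z. z \<in> W \<Longrightarrow> transpose (G z) = G z"
    and N_G: "\<And>z. z \<in> W \<Longrightarrow> N z ** G z = mat 1" and G_N: "\<And>z. z \<in> W \<Longrightarrow> G z ** N z = mat 1"
    and \<Gamma>_sym: "\<And>z i j k. z \<in> W \<Longrightarrow> \<Gamma> i z $ k $ j = \<Gamma> j z $ k $ i"
    and compatible: "\<And>z i. z \<in> W \<Longrightarrow> dd (e i) G z = transpose (\<Gamma> i z) ** G z + G z ** \<Gamma> i z"
begin

abbreviation D :: "'n \<Rightarrow> ('e \<Rightarrow> 'w::real_normed_vector) \<Rightarrow> 'e \<Rightarrow> 'w" where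
  "D i \<equiv> dd (e i)"

text \<open>The curvature of the connection matrices. Its entry with row \<open>l\<close> and column
  \<open>k\<close> is the coefficient of the \<open>l\<close>-th coordinate field in the curvature
  operator of the directions \<open>i\<close>, \<open>j\<close> applied to the \<open>k\<close>-th
  one.\<close>

definition curv :: "'n \<Rightarrow> 'n \<Rightarrow> 'e \<Rightarrow> real^'n^'n" where
  "curv i j z = D i (\<Gamma> j) z - D j (\<Gamma> i) z + (\<Gamma> i z ** \<Gamma> j z - \<Gamma> j z ** \<Gamma> i z)"

definition Ric :: "'e \<Rightarrow> real^'n^'n" where
  "Ric z = (\<chi> j k. \<Sum>i\<in>UNIV. curv i j z $ i $ k)"

definition cov :: "'n \<Rightarrow> ('e \<Rightarrow> real^'n) \<Rightarrow> 'e \<Rightarrow> real^'n" where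
  "cov i X z = D i X z + \<Gamma> i z *v X z"

definition divg :: "('e \<Rightarrow> real^'n) \<Rightarrow> 'e \<Rightarrow> real" where
  "divg X z = (\<Sum>i\<in>UNIV. cov i X z $ i)"

definition diff :: "('e \<Rightarrow> real) \<Rightarrow> 'e \<Rightarrow> real^'n" where
  "diff F z = (\<chi> i. D i F z)"

definition grad :: "('e \<Rightarrow> real) \<Rightarrow> 'e \<Rightarrow> real^'n" where
  "grad F z = N z *v diff F z"

text \<open>The divergence form is the one suited to the Bochner formula and to time derivatives;
  \<open>lap_eq\<close> gives back the trace of the Hessian.\<close>

definition lap :: "('e \<Rightarrow> real) \<Rightarrow> 'e \<Rightarrow> real" where
  "lap F = divg (grad F)"

lemma smooth_matmul:
  fixes E F :: "'e \<Rightarrow> real^'n^'n"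
  shows "smooth_on W E \<Longrightarrow> smooth_on W F \<Longrightarrow> smooth_on W (\<lambda>z. E z ** F z)"
  by (rule smooth_on_bounded_bilinear[OF open_W bounded_bilinear_matrix_mult])

lemma smooth_matvec:
  fixes E :: "'e \<Rightarrow> real^'n^'n"
  shows "smooth_on W E \<Longrightarrow> smooth_on W X \<Longrightarrow> smooth_on W (\<lambda>z. E z *v X z)"
  by (rule smooth_on_bounded_bilinear[OF open_W bounded_bilinear_matrix_vector_mult])

lemma smooth_transpose:
  fixes E :: "'e \<Rightarrow> real^'n^'n"
  shows "smooth_on W E \<Longrightarrow> smooth_on W (\<lambda>z. transpose (E z))"
  by (rule smooth_on_bounded_linear[OF open_W bounded_linear_transpose])

lemma smooth_D: "smooth_on W F \<Longrightarrow> smooth_on W (\<lambda>z. dd v F z)"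
  by (rule smooth_on_dd[OF open_W])

lemma smooth_diff: "smooth_on W F \<Longrightarrow> smooth_on W (diff F)"
  unfolding diff_def by (intro smooth_on_vec_lambda open_W smooth_D)

lemma smooth_grad: "smooth_on W F \<Longrightarrow> smooth_on W (grad F)"
  unfolding grad_def by (intro smooth_matvec smooth_N smooth_diff)

lemma smooth_cov: "smooth_on W X \<Longrightarrow> smooth_on W (cov i X)"
  unfolding cov_def by (intro smooth_on_add open_W smooth_D smooth_matvec smooth_\<Gamma>)

lemma smooth_divg: "smooth_on W X \<Longrightarrow> smooth_on W (divg X)"
  unfolding divg_def by (intro smooth_on_sum open_W smooth_on_vec_nth smooth_cov) auto

lemma smooth_lap: "smooth_on W F \<Longrightarrow> smooth_on W (lap F)"
  unfolding lap_def by (intro smooth_divg smooth_grad)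

lemma smooth_curv: "smooth_on W (curv i j)"
  unfolding curv_def by (intro smooth_on_add smooth_on_diff open_W smooth_D smooth_matmul smooth_\<Gamma>)

lemma smooth_Ric: "smooth_on W Ric"
  unfolding Ric_def
  by (intro smooth_on_vec_lambda smooth_on_sum smooth_on_vec_nth open_W smooth_curv) auto

lemmas smooth_intros = open_W smooth_on_const[OF open_W] smooth_G smooth_N smooth_\<Gamma>
  smooth_on_add smooth_on_diff smooth_on_minus smooth_on_mult
  smooth_on_vec_nth smooth_matmul smooth_matvec smooth_transpose smooth_D smooth_diff smooth_grad
  smooth_cov smooth_divg smooth_lap smooth_curv smooth_Ric

lemma differentiable: "smooth_on W F \<Longrightarrow> z \<in> W \<Longrightarrow> F differentiable (at z)"
  by (rule smooth_on_imp_differentiable[OF open_W])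

lemma dd_matmul:
  fixes E F :: "'e \<Rightarrow> real^'n^'n"
  assumes "smooth_on W E" "smooth_on W F" "z \<in> W"
  shows "dd v (\<lambda>z. E z ** F z) z = E z ** dd v F z + dd v E z ** F z"
  using assms by (intro dd_bounded_bilinear[OF bounded_bilinear_matrix_mult] differentiable)

lemma dd_matvec:
  fixes E :: "'e \<Rightarrow> real^'n^'n"
  assumes "smooth_on W E" "smooth_on W X" "z \<in> W"
  shows "dd v (\<lambda>z. E z *v X z) z = E z *v dd v X z + dd v E z *v X z"
  using assms by (intro dd_bounded_bilinear[OF bounded_bilinear_matrix_vector_mult] differentiable)

lemma dd_transpose:
  fixes E :: "'e \<Rightarrow> real^'n^'n"
  assumes "smooth_on W E" "z \<in> W"
  shows "dd v (\<lambda>z. transpose (E z)) z = transpose (dd v E z)"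
  using assms by (intro dd_bounded_linear[OF bounded_linear_transpose] differentiable)

lemma N_sym:
  assumes "z \<in> W"
  shows "transpose (N z) = N z"
proof -
  have "transpose (N z) ** G z = mat 1"
    using G_N[OF assms] G_sym[OF assms] by (metis matrix_transpose_mul transpose_mat)
  then show ?thesis
    using G_N[OF assms] by (metis matrix_mul_assoc matrix_mul_lid matrix_mul_rid)
qed

lemma dd_N:
  assumes z: "z \<in> W"
  shows "dd v N z = - (N z ** dd v G z ** N z)"
proof -
  have "dd v (\<lambda>z. N z ** G z) z = dd v (\<lambda>z. mat 1) z"
    by (rule dd_cong[OF open_W z]) (rule N_G)
  then have "dd v N z ** G z = - (N z ** dd v G z)"
    using dd_matmul[OF smooth_N smooth_G z, of v] by (simp add: eq_neg_iff_add_eq_0 add.commute)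
  then have "dd v N z ** (G z ** N z) = - (N z ** dd v G z) ** N z"
    by (simp add: matrix_mul_assoc)
  then show ?thesis
    using G_N[OF z] by (simp add: matmul_simps)
qed

text \<open>The inverse metric is parallel as well. This is what lets indices be raised under
  covariant derivatives.\<close>

lemma D_N:
  assumes z: "z \<in> W"
  shows "D i N z = - (\<Gamma> i z ** N z + N z ** transpose (\<Gamma> i z))"
proof -
  have "N z ** (transpose (\<Gamma> i z) ** G z + G z ** \<Gamma> i z) ** N z
      = N z ** transpose (\<Gamma> i z) ** (G z ** N z) + (N z ** G z) ** \<Gamma> i z ** N z"
    by (simp add: matmul_simps)
  then show ?thesis
    unfolding dd_N[OF z] compatible[OF z] using N_G[OF z] G_N[OF z] by (simp add: add.commute)
qed

lemma curv_swap: "curv i j z = - curv j i z"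
  by (simp add: curv_def)

text \<open>Second partial derivatives of \<open>N\<close> commute. Expanding both orders by
  \<open>D_N\<close>, what survives is the action of the curvature on the inverse metric, which must
  therefore vanish.\<close>

lemma curv_raised_antisym:
  assumes z: "z \<in> W"
  shows "transpose (curv i j z ** N z) = - (curv i j z ** N z)"
proof -
  have DD: "D j (D i N) z = - (D j (\<Gamma> i) z ** N z + \<Gamma> i z ** D j N z
      + (D j N z ** transpose (\<Gamma> i z) + N z ** transpose (D j (\<Gamma> i) z)))" for i j
  proof -
    have "D j (D i N) z = D j (\<lambda>z. - (\<Gamma> i z ** N z + N z ** transpose (\<Gamma> i z))) z"
      by (rule dd_cong[OF open_W z]) (rule D_N)
    also have "\<dots> = - (D j (\<Gamma> i) z ** N z + \<Gamma> i z ** D j N z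
      + (D j N z ** transpose (\<Gamma> i z) + N z ** transpose (D j (\<Gamma> i) z)))"
      by (subst dd_minus dd_add dd_matmul dd_transpose, (intro differentiable smooth_intros z)+)+
        (simp add: add_ac)
    finally show ?thesis .
  qed
  have "D j (D i N) z = D i (D j N) z"
    by (rule dd_commute[OF open_W smooth_N z])
  then have "curv i j z ** N z + N z ** transpose (curv i j z) = 0"
    unfolding DD D_N[OF z] curv_def
    by (simp add: matmul_simps transpose_add transpose_diff matrix_transpose_mul algebra_simps)
  then show ?thesis
    by (simp add: matrix_transpose_mul N_sym[OF z] eq_neg_iff_add_eq_0 add.commute)
qed

text \<open>Each line carries only the commutator with the connection matrix: the Christoffel
  corrections for the two direction indices cancel in the cyclic sum of covariant derivatives. The
  rest vanishes by commuting second derivatives and by the Jacobi identity.\<close>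

lemma bianchi:
  assumes z: "z \<in> W"
  shows "D m (curv i j) z + (\<Gamma> m z ** curv i j z - curv i j z ** \<Gamma> m z)
    + (D i (curv j m) z + (\<Gamma> i z ** curv j m z - curv j m z ** \<Gamma> i z))
    + (D j (curv m i) z + (\<Gamma> j z ** curv m i z - curv m i z ** \<Gamma> j z)) = 0"
proof -
  have D_curv: "D m (curv i j) z = D m (D i (\<Gamma> j)) z - D m (D j (\<Gamma> i)) z
      + ((\<Gamma> i z ** D m (\<Gamma> j) z + D m (\<Gamma> i) z ** \<Gamma> j z)
         - (\<Gamma> j z ** D m (\<Gamma> i) z + D m (\<Gamma> j) z ** \<Gamma> i z))" for m i j
    unfolding curv_def
    by (subst dd_add dd_diff dd_matmul, (intro differentiable smooth_intros z)+)+ simp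
  have comm: "D i (D m (\<Gamma> j)) z = D m (D i (\<Gamma> j)) z" "D j (D i (\<Gamma> m)) z = D i (D j (\<Gamma> m)) z"
    "D j (D m (\<Gamma> i)) z = D m (D j (\<Gamma> i)) z"
    by (rule dd_commute[OF open_W smooth_\<Gamma> z])+
  have D_curv': "D m (curv i j) z + (\<Gamma> m z ** curv i j z - curv i j z ** \<Gamma> m z)
    = D m (D i (\<Gamma> j)) z - D m (D j (\<Gamma> i)) z
      + (\<Gamma> i z ** D m (\<Gamma> j) z + D m (\<Gamma> i) z ** \<Gamma> j z - \<Gamma> j z ** D m (\<Gamma> i) z - D m (\<Gamma> j) z ** \<Gamma> i z)
      + (\<Gamma> m z ** D i (\<Gamma> j) z - \<Gamma> m z ** D j (\<Gamma> i) z - D i (\<Gamma> j) z ** \<Gamma> m z + D j (\<Gamma> i) z ** \<Gamma> m z)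
      + (\<Gamma> m z ** \<Gamma> i z ** \<Gamma> j z - \<Gamma> m z ** \<Gamma> j z ** \<Gamma> i z
         - \<Gamma> i z ** \<Gamma> j z ** \<Gamma> m z + \<Gamma> j z ** \<Gamma> i z ** \<Gamma> m z)" for m i j
    unfolding D_curv unfolding curv_def by (simp only: matmul_simps bianchi_group_identity1)
  show ?thesis
    unfolding D_curv' comm
    by (rule bianchi_group_identity2)
qed

text \<open>Multiplying by the parallel tensor \<open>N\<close> on the right turns the commutator
  into the connection acting on two upper indices.\<close>

lemma bianchi_raised:
  fixes P defines "P \<equiv> \<lambda>i j z. curv i j z ** N z"
  assumes z: "z \<in> W"
  shows "D m (P i j) z + \<Gamma> m z ** P i j z + P i j z ** transpose (\<Gamma> m z)
    + (D i (P j m) z + \<Gamma> i z ** P j m z + P j m z ** transpose (\<Gamma> i z))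
    + (D j (P m i) z + \<Gamma> j z ** P m i z + P m i z ** transpose (\<Gamma> j z)) = 0"
proof -
  have one: "D m (P i j) z + \<Gamma> m z ** P i j z + P i j z ** transpose (\<Gamma> m z)
      = (D m (curv i j) z + (\<Gamma> m z ** curv i j z - curv i j z ** \<Gamma> m z)) ** N z" for m i j
    unfolding P_def dd_matmul[OF smooth_curv smooth_N z] D_N[OF z]
    by (simp add: matmul_simps)
  show ?thesis
    unfolding one matmul.add_left[symmetric] bianchi[OF z] by (rule matmul.zero_left)
qed

end

section \<open>Covariant derivatives of vector fields and the Bochner formula\<close>

lemma bounded_linear_trace: "bounded_linear (trace :: real^'n::finite^'n \<Rightarrow> real)"
  by (intro linear_conv_bounded_linear[THEN iffD1] linearI) (auto simp: trace_def sum.distrib sum_distrib_left)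

lemma trace_transpose: "trace (transpose A) = trace (A :: real^'n::finite^'n)"
  by (simp add: trace_def transpose_def)

lemma matvec_component: "(A *v x) $ i = (\<Sum>j\<in>UNIV. A $ i $ j * x $ j)"
  by (simp add: matrix_vector_mult_def)

lemma matvec_adjoint: "(A *v x) \<bullet> y = x \<bullet> (transpose A *v (y :: real^'m::finite))"
  by (metis dot_lmul_matrix inner_commute transpose_matrix_vector)

context metric_patch
begin

lemma smooth_trace: "smooth_on W E \<Longrightarrow> smooth_on W (\<lambda>z. trace (E z :: real^'n^'n))"
  by (rule smooth_on_bounded_linear[OF open_W bounded_linear_trace])

lemma dd_trace:
  "smooth_on W E \<Longrightarrow> z \<in> W \<Longrightarrow> dd v (\<lambda>z. trace (E z :: real^'n^'n)) z = trace (dd v E z)"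
  by (rule dd_bounded_linear[OF bounded_linear_trace differentiable])

lemma smooth_scaleR: "smooth_on W F \<Longrightarrow> smooth_on W X \<Longrightarrow> smooth_on W (\<lambda>z. F z *\<^sub>R X z)"
  by (rule smooth_on_bounded_bilinear[OF open_W bounded_bilinear_scaleR])

lemma smooth_inner:
  fixes X Y :: "'e \<Rightarrow> 'w::real_inner"
  shows "smooth_on W X \<Longrightarrow> smooth_on W Y \<Longrightarrow> smooth_on W (\<lambda>z. X z \<bullet> Y z)"
  by (rule smooth_on_bounded_bilinear[OF open_W bounded_bilinear_inner])

lemma D_cov: "D i X z = cov i X z - \<Gamma> i z *v X z"
  by (simp add: cov_def)

lemma dd_cov:
  assumes "smooth_on W X" "z \<in> W"
  shows "dd v (cov j X) z = dd v (D j X) z + (\<Gamma> j z *v dd v X z + dd v (\<Gamma> j) z *v X z)"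
  unfolding cov_def
  using dd_add[OF differentiable[OF smooth_D[OF assms(1)] assms(2)]
      differentiable[OF smooth_matvec[OF smooth_\<Gamma> assms(1)] assms(2)]]
    dd_matvec[OF smooth_\<Gamma> assms] by simp

text \<open>Each \<open>cov\<close> differentiates a vector field along a coordinate field.
  Coordinate fields commute, so curvature is the whole commutator.\<close>

lemma cov_commute:
  assumes X: "smooth_on W X" and z: "z \<in> W"
  shows "cov i (cov j X) z - cov j (cov i X) z = curv i j z *v X z"
proof -
  have "D i (D j X) z = D j (D i X) z"
    by (rule dd_commute[OF open_W X z])
  then show ?thesis
    unfolding cov_def[of i "cov j X"] cov_def[of j "cov i X"] dd_cov[OF X z] curv_def
    by (simp add: cov_def matvec.add_left matvec.add_right matvec.diff_left matrix_vector_mul_assoc)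
qed

lemma D_divg:
  assumes X: "smooth_on W X" and z: "z \<in> W"
  shows "dd v (divg X) z = (\<Sum>i\<in>UNIV. dd v (cov i X) z $ i)"
proof -
  have "(\<lambda>z. cov i X z $ i) differentiable (at z)" for i
    by (intro differentiable smooth_intros X z)
  then show ?thesis
    unfolding divg_def by (simp add: dd_sum dd_vec_nth differentiable smooth_cov X z)
qed

lemma divg_cong:
  assumes "z \<in> W" "\<And>y. y \<in> W \<Longrightarrow> X y = Y y"
  shows "divg X z = divg Y z"
  using dd_cong[OF open_W assms] assms unfolding divg_def cov_def by simp

text \<open>
  For a gradient field this identity becomes the Bochner formula, but it holds for every vector
  field, and for every torsion-free connection.
\<close>

lemma divg_cov_self:
  assumes X: "smooth_on W X" and z: "z \<in> W"
  shows "divg (\<lambda>z. \<Sum>j\<in>UNIV. X z $ j *\<^sub>R cov j X z) z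
    = (\<Sum>j\<in>UNIV. X z $ j * D j (divg X) z)
      + (\<Sum>i\<in>UNIV. \<Sum>j\<in>UNIV. cov i X z $ j * cov j X z $ i) + X z \<bullet> (Ric z *v X z)"
proof -
  let ?Y = "\<lambda>z. \<Sum>j\<in>UNIV. X z $ j *\<^sub>R cov j X z"
  have dY: "D i ?Y z = (\<Sum>j\<in>UNIV. X z $ j *\<^sub>R D i (cov j X) z + D i X z $ j *\<^sub>R cov j X z)" for i
  proof -
    have "D i (\<lambda>z. X z $ j *\<^sub>R cov j X z) z = X z $ j *\<^sub>R D i (cov j X) z + D i X z $ j *\<^sub>R cov j X z" for j
      using X z by (subst dd_bounded_bilinear[OF bounded_bilinear_scaleR])
        (auto intro!: differentiable smooth_intros dd_vec_nth)
    moreover have "(\<lambda>z. X z $ j *\<^sub>R cov j X z) differentiable (at z)" for j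
      using X z by (intro differentiable smooth_scaleR smooth_intros)
    ultimately show ?thesis by (simp add: dd_sum)
  qed
  have 1: "divg ?Y z = (\<Sum>i\<in>UNIV. \<Sum>j\<in>UNIV. X z $ j * cov i (cov j X) z $ i + D i X z $ j * cov j X z $ i)"
    unfolding divg_def cov_def[of _ ?Y] dY cov_def[of _ "cov _ X"]
    by (simp add: matvec.sum_right matvec.scaleR_right sum_component sum.distrib[symmetric] algebra_simps)
  have 2: "(\<Sum>j\<in>UNIV. X z $ j * D j (divg X) z)
      = (\<Sum>i\<in>UNIV. \<Sum>j\<in>UNIV. X z $ j * (cov j (cov i X) z $ i - (\<Gamma> j z *v cov i X z) $ i))"
    unfolding D_divg[OF X z] D_cov[of "cov _ X"] sum_distrib_left
    by (subst sum.swap) simp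
  \<comment> \<open>Here the symmetry of the lower indices enters: the connection term left over
    from the derivative of the divergence is the one that completes \<open>D i X\<close> to
    \<open>cov i X\<close>.\<close>
  have 3: "(\<Sum>i\<in>UNIV. \<Sum>j\<in>UNIV. X z $ j * (\<Gamma> j z *v cov i X z) $ i)
      = (\<Sum>i\<in>UNIV. \<Sum>j\<in>UNIV. (\<Gamma> i z *v X z) $ j * cov j X z $ i)"
  proof -
    have "(\<Sum>i\<in>UNIV. \<Sum>j\<in>UNIV. X z $ j * (\<Gamma> j z *v cov i X z) $ i)
      = (\<Sum>i\<in>UNIV. \<Sum>j\<in>UNIV. \<Sum>k\<in>UNIV. X z $ j * (\<Gamma> j z $ i $ k * cov i X z $ k))"
      by (simp add: matvec_component sum_distrib_left)
    also have "\<dots> = (\<Sum>i\<in>UNIV. \<Sum>k\<in>UNIV. \<Sum>j\<in>UNIV. X z $ j * (\<Gamma> j z $ i $ k * cov i X z $ k))"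
      by (intro sum.cong refl sum.swap)
    also have "\<dots> = (\<Sum>i\<in>UNIV. \<Sum>k\<in>UNIV. \<Sum>j\<in>UNIV. \<Gamma> k z $ i $ j * X z $ j * cov i X z $ k)"
      by (intro sum.cong refl) (subst \<Gamma>_sym[OF z], simp)
    also have "\<dots> = (\<Sum>k\<in>UNIV. \<Sum>i\<in>UNIV. \<Sum>j\<in>UNIV. \<Gamma> k z $ i $ j * X z $ j * cov i X z $ k)"
      by (rule sum.swap)
    finally show ?thesis by (simp add: matvec_component sum_distrib_right)
  qed
  have 4: "(\<Sum>i\<in>UNIV. \<Sum>j\<in>UNIV. X z $ j * (curv i j z *v X z) $ i) = X z \<bullet> (Ric z *v X z)"
  proof -
    have "(\<Sum>i\<in>UNIV. \<Sum>j\<in>UNIV. X z $ j * (curv i j z *v X z) $ i)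
      = (\<Sum>j\<in>UNIV. \<Sum>i\<in>UNIV. \<Sum>k\<in>UNIV. X z $ j * (curv i j z $ i $ k * X z $ k))"
      by (subst sum.swap) (simp add: matvec_component sum_distrib_left)
    also have "\<dots> = (\<Sum>j\<in>UNIV. \<Sum>k\<in>UNIV. \<Sum>i\<in>UNIV. X z $ j * (curv i j z $ i $ k * X z $ k))"
      by (intro sum.cong refl sum.swap)
    finally show ?thesis
      by (simp add: inner_vec_def matvec_component Ric_def sum_distrib_left sum_distrib_right)
  qed
  have 5: "cov i (cov j X) z $ i = cov j (cov i X) z $ i + (curv i j z *v X z) $ i" for i j
    using cov_commute[OF X z, of i j] by (metis add_diff_cancel_left' diff_add_cancel add.commute vector_add_component)
  have 6: "cov i X z $ j = D i X z $ j + (\<Gamma> i z *v X z) $ j" for i j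
    by (simp add: cov_def)
  have "divg ?Y z - (\<Sum>j\<in>UNIV. X z $ j * D j (divg X) z)
    = (\<Sum>i\<in>UNIV. \<Sum>j\<in>UNIV. X z $ j * (\<Gamma> j z *v cov i X z) $ i + D i X z $ j * cov j X z $ i
        + X z $ j * (curv i j z *v X z) $ i)"
    unfolding 1 2 sum_subtractf[symmetric] 5 by (simp add: algebra_simps)
  also have "\<dots> = (\<Sum>i\<in>UNIV. \<Sum>j\<in>UNIV. (\<Gamma> i z *v X z) $ j * cov j X z $ i + D i X z $ j * cov j X z $ i)
      + X z \<bullet> (Ric z *v X z)"
    by (simp only: sum.distrib 3 4)
  also have "(\<Sum>i\<in>UNIV. \<Sum>j\<in>UNIV. (\<Gamma> i z *v X z) $ j * cov j X z $ i + D i X z $ j * cov j X z $ i)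
      = (\<Sum>i\<in>UNIV. \<Sum>j\<in>UNIV. cov i X z $ j * cov j X z $ i)"
    by (intro sum.cong refl) (simp add: 6 distrib_right)
  finally show ?thesis by simp
qed

text \<open>The covariant derivative in direction \<open>i\<close> of the differential of
  \<open>F\<close>, as a covector: one row of the Hessian.\<close>

definition hess :: "('e \<Rightarrow> real) \<Rightarrow> 'n \<Rightarrow> 'e \<Rightarrow> real^'n" where
  "hess F i z = D i (diff F) z - transpose (\<Gamma> i z) *v diff F z"

lemma dd_diff_component:
  assumes F: "smooth_on W F" and z: "z \<in> W"
  shows "dd v (diff F) z $ j = dd v (D j F) z"
proof -
  have "dd v (\<lambda>z. diff F z $ j) z = dd v (diff F) z $ j"
    by (intro dd_vec_nth differentiable smooth_diff F z)
  then show ?thesis by (simp add: diff_def)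
qed

lemma hess_component:
  assumes F: "smooth_on W F" and z: "z \<in> W"
  shows "hess F i z $ j = D i (D j F) z - (\<Sum>k\<in>UNIV. \<Gamma> i z $ k $ j * D k F z)"
  unfolding hess_def using dd_diff_component[OF assms, of "e i" j]
  by (simp add: matvec_component transpose_def diff_def del: transpose_matrix_vector)

lemma hess_sym:
  assumes F: "smooth_on W F" and z: "z \<in> W"
  shows "hess F i z $ j = hess F j z $ i"
  unfolding hess_component[OF assms] dd_commute[OF open_W F z, of "e i"] \<Gamma>_sym[OF z, of i] ..

lemma dd_grad:
  assumes F: "smooth_on W F" and z: "z \<in> W"
  shows "dd v (grad F) z = N z *v dd v (diff F) z + dd v N z *v diff F z"
  unfolding grad_def by (rule dd_matvec[OF smooth_N smooth_diff[OF F] z])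

text \<open>Since \<open>N\<close> is parallel, raising the index commutes with the covariant
  derivative.\<close>

lemma cov_grad:
  assumes F: "smooth_on W F" and z: "z \<in> W"
  shows "cov i (grad F) z = N z *v hess F i z"
  unfolding cov_def dd_grad[OF F z] D_N[OF z] hess_def grad_def
  by (simp add: matvec.add_left matvec.minus_left matvec.diff_left matvec.diff_right matrix_vector_mul_assoc
      del: transpose_matrix_vector)

lemma lap_eq:
  assumes F: "smooth_on W F" and z: "z \<in> W"
  shows "lap F z = (\<Sum>i\<in>UNIV. \<Sum>j\<in>UNIV. N z $ i $ j * hess F i z $ j)"
  unfolding lap_def divg_def cov_grad[OF assms] matvec_component ..

lemma inner_N: "z \<in> W \<Longrightarrow> (N z *v x) \<bullet> y = x \<bullet> (N z *v y)"
  using N_sym[of z] by (metis dot_lmul_matrix transpose_matrix_vector)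

lemma D_grad_norm:
  assumes F: "smooth_on W F" and z: "z \<in> W"
  shows "D i (\<lambda>z. grad F z \<bullet> diff F z) z = 2 * (hess F i z \<bullet> grad F z)"
proof -
  have "D i (\<lambda>z. grad F z \<bullet> diff F z) z = grad F z \<bullet> D i (diff F) z + D i (grad F) z \<bullet> diff F z"
    by (intro dd_bounded_bilinear[OF bounded_bilinear_inner] differentiable smooth_intros F z)
  also have "D i (grad F) z \<bullet> diff F z = hess F i z \<bullet> grad F z - grad F z \<bullet> (transpose (\<Gamma> i z) *v diff F z)"
    unfolding D_cov cov_grad[OF F z]
    by (simp add: inner_diff_left inner_N[OF z] matvec_adjoint[of "\<Gamma> i z"] del: transpose_matrix_vector)
      (simp add: grad_def)
  finally show ?thesis
    by (simp add: hess_def inner_diff_left inner_diff_right inner_commute del: transpose_matrix_vector)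
qed

text \<open>By symmetry of the Hessian, the gradient of the squared norm of the gradient is twice
  the covariant derivative of the gradient field along itself, which is the field treated in
  \<open>divg_cov_self\<close>.\<close>

lemma grad_grad_norm:
  assumes F: "smooth_on W F" and z: "z \<in> W"
  shows "grad (\<lambda>z. grad F z \<bullet> diff F z) z = 2 *\<^sub>R (\<Sum>j\<in>UNIV. grad F z $ j *\<^sub>R cov j (grad F) z)"
proof -
  have "diff (\<lambda>z. grad F z \<bullet> diff F z) z $ i = (2 *\<^sub>R (\<Sum>j\<in>UNIV. grad F z $ j *\<^sub>R hess F j z)) $ i" for i
  proof -
    have "diff (\<lambda>z. grad F z \<bullet> diff F z) z $ i = 2 * (hess F i z \<bullet> grad F z)"
      unfolding D_grad_norm[OF assms, symmetric] diff_def[of "\<lambda>z. grad F z \<bullet> diff F z"] by simp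
    then show ?thesis
      by (simp add: inner_vec_def sum_component hess_sym[OF assms, of i] mult.commute)
  qed
  then have "diff (\<lambda>z. grad F z \<bullet> diff F z) z = 2 *\<^sub>R (\<Sum>j\<in>UNIV. grad F z $ j *\<^sub>R hess F j z)"
    by (simp add: vec_eq_iff)
  then show ?thesis
    unfolding grad_def[of "\<lambda>z. grad F z \<bullet> diff F z"] cov_grad[OF assms]
    by (simp add: matvec.scaleR_right matvec.sum_right)
qed

lemma divg_scaleR:
  assumes X: "smooth_on W X" and z: "z \<in> W"
  shows "divg (\<lambda>z. c *\<^sub>R X z) z = c * divg X z"
  unfolding divg_def cov_def
  using dd_bounded_linear[OF bounded_linear_scaleR_right differentiable[OF assms]]
  by (simp add: sum_distrib_left distrib_left matvec.scaleR_right)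

lemma divg_add:
  assumes "smooth_on W X" "smooth_on W Y" and z: "z \<in> W"
  shows "divg (\<lambda>z. X z + Y z) z = divg X z + divg Y z"
  unfolding divg_def cov_def
  using dd_add[OF differentiable[OF assms(1) z] differentiable[OF assms(2) z]]
  by (simp add: sum.distrib matvec.add_right algebra_simps)

text \<open>The double sum is the squared norm of the Hessian, written as the trace of the square of
  the endomorphism given by the derivatives \<open>cov i X\<close>.\<close>

lemma bochner:
  assumes F: "smooth_on W F" and z: "z \<in> W"
  defines "X \<equiv> grad F"
  shows "lap (\<lambda>z. grad F z \<bullet> diff F z) z
    = 2 * ((\<Sum>j\<in>UNIV. X z $ j * D j (lap F) z)
      + (\<Sum>i\<in>UNIV. \<Sum>j\<in>UNIV. cov i X z $ j * cov j X z $ i) + X z \<bullet> (Ric z *v X z))"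
proof -
  have X: "smooth_on W X"
    unfolding X_def by (rule smooth_grad[OF F])
  have "lap (\<lambda>z. grad F z \<bullet> diff F z) z = divg (\<lambda>z. 2 *\<^sub>R (\<Sum>j\<in>UNIV. X z $ j *\<^sub>R cov j X z)) z"
    unfolding lap_def X_def by (rule divg_cong[OF z]) (rule grad_grad_norm[OF F])
  also have "\<dots> = 2 * divg (\<lambda>z. \<Sum>j\<in>UNIV. X z $ j *\<^sub>R cov j X z) z"
    by (intro divg_scaleR z smooth_on_sum open_W smooth_scaleR smooth_on_vec_nth smooth_cov X) auto
  finally show ?thesis
    using divg_cov_self[OF X z] unfolding lap_def X_def by simp
qed

lemma lap_cong:
  assumes "z \<in> W" "\<And>y. y \<in> W \<Longrightarrow> F y = H y"
  shows "lap F z = lap H z"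
  unfolding lap_def using assms
  by (intro divg_cong) (auto simp: grad_def diff_def vec_eq_iff cong: dd_cong[OF open_W])

lemma lap_add:
  assumes "smooth_on W F" "smooth_on W H" and z: "z \<in> W"
  shows "lap (\<lambda>z. F z + H z) z = lap F z + lap H z"
proof -
  have "lap (\<lambda>z. F z + H z) z = divg (\<lambda>z. grad F z + grad H z) z"
    unfolding lap_def
  proof (rule divg_cong[OF z])
    show "grad (\<lambda>z. F z + H z) y = grad F y + grad H y" if "y \<in> W" for y
      unfolding grad_def diff_def matvec.add_right[symmetric]
      using dd_add[OF differentiable[OF assms(1) that] differentiable[OF assms(2) that]]
      by (simp add: vec_eq_iff plus_vec_def)
  qed
  also have "\<dots> = lap F z + lap H z"
    unfolding lap_def by (intro divg_add smooth_grad assms)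
  finally show ?thesis .
qed

lemma lap_cmult:
  assumes F: "smooth_on W F" and z: "z \<in> W"
  shows "lap (\<lambda>z. c * F z) z = c * lap F z"
proof -
  have "lap (\<lambda>z. c * F z) z = divg (\<lambda>z. c *\<^sub>R grad F z) z"
    unfolding lap_def
  proof (rule divg_cong[OF z])
    show "grad (\<lambda>z. c * F z) y = c *\<^sub>R grad F y" if "y \<in> W" for y
      unfolding grad_def diff_def matvec.scaleR_right[symmetric]
      using dd_bounded_linear[OF bounded_linear_mult_right differentiable[OF F that]]
      by (simp add: vec_eq_iff scaleR_vec_def)
  qed
  also have "\<dots> = c * lap F z"
    unfolding lap_def by (intro divg_scaleR smooth_grad assms)
  finally show ?thesis .
qed

text \<open>Multiply the compatibility equation by \<open>N\<close> and take traces: by cyclicity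
  both terms give the trace of the connection matrix. The value is the derivative of
  \<open>ln (sqrt (det G))\<close>.\<close>

lemma trace_\<Gamma>:
  assumes z: "z \<in> W"
  shows "trace (\<Gamma> k z) = trace (N z ** D k G z) / 2"
proof -
  have "trace (N z ** D k G z) = trace (N z ** transpose (\<Gamma> k z) ** G z) + trace ((N z ** G z) ** \<Gamma> k z)"
    unfolding compatible[OF z] by (simp add: matmul_simps trace_add)
  also have "trace (N z ** transpose (\<Gamma> k z) ** G z) = trace (transpose (\<Gamma> k z))"
    using trace_mul_sym[of "N z ** transpose (\<Gamma> k z)" "G z"] G_N[OF z] by (simp add: matrix_mul_assoc)
  finally show ?thesis
    by (simp add: N_G[OF z] trace_transpose)
qed

text \<open>Both sides are the mixed second derivative of \<open>ln (det G)\<close>.\<close>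

lemma dd_trace_commute:
  assumes z: "z \<in> W"
  shows "dd v (\<lambda>z. trace (N z ** dd w G z)) z = dd w (\<lambda>z. trace (N z ** dd v G z)) z"
proof -
  have "dd v (\<lambda>z. trace (N z ** dd w G z)) z
      = trace (N z ** dd v (dd w G) z) - trace (N z ** dd v G z ** (N z ** dd w G z))" for v w
    by (subst dd_trace, (intro smooth_intros z)+, subst dd_matmul, (intro smooth_intros z)+)
      (simp add: dd_N[OF z] matmul_simps trace_add trace_sub)
  then show ?thesis
    using dd_commute[OF open_W smooth_G z, of v w]
      trace_mul_sym[of "N z ** dd v G z" "N z ** dd w G z"] by simp
qed

text \<open>Symmetry of the lower indices lets the connection enter through its traces alone, whose
  time derivative is easy to find.\<close>

lemma divg_eq:
  assumes z: "z \<in> W"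
  shows "divg X z = (\<Sum>i\<in>UNIV. D i X z $ i) + (\<Sum>k\<in>UNIV. trace (\<Gamma> k z) * X z $ k)"
proof -
  have "(\<Sum>i\<in>UNIV. (\<Gamma> i z *v X z) $ i) = (\<Sum>k\<in>UNIV. \<Sum>i\<in>UNIV. \<Gamma> i z $ i $ k * X z $ k)"
    unfolding matvec_component by (rule sum.swap)
  also have "\<dots> = (\<Sum>k\<in>UNIV. trace (\<Gamma> k z) * X z $ k)"
    unfolding trace_def sum_distrib_right by (intro sum.cong refl) (subst \<Gamma>_sym[OF z], rule refl)
  finally show ?thesis
    by (simp add: divg_def cov_def sum.distrib)
qed

end

section \<open>The contracted Bianchi identity\<close>

lemma matmul_component: "(A ** B) $ i $ k = (\<Sum>j\<in>UNIV. A $ i $ j * B $ j $ k)"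
  by (simp add: matrix_matrix_mult_def)

lemma transpose_component: "transpose A $ i $ j = A $ j $ i"
  by (simp add: transpose_def)

context metric_patch
begin

lemma dd_component2:
  "smooth_on W E \<Longrightarrow> z \<in> W \<Longrightarrow> dd v (\<lambda>z. (E z :: real^'n^'n) $ i $ j) z = dd v E z $ i $ j"
  by (simp add: dd_vec_nth[where f = "\<lambda>z. E z $ i"] dd_vec_nth[where f = E] differentiable
      smooth_on_vec_nth open_W)

text \<open>\<open>Q\<close> is the Ricci endomorphism and the bracket its covariant derivative, so
  the divergence of \<open>Q\<close> is half the differential of the scalar curvature. Symmetry of
  the Ricci tensor is an assumption here; along the flow it is supplied by
  \<open>Ric_sym\<close>.\<close>

lemma contracted_bianchi:
  fixes Q defines "Q \<equiv> \<lambda>z. N z ** Ric z"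
  assumes Ric_sym: "\<And>z. z \<in> W \<Longrightarrow> transpose (Ric z) = Ric z" and z: "z \<in> W"
  shows "2 * (\<Sum>m\<in>UNIV. (D m Q z + \<Gamma> m z ** Q z - Q z ** \<Gamma> m z) $ m $ j) = D j (\<lambda>z. trace (Q z)) z"
proof -
  define P where "P = (\<lambda>i j z. curv i j z ** N z)"
  have smooth_P: "smooth_on W (P i j)" for i j
    unfolding P_def by (intro smooth_intros)
  have smooth_Q: "smooth_on W Q"
    unfolding Q_def by (intro smooth_intros)
  \<comment> \<open>Symmetry of \<open>N\<close> and \<open>Ric\<close> turns the Ricci endomorphism
    into a contraction of the raised curvature \<open>P\<close>, the form to which
    \<open>contract_bianchi\<close> applies.\<close>
  have Q: "Q z $ k $ j = (\<Sum>i\<in>UNIV. P i j z $ i $ k)" if "z \<in> W" for z k j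
  proof -
    have "Q z $ k $ j = (\<Sum>b\<in>UNIV. N z $ b $ k * Ric z $ j $ b)"
      unfolding Q_def matmul_component
      by (metis N_sym[OF that] Ric_sym[OF that] transpose_component)
    also have "\<dots> = (\<Sum>b\<in>UNIV. \<Sum>i\<in>UNIV. curv i j z $ i $ b * N z $ b $ k)"
      by (simp add: Ric_def sum_distrib_left mult.commute)
    also have "\<dots> = (\<Sum>i\<in>UNIV. P i j z $ i $ k)"
      unfolding P_def matmul_component by (rule sum.swap)
    finally show ?thesis .
  qed
  have DQ: "D m Q z $ k $ j = (\<Sum>i\<in>UNIV. D m (P i j) z $ i $ k)" for m k j
  proof -
    have "D m Q z $ k $ j = D m (\<lambda>z. Q z $ k $ j) z"
      by (rule dd_component2[OF smooth_Q z, symmetric])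
    also have "\<dots> = D m (\<lambda>z. \<Sum>i\<in>UNIV. P i j z $ i $ k) z"
      by (rule dd_cong[OF open_W z Q])
    also have "\<dots> = (\<Sum>i\<in>UNIV. D m (\<lambda>z. P i j z $ i $ k) z)"
      by (intro dd_sum differentiable smooth_intros smooth_P z)
    finally show ?thesis by (simp add: dd_component2[OF smooth_P z])
  qed
  have P1: "P i j z = - P j i z" for i j z
    unfolding P_def curv_swap[of i j] by (rule matmul.minus_left)
  have P2: "P i j z = - transpose (P i j z)" if "z \<in> W" for i j z
    using curv_raised_antisym[OF that] by (simp add: P_def)
  have DP1: "D m (P i j) z = - D m (P j i) z" for m i j
  proof -
    have "D m (P i j) z = D m (\<lambda>z. - P j i z) z"
      by (rule dd_cong[OF open_W z P1])
    then show ?thesis by (simp add: dd_minus differentiable[OF smooth_P z])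
  qed
  have DP2: "D m (P i j) z = - transpose (D m (P i j) z)" for m i j
  proof -
    have "D m (P i j) z = D m (\<lambda>z. - transpose (P i j z)) z"
      by (rule dd_cong[OF open_W z P2])
    also have "\<dots> = - D m (\<lambda>z. transpose (P i j z)) z"
      by (intro dd_minus differentiable smooth_intros smooth_P z)
    finally show ?thesis by (simp add: dd_transpose[OF smooth_P z])
  qed
  have "2 * (\<Sum>m\<in>UNIV. \<Sum>i\<in>UNIV. D m (P i j) z $ i $ m)
      + 2 * (\<Sum>m\<in>UNIV. \<Sum>a\<in>UNIV. \<Gamma> m z $ m $ a * (\<Sum>i\<in>UNIV. P i j z $ i $ a))
      - 2 * (\<Sum>m\<in>UNIV. \<Sum>a\<in>UNIV. (\<Sum>i\<in>UNIV. P i a z $ i $ m) * \<Gamma> m z $ a $ j)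
    = (\<Sum>m\<in>UNIV. \<Sum>i\<in>UNIV. D j (P i m) z $ i $ m)"
  proof (rule contract_bianchi[where p = "\<lambda>i j l k. P i j z $ l $ k"
        and dp = "\<lambda>m i j l k. D m (P i j) z $ l $ k" and \<gamma> = "\<lambda>i k j. \<Gamma> i z $ k $ j"])
    show "D m (P i j) z $ i $ m + (\<Sum>a\<in>UNIV. \<Gamma> m z $ i $ a * P i j z $ a $ m)
        + (\<Sum>a\<in>UNIV. P i j z $ i $ a * \<Gamma> m z $ m $ a)
      + (D i (P j m) z $ i $ m + (\<Sum>a\<in>UNIV. \<Gamma> i z $ i $ a * P j m z $ a $ m)
        + (\<Sum>a\<in>UNIV. P j m z $ i $ a * \<Gamma> i z $ m $ a))
      + (D j (P m i) z $ i $ m + (\<Sum>a\<in>UNIV. \<Gamma> j z $ i $ a * P m i z $ a $ m)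
        + (\<Sum>a\<in>UNIV. P m i z $ i $ a * \<Gamma> j z $ m $ a)) = 0" for i m
      using arg_cong[OF bianchi_raised[OF z, of m i j], of "\<lambda>A. A $ i $ m"]
      by (simp add: P_def matmul_component transpose_component)
    show "P i j z $ l $ k = - P j i z $ l $ k" for i j l k
      by (subst P1) simp
    show "P i j z $ l $ k = - P i j z $ k $ l" for i j l k
      by (subst P2[OF z]) (simp add: transpose_component)
    show "D m (P i j) z $ l $ k = - D m (P j i) z $ l $ k" for m i j l k
      by (subst DP1) simp
    show "D m (P i j) z $ l $ k = - D m (P i j) z $ k $ l" for m i j l k
      by (subst DP2) (simp add: transpose_component)
    show "\<Gamma> i z $ k $ j = \<Gamma> j z $ k $ i" for i k j
      by (rule \<Gamma>_sym[OF z])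
  qed
  then show ?thesis
    unfolding dd_trace[OF smooth_Q z]
    by (simp add: DQ[symmetric] Q[OF z, symmetric] matmul_component trace_def sum.distrib sum_subtractf)
qed

end

section \<open>Evolution equations under the Ricci flow\<close>

locale ricci_flow_patch = metric_patch +
  fixes \<tau> :: 'a
  assumes flow: "\<And>z. z \<in> W \<Longrightarrow> dd \<tau> G z = (-2) *\<^sub>R Ric z"
begin

abbreviation Q :: "'a \<Rightarrow> real^'b^'b" where
  "Q z \<equiv> N z ** Ric z"

lemma smooth_Q: "smooth_on W Q"
  by (intro smooth_intros)

text \<open>The symmetry is read off from the flow equation: up to a factor, \<open>Ric\<close> is
  the time derivative of a symmetric matrix.\<close>

lemma Ric_sym:
  assumes z: "z \<in> W"
  shows "transpose (Ric z) = Ric z"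
proof -
  have "transpose (dd \<tau> G z) = dd \<tau> (\<lambda>z. transpose (G z)) z"
    by (rule dd_transpose[OF smooth_G z, symmetric])
  also have "\<dots> = dd \<tau> G z"
    by (rule dd_cong[OF open_W z G_sym])
  finally show ?thesis
    unfolding flow[OF z] transpose_scalar by simp
qed

lemma dd_\<tau>_N:
  assumes z: "z \<in> W"
  shows "dd \<tau> N z = 2 *\<^sub>R (Q z ** N z)"
  unfolding dd_N[OF z] flow[OF z] by (simp add: matmul.scaleR_left matmul.scaleR_right matmul.minus_left matmul.minus_right)

text \<open>The trace is a spatial derivative of \<open>ln (sqrt (det G))\<close>, and the time
  derivative of that function under the flow is minus the scalar curvature; the two derivatives
  commute.\<close>

lemma dd_\<tau>_trace_\<Gamma>:
  assumes z: "z \<in> W"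
  shows "dd \<tau> (\<lambda>z. trace (\<Gamma> k z)) z = - D k (\<lambda>z. trace (Q z)) z"
proof -
  have half: "dd v (\<lambda>z. c * F z) z = c * dd v F z" if "smooth_on W F" for F :: "'a \<Rightarrow> real" and v c
    by (rule dd_bounded_linear[OF bounded_linear_mult_right differentiable[OF that z]])
  have "dd \<tau> (\<lambda>z. trace (\<Gamma> k z)) z = dd \<tau> (\<lambda>z. 1 / 2 * trace (N z ** D k G z)) z"
    by (rule dd_cong[OF open_W z]) (simp add: trace_\<Gamma>)
  also have "\<dots> = 1 / 2 * dd \<tau> (\<lambda>z. trace (N z ** D k G z)) z"
    by (intro half smooth_trace smooth_intros)
  also have "dd \<tau> (\<lambda>z. trace (N z ** D k G z)) z = D k (\<lambda>z. trace (N z ** dd \<tau> G z)) z"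
    by (rule dd_trace_commute[OF z])
  also have "\<dots> = D k (\<lambda>z. (-2) * trace (Q z)) z"
    by (rule dd_cong[OF open_W z])
      (simp add: flow matmul.scaleR_right matmul.minus_right trace_def sum_distrib_left sum_negf)
  also have "\<dots> = (-2) * D k (\<lambda>z. trace (Q z)) z"
    by (intro half smooth_trace smooth_Q)
  finally show ?thesis by simp
qed

lemma divg_Q:
  assumes X: "smooth_on W X" and z: "z \<in> W"
  shows "divg (\<lambda>z. Q z *v X z) z
    = (\<Sum>j\<in>UNIV. D j (\<lambda>z. trace (Q z)) z * X z $ j) / 2 + (\<Sum>i\<in>UNIV. (Q z *v cov i X z) $ i)"
proof -
  have "cov i (\<lambda>z. Q z *v X z) z
      = (D i Q z + \<Gamma> i z ** Q z - Q z ** \<Gamma> i z) *v X z + Q z *v cov i X z" for i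
    unfolding cov_def dd_matvec[OF smooth_Q X z]
    by (simp add: matvec.add_left matvec.diff_left matvec.add_right matrix_vector_mul_assoc matrix_mul_assoc)
  then have "divg (\<lambda>z. Q z *v X z) z
    = (\<Sum>i\<in>UNIV. ((D i Q z + \<Gamma> i z ** Q z - Q z ** \<Gamma> i z) *v X z) $ i) + (\<Sum>i\<in>UNIV. (Q z *v cov i X z) $ i)"
    unfolding divg_def by (simp add: sum.distrib)
  also have "(\<Sum>i\<in>UNIV. ((D i Q z + \<Gamma> i z ** Q z - Q z ** \<Gamma> i z) *v X z) $ i)
    = (\<Sum>j\<in>UNIV. (\<Sum>i\<in>UNIV. (D i Q z + \<Gamma> i z ** Q z - Q z ** \<Gamma> i z) $ i $ j) * X z $ j)"
    unfolding matvec_component sum_distrib_right by (rule sum.swap)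
  also have "\<dots> = (\<Sum>j\<in>UNIV. D j (\<lambda>z. trace (Q z)) z / 2 * X z $ j)"
    using contracted_bianchi[OF Ric_sym z] by (intro sum.cong refl) (simp add: field_simps)
  finally show ?thesis by (simp add: sum_divide_distrib)
qed

text \<open>The direction \<open>\<tau>\<close> is a direction of \<open>W\<close> like any other,
  so it commutes with each \<open>D i\<close>; besides the divergence of the time derivative only
  the traces of the connection contribute.\<close>

lemma dd_\<tau>_divg:
  assumes X: "smooth_on W X" and z: "z \<in> W"
  shows "dd \<tau> (divg X) z = divg (dd \<tau> X) z - (\<Sum>k\<in>UNIV. D k (\<lambda>z. trace (Q z)) z * X z $ k)"
proof -
  have sm: "smooth_on W (\<lambda>z. D i X z $ i)" "smooth_on W (\<lambda>z. trace (\<Gamma> k z) * X z $ k)" for i k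
    by (intro smooth_trace smooth_intros X)+
  have "dd \<tau> (divg X) z
      = dd \<tau> (\<lambda>z. (\<Sum>i\<in>UNIV. D i X z $ i) + (\<Sum>k\<in>UNIV. trace (\<Gamma> k z) * X z $ k)) z"
    by (rule dd_cong[OF open_W z divg_eq])
  also have "\<dots> = (\<Sum>i\<in>UNIV. dd \<tau> (\<lambda>z. D i X z $ i) z) + (\<Sum>k\<in>UNIV. dd \<tau> (\<lambda>z. trace (\<Gamma> k z) * X z $ k) z)"
    by (simp add: dd_add dd_sum differentiable[OF sm(1) z] differentiable[OF sm(2) z])
  also have "(\<lambda>k. dd \<tau> (\<lambda>z. trace (\<Gamma> k z) * X z $ k) z)
      = (\<lambda>k. trace (\<Gamma> k z) * dd \<tau> X z $ k - D k (\<lambda>z. trace (Q z)) z * X z $ k)"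
  proof
    fix k
    have "dd \<tau> (\<lambda>z. trace (\<Gamma> k z) * X z $ k) z
      = trace (\<Gamma> k z) * dd \<tau> (\<lambda>z. X z $ k) z + dd \<tau> (\<lambda>z. trace (\<Gamma> k z)) z * X z $ k"
      by (intro dd_bounded_bilinear[OF bounded_bilinear_mult] differentiable smooth_trace smooth_intros X z)
    then show "dd \<tau> (\<lambda>z. trace (\<Gamma> k z) * X z $ k) z
      = trace (\<Gamma> k z) * dd \<tau> X z $ k - D k (\<lambda>z. trace (Q z)) z * X z $ k"
      by (simp add: dd_\<tau>_trace_\<Gamma>[OF z] dd_vec_nth[OF differentiable[OF X z]])
  qed
  also have "(\<lambda>i. dd \<tau> (\<lambda>z. D i X z $ i) z) = (\<lambda>i. D i (dd \<tau> X) z $ i)"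
    using dd_vec_nth[OF differentiable[OF smooth_D[OF X] z]] dd_commute[OF open_W X z, of \<tau>] by simp
  finally show ?thesis
    by (simp add: divg_eq[OF z] sum_subtractf)
qed

lemma dd_\<tau>_grad:
  assumes F: "smooth_on W F" and z: "z \<in> W"
  shows "dd \<tau> (grad F) z = grad (dd \<tau> F) z + 2 *\<^sub>R (Q z *v grad F z)"
proof -
  have "dd \<tau> (diff F) z = diff (dd \<tau> F) z"
    using dd_diff_component[OF F z, of \<tau>] dd_commute[OF open_W F z, of \<tau>]
    by (simp add: vec_eq_iff diff_def)
  then show ?thesis
    unfolding dd_grad[OF F z] dd_\<tau>_N[OF z] grad_def
    by (simp add: matvec.scaleR_left matrix_vector_mul_assoc)
qed

text \<open>The connection contributes minus the derivative of the scalar curvature along the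
  gradient. The changing inverse metric contributes the divergence of \<open>2 Q\<close> applied to
  the gradient, hence twice half of that derivative, and the two cancel.\<close>

lemma dd_\<tau>_lap:
  assumes F: "smooth_on W F" and z: "z \<in> W"
  shows "dd \<tau> (lap F) z = lap (dd \<tau> F) z + 2 * (\<Sum>i\<in>UNIV. (Q z *v cov i (grad F) z) $ i)"
proof -
  note X = smooth_grad[OF F]
  have QX: "smooth_on W (\<lambda>z. Q z *v grad F z)"
    by (intro smooth_intros F)
  have "divg (dd \<tau> (grad F)) z = divg (\<lambda>z. grad (dd \<tau> F) z + 2 *\<^sub>R (Q z *v grad F z)) z"
    by (rule divg_cong[OF z dd_\<tau>_grad[OF F]])
  also have "\<dots> = divg (grad (dd \<tau> F)) z + 2 * divg (\<lambda>z. Q z *v grad F z) z"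
    using divg_add[OF smooth_grad[OF smooth_D[OF F]] smooth_on_bounded_linear[OF open_W bounded_linear_scaleR_right QX] z]
      divg_scaleR[OF QX z] by metis
  finally show ?thesis
    unfolding lap_def dd_\<tau>_divg[OF X z] divg_Q[OF X z] by simp
qed

lemma evolution_of_laplacian:
  assumes f: "smooth_on W f" and q: "smooth_on W q" and z: "z \<in> W"
    and eq: "\<And>y. y \<in> W \<Longrightarrow> dd \<tau> f y = lap f y + grad f y \<bullet> diff f y - q y - a * f y"
  defines "X \<equiv> grad f"
  shows "dd \<tau> (lap f) z = lap (lap f) z + 2 * (\<Sum>j\<in>UNIV. X z $ j * D j (lap f) z)
    + 2 * (\<Sum>i\<in>UNIV. \<Sum>j\<in>UNIV. cov i X z $ j * cov j X z $ i)
    + 2 * (\<Sum>i\<in>UNIV. (Q z *v cov i X z) $ i)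
    + 2 * (X z \<bullet> (Ric z *v X z)) - lap q z - a * lap f z"
proof -
  have sm: "smooth_on W (\<lambda>z. grad f z \<bullet> diff f z)" "smooth_on W (\<lambda>z. (-1) * q z)" "smooth_on W (\<lambda>z. (- a) * f z)"
    by (intro smooth_inner smooth_intros f q)+
  have "lap (dd \<tau> f) z = lap (\<lambda>z. (lap f z + grad f z \<bullet> diff f z) + ((-1) * q z + (- a) * f z)) z"
    by (rule lap_cong[OF z]) (simp add: eq)
  also have "\<dots> = lap (lap f) z + lap (\<lambda>z. grad f z \<bullet> diff f z) z + (lap (\<lambda>z. (-1) * q z) z + lap (\<lambda>z. (- a) * f z) z)"
    by (subst lap_add, (intro smooth_on_add open_W sm smooth_lap f z)+)+ simp
  finally show ?thesis
    unfolding dd_\<tau>_lap[OF f z] bochner[OF f z] lap_cmult[OF f z] lap_cmult[OF q z] X_def by simp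
qed

end

section \<open>Symmetric matrices\<close>

text \<open>Gram-Schmidt by induction over subsets of the index type, so that the frame is indexed
  by \<open>'n\<close> itself. The frame turns traces taken with the metric into ordinary matrix
  traces.\<close>

lemma ex_orthonormal_frame:
  fixes G :: "real^'n::finite^'n"
  assumes sym: "transpose G = G" and pos: "\<And>v. v \<noteq> 0 \<Longrightarrow> 0 < v \<bullet> (G *v v)"
  obtains B :: "real^'n^'n" where "transpose B ** G ** B = mat 1"
proof -
  have comm: "x \<bullet> (G *v y) = y \<bullet> (G *v x)" for x y
    using matvec_adjoint[of G x y] sym by (simp add: inner_commute)
  have "\<exists>b :: 'n \<Rightarrow> real^'n. \<forall>i\<in>I. \<forall>j\<in>I. b i \<bullet> (G *v b j) = (if i = j then 1 else 0)" for I :: "'n set"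
    using finite[of I]
  proof (induction I)
    case empty
    then show ?case by simp
  next
    case (insert k I)
    then obtain b :: "'n \<Rightarrow> real^'n"
      where b: "\<And>i j. i \<in> I \<Longrightarrow> j \<in> I \<Longrightarrow> b i \<bullet> (G *v b j) = (if i = j then 1 else 0)"
      by blast
    \<comment> \<open>\<open>I\<close> misses the index \<open>k\<close>, so the images of the
      vectors found so far span a proper subspace, and a nonzero vector orthogonal to it
      exists.\<close>
    let ?S = "(\<lambda>i. G *v b i) ` I"
    have "dim ?S \<le> card ?S"
      by (simp add: dim_le_card')
    also have "\<dots> \<le> card I"
      by (simp add: card_image_le)
    also have "\<dots> < CARD('n)"
      using insert.hyps by (intro psubset_card_mono) auto
    finally obtain v where v: "v \<noteq> 0" "\<And>y. y \<in> span ?S \<Longrightarrow> orthogonal v y"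
      using orthogonal_to_subspace_exists[of ?S] by auto
    have orth: "v \<bullet> (G *v b i) = 0" if "i \<in> I" for i
      using v(2)[of "G *v b i"] that by (auto simp: orthogonal_def span_base)
    have orth': "b i \<bullet> (G *v v) = 0" if "i \<in> I" for i
      using orth[OF that] comm[of v "b i"] by simp
    define c where "c = inverse (sqrt (v \<bullet> (G *v v)))"
    have c: "c * c * (v \<bullet> (G *v v)) = 1"
      using pos[OF v(1)] unfolding c_def by (simp add: field_simps)
    have "\<forall>i\<in>insert k I. \<forall>j\<in>insert k I. (b(k := c *\<^sub>R v)) i \<bullet> (G *v (b(k := c *\<^sub>R v)) j) = (if i = j then 1 else 0)"
      using b c orth orth' insert.hyps by (auto simp: matvec.scaleR_right)
    then show ?case by blast
  qed
  then obtain b :: "'n \<Rightarrow> real^'n" where b: "\<And>i j. b i \<bullet> (G *v b j) = (if i = j then 1 else 0)"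
    by (metis UNIV_I)
  define B where "B = (\<chi> i j. b j $ i)"
  have "(transpose B ** G ** B) $ i $ j = b i \<bullet> (G *v b j)" for i j
    unfolding matrix_mul_assoc[symmetric] matmul_component[of "transpose B"] matmul_component[of G]
      transpose_component by (simp add: inner_vec_def matvec_component B_def)
  then have "transpose B ** G ** B = mat 1"
    by (simp add: vec_eq_iff mat_def b)
  then show ?thesis using that by blast
qed

lemma trace_square_symmetric:
  fixes S :: "real^'n::finite^'n"
  assumes "transpose S = S"
  shows "trace (S ** S) = (\<Sum>i\<in>UNIV. \<Sum>j\<in>UNIV. (S $ i $ j)\<^sup>2)"
proof -
  have "S $ j $ i = S $ i $ j" for i j
    using assms by (metis transpose_component)
  then show ?thesis
    by (simp add: trace_def matmul_component power2_eq_square)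
qed

text \<open>Cauchy-Schwarz on the diagonal entries, followed by adding the squares of the
  off-diagonal ones.\<close>

lemma trace_squared_le:
  fixes S :: "real^'n::finite^'n"
  assumes "transpose S = S"
  shows "(trace S)\<^sup>2 \<le> CARD('n) * trace (S ** S)"
proof -
  have "(trace S)\<^sup>2 \<le> (\<Sum>i\<in>(UNIV::'n set). 1\<^sup>2) * (\<Sum>i\<in>UNIV. (S $ i $ i)\<^sup>2)"
    using Cauchy_Schwarz_ineq_sum[of "\<lambda>i. 1" "\<lambda>i. S $ i $ i" UNIV] by (simp add: trace_def)
  also have "\<dots> \<le> CARD('n) * trace (S ** S)"
    unfolding trace_square_symmetric[OF assms]
    by (auto intro!: mult_left_mono sum_mono member_le_sum)
  finally show ?thesis .
qed

lemma trace_le_of_bounded: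
  fixes \<rho> :: "real^'n::finite^'n" and K :: real
  assumes "\<And>v. v \<bullet> (\<rho> *v v) \<le> K * (v \<bullet> v)"
  shows "trace \<rho> \<le> CARD('n) * K"
proof -
  have "\<rho> $ i $ i \<le> K" for i
    using assms[of "axis i 1"] by (simp add: matrix_vector_mult_basis column_def inner_axis' inner_axis)
  then show ?thesis
    unfolding trace_def using sum_bounded_above[of UNIV "\<lambda>i. \<rho> $ i $ i" K] by simp
qed

text \<open>No diagonalization is used: nonnegativity of the form at \<open>t v - \<rho> v\<close>,
  with the upper bound at \<open>v\<close> and at \<open>\<rho> v\<close>, bounds the norm of
  \<open>\<rho> v\<close> by \<open>K\<close> times that of \<open>v\<close>. Summing over the
  standard basis gives the trace.\<close>

lemma trace_square_le_of_bounded: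
  fixes \<rho> :: "real^'n::finite^'n" and K :: real
  assumes sym: "transpose \<rho> = \<rho>" and K: "0 \<le> K"
    and nonneg: "\<And>v. 0 \<le> v \<bullet> (\<rho> *v v)" and bound: "\<And>v. v \<bullet> (\<rho> *v v) \<le> K * (v \<bullet> v)"
  shows "trace (\<rho> ** \<rho>) \<le> CARD('n) * K\<^sup>2"
proof -
  have adj: "x \<bullet> (\<rho> *v y) = (\<rho> *v x) \<bullet> y" for x y
    using matvec_adjoint[of \<rho> x y] sym by simp
  have *: "(\<rho> *v v) \<bullet> (\<rho> *v v) \<le> K\<^sup>2 * (v \<bullet> v)" for v
  proof -
    have quad: "0 \<le> t\<^sup>2 * (v \<bullet> (\<rho> *v v)) - 2 * t * ((\<rho> *v v) \<bullet> (\<rho> *v v))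
        + (\<rho> *v v) \<bullet> (\<rho> *v (\<rho> *v v))" for t
      using nonneg[of "t *\<^sub>R v - \<rho> *v v"] adj[of v "\<rho> *v v"]
      by (simp add: matvec.diff_right matvec.scaleR_right inner_diff_left inner_diff_right power2_eq_square algebra_simps)
    have le: "2 * t * ((\<rho> *v v) \<bullet> (\<rho> *v v)) \<le> t\<^sup>2 * (K * (v \<bullet> v)) + K * ((\<rho> *v v) \<bullet> (\<rho> *v v))" for t
      using quad[of t] bound[of "\<rho> *v v"] mult_left_mono[OF bound[of v], of "t\<^sup>2"] by simp
    show ?thesis
    \<comment> \<open>The choice \<open>t = K\<close> gives the sharp constant after division by
      \<open>K\<close>; for \<open>K = 0\<close> the choice \<open>t = 1\<close> already forces
      \<open>\<rho> v = 0\<close>.\<close>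
    proof (cases "K = 0")
      case True
      then show ?thesis using le[of 1] by simp
    next
      case False
      have "K * ((\<rho> *v v) \<bullet> (\<rho> *v v)) \<le> K * (K\<^sup>2 * (v \<bullet> v))"
        using le[of K] by (simp add: power2_eq_square algebra_simps)
      then show ?thesis using False K by simp
    qed
  qed
  have "(\<Sum>j\<in>UNIV. (\<rho> $ i $ j)\<^sup>2) \<le> K\<^sup>2" for i
  proof -
    have "\<rho> *v axis i 1 = (\<chi> j. \<rho> $ i $ j)"
      using sym by (simp add: matrix_vector_mult_basis column_def vec_eq_iff) (metis transpose_component)
    then show ?thesis
      using *[of "axis i 1"] by (simp add: inner_vec_def[of "\<rho> $ i"] power2_eq_square inner_axis_axis)
  qed
  then show ?thesis
    unfolding trace_square_symmetric[OF sym]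
    using sum_bounded_above[of UNIV "\<lambda>i. \<Sum>j\<in>UNIV. (\<rho> $ i $ j)\<^sup>2" "K\<^sup>2"] by simp
qed

text \<open>With \<open>M = S + \<rho> / 2\<close> the left side is twice the trace of the square of
  \<open>M\<close> minus half the trace of the square of \<open>\<rho>\<close>; the two preceding
  trace bounds estimate these terms.\<close>

lemma trace_quadratic_ge:
  fixes S \<rho> :: "real^'n::finite^'n" and K :: real
  assumes S: "transpose S = S" and \<rho>: "transpose \<rho> = \<rho>" and K: "0 \<le> K"
    and nonneg: "\<And>v. 0 \<le> v \<bullet> (\<rho> *v v)" and bound: "\<And>v. v \<bullet> (\<rho> *v v) \<le> K * (v \<bullet> v)"
  shows "2 * trace (S ** S) + 2 * trace (\<rho> ** S)
    \<ge> 2 / CARD('n) * (trace S + trace \<rho> / 2)\<^sup>2 - CARD('n) * K\<^sup>2 / 2"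
proof -
  define M where "M = S + (1 / 2) *\<^sub>R \<rho>"
  have M: "transpose M = M"
    using S \<rho> by (simp add: M_def transpose_add transpose_scalar)
  have trM: "trace M = trace S + trace \<rho> / 2"
    by (simp add: M_def trace_def sum.distrib sum_divide_distrib)
  have "M ** M = S ** S + (1 / 2) *\<^sub>R (S ** \<rho>) + (1 / 2) *\<^sub>R (\<rho> ** S) + (1 / 4) *\<^sub>R (\<rho> ** \<rho>)"
    by (simp add: M_def matmul.add_left matmul.add_right matmul.scaleR_left matmul.scaleR_right scaleR_add_right)
  then have "trace (M ** M) = trace (S ** S) + trace (\<rho> ** S) + trace (\<rho> ** \<rho>) / 4"
    using trace_mul_sym[of S \<rho>] by (simp add: trace_add linear_cmul[OF bounded_linear.linear[OF bounded_linear_trace]])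
  moreover have "(trace M)\<^sup>2 / CARD('n) \<le> trace (M ** M)"
    using trace_squared_le[OF M] by (simp add: field_simps)
  moreover have "trace (\<rho> ** \<rho>) \<le> CARD('n) * K\<^sup>2"
    by (rule trace_square_le_of_bounded[OF \<rho> K nonneg bound])
  ultimately show ?thesis
    unfolding trM by simp
qed

section \<open>The estimate at a critical point\<close>

text \<open>Minimality is asked only along one line, because in space-time the comparison is
  available only among points of equal time.\<close>

lemma local_min_second_derivative:
  fixes h :: "'v::real_normed_vector \<Rightarrow> real"
  assumes W: "open W" and h: "smooth_on W h" and z: "z \<in> W" and d: "0 < d"
    and min: "\<And>s. \<bar>s\<bar> < d \<Longrightarrow> h z \<le> h (z + s *\<^sub>R v)"
  shows "dd v h z = 0" and "0 \<le> dd v (dd v h) z"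
proof -
  have "((\<lambda>s. z + s *\<^sub>R v) \<longlongrightarrow> z + 0 *\<^sub>R v) (at 0)"
    by (intro tendsto_intros)
  then have "\<forall>\<^sub>F s in at 0. z + s *\<^sub>R v \<in> W"
    using W z by (simp add: topological_tendstoD)
  then obtain d' where d': "d' > 0" "\<And>s. s \<noteq> 0 \<Longrightarrow> \<bar>s\<bar> < d' \<Longrightarrow> z + s *\<^sub>R v \<in> W"
    unfolding eventually_at by (auto simp: dist_real_def)
  have inW: "z + s *\<^sub>R v \<in> W" if "\<bar>s\<bar> < d'" for s
    using d'(2)[of s] that z by (cases "s = 0") auto
  let ?g = "\<lambda>s. h (z + s *\<^sub>R v)"
  have g: "(?g has_real_derivative dd v h (z + s *\<^sub>R v)) (at s)" if "\<bar>s\<bar> < d'" for s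
    by (rule smooth_on_line_deriv[OF W h inW[OF that]])
  have g': "((\<lambda>s. dd v h (z + s *\<^sub>R v)) has_real_derivative dd v (dd v h) z) (at 0)"
    using smooth_on_line_deriv[OF W smooth_on_dd[OF W h] inW[of 0], of v] d' by simp
  show *: "dd v h z = 0"
    using DERIV_local_min[OF g[of 0] d] d' min by simp
  show "0 \<le> dd v (dd v h) z"
  proof (rule ccontr)
    assume "\<not> 0 \<le> dd v (dd v h) z"
    then obtain e where e: "e > 0" "\<And>s. 0 < s \<Longrightarrow> s < e \<Longrightarrow> dd v h (z + s *\<^sub>R v) < 0"
      using DERIV_neg_dec_right[OF g'] * by auto
    define s where "s = min e (min d d') / 2"
    have s: "0 < s" "s < e" "s < d" "s < d'" using e d d' by (auto simp: s_def)
    obtain r where r: "0 < r" "r < s" "?g s - ?g 0 = (s - 0) * dd v h (z + r *\<^sub>R v)"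
      using MVT2[OF s(1), of ?g "\<lambda>s. dd v h (z + s *\<^sub>R v)"] g s by auto
    have "dd v h (z + r *\<^sub>R v) < 0" using e(2) r s by simp
    then have "s * dd v h (z + r *\<^sub>R v) < 0" using s by (simp add: mult_pos_neg)
    then show False using r(3) min[of s] s by simp
  qed
qed

text \<open>This is where the constant of the theorem is tested: its summands outweigh the curvature
  defect, \<open>\<theta>\<close> and \<open>a h\<close>, and the full \<open>2 / n * x^2\<close>
  survives.\<close>

lemma harnack_arithmetic:
  fixes n K \<theta> a h R x :: real
  assumes n: "0 < n" and K: "0 \<le> K" and \<theta>: "0 \<le> \<theta>" and x: "0 < x" and R: "R \<le> n * K"
    and h: "h = - (x + n * K + sqrt (n * \<theta>) + n / 2 * \<bar>a\<bar>)"
  shows "2 / n * x\<^sup>2 \<le> 2 / n * (h + R / 2)\<^sup>2 - n * K\<^sup>2 / 2 - \<theta> - a * h"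
proof -
  \<comment> \<open>In these variables \<open>n K^2 / 2 = 2 y^2 / n\<close>,
    \<open>\<theta> = s^2 / n\<close> and \<open>|a| = 2 w / n\<close>, so the inequality becomes
    one between quadratic forms divided by \<open>n\<close>. Since \<open>R / 2\<close> is at most
    \<open>y\<close>, only one of the two copies of \<open>y\<close> in \<open>- h\<close> is lost
    to it.\<close>
  define y s w where "y = n * K / 2" and "s = sqrt (n * \<theta>)" and "w = n / 2 * \<bar>a\<bar>"
  have nn: "0 \<le> y" "0 \<le> s" "0 \<le> w" using n K \<theta> by (simp_all add: y_def s_def w_def)
  have h': "h = - (x + 2 * y + s + w)" unfolding h y_def s_def w_def by simp
  have "(x + y + s + w)\<^sup>2 \<le> (- (h + R / 2))\<^sup>2"
    using nn x R by (intro power_mono) (auto simp: h' y_def mult.commute)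
  then have "(x + y + s + w)\<^sup>2 \<le> (h + R / 2)\<^sup>2"
    by (simp only: power2_minus)
  then have "2 / n * (x + y + s + w)\<^sup>2 \<le> 2 / n * (h + R / 2)\<^sup>2"
    using n by (intro mult_left_mono) auto
  moreover have "- (2 * w / n) * (x + 2 * y + s + w) \<le> - a * h"
  proof -
    have "- a \<le> \<bar>a\<bar>" by simp
    then have "- \<bar>a\<bar> * (x + 2 * y + s + w) \<le> a * (x + 2 * y + s + w)"
      using nn x by (intro mult_right_mono) auto
    moreover have "2 * w / n = \<bar>a\<bar>" using n by (simp add: w_def)
    ultimately show ?thesis unfolding h' by (simp only: minus_mult_minus)
  qed
  moreover have "n * K\<^sup>2 / 2 = 2 / n * y\<^sup>2" "\<theta> = s\<^sup>2 / n"
    using n \<theta> by (simp_all add: y_def s_def power2_eq_square)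
  moreover have "2 / n * x\<^sup>2 \<le> 2 / n * (x + y + s + w)\<^sup>2 - 2 / n * y\<^sup>2 - s\<^sup>2 / n - (2 * w / n) * (x + 2 * y + s + w)"
  proof -
    \<comment> \<open>In the expansion the terms in \<open>y^2\<close>, \<open>w^2\<close> and
      \<open>y w\<close> cancel exactly; all others have nonnegative coefficients.\<close>
    have "2 * x\<^sup>2 \<le> 2 * x\<^sup>2 + (s\<^sup>2 + 4 * (x * y) + 4 * (x * s) + 2 * (x * w) + 4 * (y * s) + 2 * (s * w))"
      using nn x by simp
    also have "\<dots> = 2 * (x + y + s + w)\<^sup>2 - 2 * y\<^sup>2 - s\<^sup>2 - 2 * w * (x + 2 * y + s + w)"
      by (simp add: power2_eq_square algebra_simps)
    finally have "2 * x\<^sup>2 / n \<le> (2 * (x + y + s + w)\<^sup>2 - 2 * y\<^sup>2 - s\<^sup>2 - 2 * w * (x + 2 * y + s + w)) / n"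
      using n by (intro divide_right_mono) auto
    then show ?thesis by (simp add: diff_divide_distrib)
  qed
  ultimately show ?thesis by simp
qed

context metric_patch
begin

lemma N_eq_frame:
  fixes B :: "real^'n^'n"
  assumes z: "z \<in> W" and B: "transpose B ** G z ** B = mat 1"
  shows "N z = B ** transpose B"
proof -
  have 1: "B ** (transpose B ** G z) = mat 1"
    using B matrix_left_right_inverse[of "transpose B ** G z" B] by (simp add: matrix_mul_assoc)
  have "N z = B ** (transpose B ** G z) ** N z"
    unfolding 1 by simp
  also have "\<dots> = B ** transpose B ** (G z ** N z)"
    by (simp add: matrix_mul_assoc)
  finally show ?thesis by (simp add: G_N[OF z])
qed

lemma dd_sum_frame:
  assumes F: "smooth_on W F" and z: "z \<in> W"
  shows "dd (\<Sum>i\<in>UNIV. b i *\<^sub>R e i) F z = (\<Sum>i\<in>UNIV. b i *\<^sub>R D i F z)"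
proof -
  have "linear (\<lambda>v. dd v F z)"
    using smooth_on_has_derivative[OF open_W F z] has_derivative_linear by blast
  then show ?thesis by (simp add: linear_sum linear_cmul)
qed

text \<open>At a critical point the Hessian consists of plain second partial derivatives, and
  \<open>N = B B^T\<close> splits the Laplacian into second derivatives along the frame vectors,
  each of them nonnegative.\<close>

lemma lap_nonneg_of_local_min:
  assumes h: "smooth_on W h" and z: "z \<in> W" and pos: "\<And>v. v \<noteq> 0 \<Longrightarrow> 0 < v \<bullet> (G z *v v)"
    and min: "\<And>b. \<exists>d>0. \<forall>s. \<bar>s\<bar> < d \<longrightarrow> h z \<le> h (z + s *\<^sub>R (\<Sum>i\<in>UNIV. b i *\<^sub>R e i))"
  shows "D i h z = 0" and "0 \<le> lap h z"
proof -
  have crit: "D i h z = 0" for i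
  proof -
    obtain d where d: "d > 0" "\<And>s. \<bar>s\<bar> < d \<Longrightarrow> h z \<le> h (z + s *\<^sub>R (\<Sum>j\<in>UNIV. (if j = i then 1 else 0) *\<^sub>R e j))"
      using min[of "\<lambda>j. if j = i then 1 else 0"] by blast
    have "(\<Sum>j\<in>UNIV. (if j = i then 1 else 0) *\<^sub>R e j) = e i"
      by (simp add: if_distrib[of "\<lambda>r. r *\<^sub>R _"] cong: if_cong)
    then show ?thesis
      using local_min_second_derivative(1)[OF open_W h z d(1), of "e i"] d(2) by simp
  qed
  then show "D i h z = 0" .
  obtain B :: "real^'n^'n" where B: "transpose B ** G z ** B = mat 1"
    using ex_orthonormal_frame[OF G_sym[OF z] pos] by blast
  have hess: "hess h i z $ j = D i (D j h) z" for i j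
    by (simp add: hess_component[OF h z] crit)
  have nn: "0 \<le> (\<Sum>i\<in>UNIV. \<Sum>j\<in>UNIV. b i * b j * D i (D j h) z)" for b
  proof -
    let ?v = "\<Sum>i\<in>UNIV. b i *\<^sub>R e i"
    obtain d where d: "d > 0" "\<And>s. \<bar>s\<bar> < d \<Longrightarrow> h z \<le> h (z + s *\<^sub>R ?v)"
      using min[of b] by blast
    have "0 \<le> dd ?v (dd ?v h) z"
      by (rule local_min_second_derivative(2)[OF open_W h z d])
    also have "dd ?v (dd ?v h) z = (\<Sum>i\<in>UNIV. b i * D i (dd ?v h) z)"
      using dd_sum_frame[OF smooth_D[OF h] z] by simp
    also have "\<dots> = (\<Sum>i\<in>UNIV. b i * (\<Sum>j\<in>UNIV. b j * D i (D j h) z))"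
    proof (intro sum.cong refl arg_cong2[where f = "(*)"])
      fix i
      have "D i (dd ?v h) z = D i (\<lambda>z. \<Sum>j\<in>UNIV. b j * D j h z) z"
        using dd_sum_frame[OF h] by (intro dd_cong[OF open_W z]) simp
      also have "\<dots> = (\<Sum>j\<in>UNIV. D i (\<lambda>z. b j * D j h z) z)"
        by (intro dd_sum differentiable smooth_intros h z)
      also have "\<dots> = (\<Sum>j\<in>UNIV. b j * D i (D j h) z)"
        by (intro sum.cong refl dd_bounded_linear[OF bounded_linear_mult_right] differentiable smooth_intros h z)
      finally show "D i (dd ?v h) z = (\<Sum>j\<in>UNIV. b j * D i (D j h) z)" .
    qed
    finally show ?thesis by (simp add: sum_distrib_left mult.assoc)
  qed
  have "lap h z = (\<Sum>i\<in>UNIV. \<Sum>j\<in>UNIV. \<Sum>k\<in>UNIV. B $ i $ k * B $ j $ k * D i (D j h) z)"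
    unfolding lap_eq[OF h z] hess N_eq_frame[OF z B] matmul_component transpose_component sum_distrib_right ..
  also have "\<dots> = (\<Sum>i\<in>UNIV. \<Sum>k\<in>UNIV. \<Sum>j\<in>UNIV. B $ i $ k * B $ j $ k * D i (D j h) z)"
    by (intro sum.cong refl sum.swap)
  also have "\<dots> = (\<Sum>k\<in>UNIV. \<Sum>i\<in>UNIV. \<Sum>j\<in>UNIV. B $ i $ k * B $ j $ k * D i (D j h) z)"
    by (rule sum.swap)
  also have "\<dots> \<ge> 0"
    by (intro sum_nonneg nn)
  finally show "0 \<le> lap h z" .
qed

end

context ricci_flow_patch
begin

text \<open>In an orthonormal frame the Hessian and the Ricci tensor become symmetric matrices
  \<open>S\<close> and \<open>\<rho>\<close>, the latter between 0 and \<open>K\<close>, and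
  cyclicity of the trace moves the terms of the evolution equation there. At the minimum the
  gradient term vanishes and the Laplacian of \<open>lap f\<close> is nonnegative.\<close>

lemma harnack_critical_point:
  fixes K \<theta> a x :: real
  assumes f: "smooth_on W f" and q: "smooth_on W q" and z: "z \<in> W"
    and eq: "\<And>y. y \<in> W \<Longrightarrow> dd \<tau> f y = lap f y + grad f y \<bullet> diff f y - q y - a * f y"
    and pos: "\<And>v. v \<noteq> 0 \<Longrightarrow> 0 < v \<bullet> (G z *v v)"
    and K: "0 \<le> K" and Ric_nonneg: "\<And>v. 0 \<le> v \<bullet> (Ric z *v v)"
    and Ric_le: "\<And>v. v \<bullet> (Ric z *v v) \<le> K * (v \<bullet> (G z *v v))"
    and \<theta>: "0 \<le> \<theta>" "lap q z \<le> \<theta>"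
    and min: "\<And>b. \<exists>d>0. \<forall>s. \<bar>s\<bar> < d \<longrightarrow> lap f z \<le> lap f (z + s *\<^sub>R (\<Sum>i\<in>UNIV. b i *\<^sub>R e i))"
    and x: "0 < x" and h: "lap f z = - (x + CARD('b) * K + sqrt (CARD('b) * \<theta>) + CARD('b) / 2 * \<bar>a\<bar>)"
  shows "2 / CARD('b) * x\<^sup>2 \<le> dd \<tau> (lap f) z"
proof -
  define X where "X = grad f"
  define H where "H = (\<chi> i. hess f i z)"
  obtain B :: "real^'b^'b" where B: "transpose B ** G z ** B = mat 1"
    using ex_orthonormal_frame[OF G_sym[OF z] pos] by blast
  note N = N_eq_frame[OF z B]
  define S where "S = transpose B ** H ** B"
  define \<rho> where "\<rho> = transpose B ** Ric z ** B"
  have H_sym: "transpose H = H"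
    by (simp add: vec_eq_iff transpose_component H_def hess_sym[OF f z])
  have S_sym: "transpose S = S" and \<rho>_sym: "transpose \<rho> = \<rho>"
    unfolding S_def \<rho>_def using H_sym Ric_sym[OF z] by (simp_all add: matrix_transpose_mul matrix_mul_assoc)
  have \<rho>_inner: "v \<bullet> (\<rho> *v v) = (B *v v) \<bullet> (Ric z *v (B *v v))" for v
    unfolding \<rho>_def by (simp add: matvec_adjoint[of B] matrix_vector_mul_assoc matrix_mul_assoc del: transpose_matrix_vector)
  have G_inner: "v \<bullet> v = (B *v v) \<bullet> (G z *v (B *v v))" for v
    using arg_cong[OF B, of "\<lambda>A. v \<bullet> (A *v v)"]
    by (simp add: matvec_adjoint[of B] matrix_vector_mul_assoc matrix_mul_assoc del: transpose_matrix_vector)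
  have \<rho>_nonneg: "0 \<le> v \<bullet> (\<rho> *v v)" and \<rho>_le: "v \<bullet> (\<rho> *v v) \<le> K * (v \<bullet> v)" for v
    unfolding \<rho>_inner G_inner[of v] by (rule Ric_nonneg, rule Ric_le)
  have cov: "cov i X z $ k = (N z ** H) $ k $ i" for i k
    unfolding X_def cov_grad[OF f z]
    by (simp add: matvec_component matmul_component H_def hess_sym[OF f z, of i])
  have tr_A: "lap f z = trace S"
  proof -
    have "lap f z = trace (N z ** H)"
      using cov by (simp add: lap_def divg_def trace_def X_def)
    also have "\<dots> = trace S"
      unfolding N S_def using trace_mul_sym[of B "transpose B ** H"] by (simp add: matrix_mul_assoc)
    finally show ?thesis .
  qed
  have tr_AA: "(\<Sum>i\<in>UNIV. \<Sum>j\<in>UNIV. cov i X z $ j * cov j X z $ i) = trace (S ** S)"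
  proof -
    have "(\<Sum>i\<in>UNIV. \<Sum>j\<in>UNIV. cov i X z $ j * cov j X z $ i) = trace ((N z ** H) ** (N z ** H))"
      unfolding cov trace_def matmul_component[of "N z ** H"] by (simp add: mult.commute)
    also have "\<dots> = trace (S ** S)"
      unfolding N S_def using trace_mul_sym[of B "transpose B ** H ** B ** transpose B ** H"]
      by (simp add: matrix_mul_assoc)
    finally show ?thesis .
  qed
  have tr_QA: "(\<Sum>i\<in>UNIV. (Q z *v cov i X z) $ i) = trace (\<rho> ** S)"
  proof -
    have "(\<Sum>i\<in>UNIV. (Q z *v cov i X z) $ i) = trace (Q z ** (N z ** H))"
      unfolding trace_def matvec_component cov matmul_component[of "Q z"] ..
    also have "\<dots> = trace (\<rho> ** S)"
      unfolding N S_def \<rho>_def using trace_mul_sym[of B "transpose B ** Ric z ** B ** transpose B ** H"]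
      by (simp add: matrix_mul_assoc)
    finally show ?thesis .
  qed
  have crit: "D j (lap f) z = 0" for j
    using lap_nonneg_of_local_min(1)[OF smooth_lap[OF f] z pos min] .
  have "0 \<le> lap (lap f) z"
    using lap_nonneg_of_local_min(2)[OF smooth_lap[OF f] z pos min] .
  moreover have "2 * trace (S ** S) + 2 * trace (\<rho> ** S)
    \<ge> 2 / CARD('b) * (trace S + trace \<rho> / 2)\<^sup>2 - CARD('b) * K\<^sup>2 / 2"
    by (rule trace_quadratic_ge[OF S_sym \<rho>_sym K \<rho>_nonneg \<rho>_le])
  moreover have "2 / CARD('b) * x\<^sup>2
      \<le> 2 / CARD('b) * (lap f z + trace \<rho> / 2)\<^sup>2 - CARD('b) * K\<^sup>2 / 2 - \<theta> - a * lap f z"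
    by (rule harnack_arithmetic[OF _ K \<theta>(1) x trace_le_of_bounded[OF \<rho>_le] h]) simp
  moreover have "dd \<tau> (lap f) z = lap (lap f) z + 2 * trace (S ** S) + 2 * trace (\<rho> ** S)
      + 2 * (X z \<bullet> (Ric z *v X z)) - lap q z - a * lap f z"
    using evolution_of_laplacian[OF f q z eq] unfolding X_def[symmetric] tr_AA tr_QA crit by simp
  ultimately show ?thesis
    using Ric_nonneg[of "X z"] \<theta>(2) unfolding tr_A by simp
qed

end

section \<open>Charts\<close>

text \<open>The slice of fixed time runs through an open set of space. Hence spatial derivatives are
  two-sided even at the end times, where the space-time derivative is only one within the
  slab.\<close>

lemma partial_spacetime_within:
  fixes F :: "(real^'n::finite) \<times> real \<Rightarrow> real"
  assumes "open U" "x \<in> U" "t \<in> I" "(F has_derivative F') (at (x, t) within U \<times> I)"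
  shows "partial i (\<lambda>y. F (y, t)) x = F' (axis i 1, 0)"
proof -
  have "((\<lambda>y. (y, t)) has_derivative (\<lambda>v. (v, 0))) (at x within U)"
    by (intro derivative_intros)
  moreover have "(F has_derivative F') (at (x, t) within (\<lambda>y. (y, t)) ` U)"
    using assms(3) by (intro has_derivative_subset[OF assms(4)]) auto
  ultimately have "((\<lambda>y. F (y, t)) has_derivative (\<lambda>v. F' (v, 0))) (at x within U)"
    using has_derivative_in_compose[of "\<lambda>y. (y, t)" "\<lambda>v. (v, 0)" x U F F'] by simp
  then have "((\<lambda>y. F (y, t)) has_derivative (\<lambda>v. F' (v, 0))) (at x)"
    unfolding at_within_open[OF assms(2,1)] .
  then show ?thesis
    unfolding partial_def by (rule has_derivative_imp_dd)
qed

lemma partial_spacetime: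
  fixes F :: "(real^'n::finite) \<times> real \<Rightarrow> real"
  assumes "F differentiable (at (x, t))"
  shows "partial i (\<lambda>y. F (y, t)) x = dd (axis i 1, 0) F (x, t)"
  by (rule partial_spacetime_within[of UNIV x t UNIV])
    (use assms in \<open>simp_all add: frechet_derivative_works\<close>)

lemma has_vector_derivative_spacetime:
  fixes F :: "'v::real_normed_vector \<times> real \<Rightarrow> 'w::real_normed_vector"
  assumes "F differentiable (at (x, t))"
  shows "((\<lambda>s. F (x, s)) has_vector_derivative dd (0, 1) F (x, t)) (at t)"
proof -
  have F: "(F has_derivative (\<lambda>v. dd v F (x, t))) (at (x, t))"
    using assms frechet_derivative_works by blast
  have "((\<lambda>s. (x, s)) has_derivative (\<lambda>v. (0, v))) (at t)"
    by (intro derivative_intros)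
  from has_derivative_compose[OF this F]
  have comp: "((\<lambda>s. F (x, s)) has_derivative (\<lambda>v. dd (0, v) F (x, t))) (at t)" .
  have "dd (0, v) F (x, t) = v *\<^sub>R dd (0, 1) F (x, t)" for v
    using linear_cmul[OF has_derivative_linear[OF F], of v "(0, 1)"] by simp
  then show ?thesis
    unfolding has_vector_derivative_def by (rule has_derivative_eq_rhs[OF comp ext])
qed

locale chart =
  fixes M :: "'a::t2_space set" and c :: "('a, 'n::finite) chart"
  assumes is_chart: "is_chart M c"
begin

lemma open_range: "open (range_of c)"
  using is_chart by (simp add: is_chart_def)

lemma point_in_dom: "x \<in> range_of c \<Longrightarrow> point_of c x \<in> dom_of c"
  using is_chart unfolding is_chart_def homeomorphism_def by blast

lemma coords_in_range: "p \<in> dom_of c \<Longrightarrow> coords c p \<in> range_of c"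
  by (simp add: range_of_def)

lemma coords_point: "x \<in> range_of c \<Longrightarrow> coords c (point_of c x) = x"
  using is_chart unfolding is_chart_def homeomorphism_def by blast

lemma point_coords: "p \<in> dom_of c \<Longrightarrow> point_of c (coords c p) = p"
  using is_chart unfolding is_chart_def homeomorphism_def by blast

lemma dom_subset: "dom_of c \<subseteq> M"
  using is_chart unfolding is_chart_def by (blast dest: openin_imp_subset)

end

section \<open>One chart of the flow as a patch of space-time\<close>

locale chart_flow = chart M c
  for M :: "'a::t2_space set" and c :: "('a, 'n::finite) chart" +
  fixes g :: "real \<Rightarrow> ('a, 'n) bilinear_field" and T :: real
  assumes metric_sym: "\<And>t p. t \<in> {0..T} \<Longrightarrow> p \<in> dom_of c \<Longrightarrow> transpose (g t c p) = g t c p"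
    and metric_pos: "\<And>t p v. t \<in> {0..T} \<Longrightarrow> p \<in> dom_of c \<Longrightarrow> v \<noteq> 0 \<Longrightarrow> 0 < v \<bullet> (g t c p *v v)"
    and metric_smooth: "smooth_on (range_of c \<times> {0..T}) (\<lambda>(x, t). g t c (point_of c x))"
    and metric_evolves: "\<And>t p. t \<in> {0..T} \<Longrightarrow> p \<in> dom_of c \<Longrightarrow>
      ((\<lambda>s. g s c p) has_vector_derivative (-2) *\<^sub>R ricci (g t) c p) (at t within {0..T})"
begin

text \<open>End times are left out so that \<open>V\<close> is open and the flow equation holds with
  an ordinary time derivative.\<close>

definition V :: "((real^'n) \<times> real) set" where "V = range_of c \<times> {0<..<T}"

definition e :: "'n \<Rightarrow> (real^'n) \<times> real" where "e i = (axis i 1, 0)"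

definition gm :: "(real^'n) \<times> real \<Rightarrow> real^'n^'n" where
  "gm = (\<lambda>(x, t). g t c (point_of c x))"

definition gi :: "(real^'n) \<times> real \<Rightarrow> real^'n^'n" where
  "gi = (\<lambda>(x, t). matrix_inv (g t c (point_of c x)))"

definition chr :: "'n \<Rightarrow> (real^'n) \<times> real \<Rightarrow> real^'n^'n" where
  "chr i = (\<lambda>(x, t). \<chi> k j. christoffel c (g t) k i j x)"

lemma open_V: "open V"
  unfolding V_def by (intro open_Times open_range) auto

lemma V_subset: "V \<subseteq> range_of c \<times> {0..T}"
  by (auto simp: V_def)

lemma metric_invertible:
  assumes "t \<in> {0..T}" "p \<in> dom_of c"
  shows "invertible (g t c p)"
proof -
  have "g t c p *v x = 0 \<Longrightarrow> x = 0" for x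
    using metric_pos[OF assms, of x] by (cases "x = 0") auto
  then have "\<exists>B. B ** g t c p = mat 1"
    using matrix_left_invertible_ker[of "g t c p"] by blast
  then show ?thesis
    using invertible_left_inverse by blast
qed

lemma metric_inverse:
  assumes "t \<in> {0..T}" "p \<in> dom_of c"
  shows "g t c p ** matrix_inv (g t c p) = mat 1" "matrix_inv (g t c p) ** g t c p = mat 1"
  using metric_invertible[OF assms] unfolding invertible_def matrix_inv_def
  by (metis (mono_tags, lifting) someI_ex)+

lemma smooth_gm: "smooth_on V gm"
  using smooth_on_subset_open[OF metric_smooth open_V V_subset] by (simp add: gm_def)

lemma smooth_gi: "smooth_on V gi"
proof -
  have "smooth_on V (\<lambda>z. matrix_inv (gm z))"
    by (rule smooth_on_matrix_inv[OF open_V smooth_gm])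
      (auto simp: V_def gm_def intro!: metric_invertible point_in_dom)
  then show ?thesis by (rule smooth_on_cong) (auto simp: gi_def gm_def)
qed

lemma gm_diff: "z \<in> V \<Longrightarrow> gm differentiable (at z)"
  using smooth_on_imp_differentiable[OF open_V smooth_gm] .

lemma dd_gm_component:
  assumes "z \<in> V"
  shows "dd v (\<lambda>z. gm z $ i $ j) z = dd v gm z $ i $ j"
proof -
  have "(\<lambda>z. gm z $ i) differentiable (at z)"
    by (rule smooth_on_imp_differentiable[OF open_V smooth_on_vec_nth[OF open_V smooth_gm] assms])
  then have "dd v (\<lambda>z. gm z $ i $ j) z = dd v (\<lambda>z. gm z $ i) z $ j"
    by (rule dd_vec_nth)
  then show ?thesis using dd_vec_nth[OF gm_diff[OF assms]] by simp
qed

lemma gm_sym: "z \<in> V \<Longrightarrow> transpose (gm z) = gm z"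
  by (auto simp: V_def gm_def intro!: metric_sym point_in_dom)

lemma dd_gm_sym:
  assumes z: "z \<in> V"
  shows "dd v gm z $ i $ j = dd v gm z $ j $ i"
  unfolding dd_gm_component[OF z, symmetric]
  using gm_sym by (intro dd_cong[OF open_V z]) (metis transpose_component)

lemma partial_metric_comp:
  assumes "(x, t) \<in> V"
  shows "partial i (metric_comp c (g t) j l) x = dd (e i) gm (x, t) $ j $ l"
proof -
  have "partial i (\<lambda>y. (\<lambda>z. gm z $ j $ l) (y, t)) x = dd (e i) (\<lambda>z. gm z $ j $ l) (x, t)"
    unfolding e_def
    by (intro partial_spacetime smooth_on_imp_differentiable[OF open_V] smooth_on_vec_nth open_V smooth_gm assms)
  then show ?thesis
    unfolding dd_gm_component[OF assms] by (simp add: metric_comp_def[abs_def] gm_def)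
qed

lemma chr_component:
  assumes z: "z \<in> V"
  shows "chr i z $ k $ j = 1 / 2 * (\<Sum>l\<in>UNIV. gi z $ k $ l *
    (dd (e i) gm z $ j $ l + dd (e j) gm z $ i $ l - dd (e l) gm z $ i $ j))"
  using z partial_metric_comp by (cases z) (simp add: chr_def christoffel_def inverse_metric_comp_def gi_def)

lemma smooth_chr: "smooth_on V (chr i)"
proof -
  have "smooth_on V (\<lambda>z. chr i z $ k $ j)" for k j
  proof (rule smooth_on_cong)
    show "smooth_on V (\<lambda>z. 1 / 2 * (\<Sum>l\<in>UNIV. gi z $ k $ l *
      (dd (e i) gm z $ j $ l + dd (e j) gm z $ i $ l - dd (e l) gm z $ i $ j)))"
      by (intro smooth_on_mult smooth_on_sum smooth_on_diff smooth_on_add smooth_on_vec_nth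
          smooth_on_dd smooth_gm smooth_gi smooth_on_const open_V) auto
  qed (simp add: chr_component)
  then have "smooth_on V (\<lambda>z. \<chi> k j. chr i z $ k $ j)"
    by (intro smooth_on_vec_lambda open_V)
  then show ?thesis by simp
qed

lemma gm_gi: "z \<in> V \<Longrightarrow> gm z ** gi z = mat 1" and gi_gm: "z \<in> V \<Longrightarrow> gi z ** gm z = mat 1"
  by (auto simp: V_def gm_def gi_def metric_inverse point_in_dom)

text \<open>Lowering the upper index cancels the inverse metric and leaves the Christoffel symbols
  of the first kind.\<close>

lemma gm_chr_component:
  assumes z: "z \<in> V"
  shows "(gm z ** chr i z) $ l $ j
    = 1 / 2 * (dd (e i) gm z $ j $ l + dd (e j) gm z $ i $ l - dd (e l) gm z $ i $ j)"
proof -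
  define s where "s = (\<chi> l. 1 / 2 * (dd (e i) gm z $ j $ l + dd (e j) gm z $ i $ l - dd (e l) gm z $ i $ j))"
  have "(gm z ** chr i z) $ l $ j = (gm z *v (gi z *v s)) $ l"
    unfolding matmul_component matvec_component[of "gm z"] chr_component[OF z]
    by (simp add: matvec_component s_def sum_distrib_left mult_ac)
  also have "\<dots> = s $ l"
    by (simp add: matrix_vector_mul_assoc gm_gi[OF z])
  finally show ?thesis by (simp add: s_def)
qed

text \<open>Adding two Christoffel symbols of the first kind with the outer indices exchanged leaves
  a single derivative of the metric.\<close>

lemma chr_compatible:
  assumes z: "z \<in> V"
  shows "dd (e i) gm z = transpose (chr i z) ** gm z + gm z ** chr i z"
proof -
  have "transpose (chr i z) ** gm z = transpose (gm z ** chr i z)"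
    by (simp add: matrix_transpose_mul gm_sym[OF z])
  then show ?thesis
    by (simp add: vec_eq_iff transpose_component gm_chr_component[OF z])
      (simp add: dd_gm_sym[OF z, of "e i"] field_simps)
qed

sublocale metric_patch V e gm gi chr
proof
  show "chr i z $ k $ j = chr j z $ k $ i" if "z \<in> V" for z i j k
    unfolding chr_component[OF that] by (simp add: dd_gm_sym[OF that, of _ i j] add.commute)
qed (use open_V smooth_gm smooth_gi smooth_chr gm_sym gi_gm gm_gi chr_compatible in auto)

lemma Ric_eq:
  assumes "(x, t) \<in> V"
  shows "Ric (x, t) = ricci (g t) c (point_of c x)"
proof -
  have x: "x \<in> range_of c" using assms by (simp add: V_def)
  have "partial i (christoffel c (g t) l j k) x = dd (e i) (chr j) (x, t) $ l $ k" for i j k l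
  proof -
    have "partial i (\<lambda>y. (\<lambda>z. chr j z $ l $ k) (y, t)) x = dd (e i) (\<lambda>z. chr j z $ l $ k) (x, t)"
      unfolding e_def by (intro partial_spacetime differentiable smooth_intros assms)
    then show ?thesis
      unfolding dd_component2[OF smooth_\<Gamma> assms] by (simp add: chr_def)
  qed
  then have "riemann c (g t) i i j k x = curv i j (x, t) $ i $ k" for i j k
    unfolding riemann_def curv_def
    by (simp add: matmul_component sum_subtractf) (simp add: chr_def)
  then show ?thesis
    by (simp add: vec_eq_iff Ric_def ricci_def coords_point[OF x])
qed

sublocale ricci_flow_patch V e gm gi chr "(0, 1)"
proof
  fix z assume z: "z \<in> V"
  obtain x t where xt: "z = (x, t)" by fastforce
  have t: "t \<in> {0<..<T}" and x: "x \<in> range_of c" using z by (auto simp: V_def xt)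
  have "((\<lambda>s. g s c (point_of c x)) has_vector_derivative (-2) *\<^sub>R ricci (g t) c (point_of c x)) (at t)"
    using metric_evolves[of t "point_of c x"] t point_in_dom[OF x]
    by (simp add: at_within_Icc_at)
  moreover have "((\<lambda>s. g s c (point_of c x)) has_vector_derivative dd (0, 1) gm z) (at t)"
    using has_vector_derivative_spacetime[OF gm_diff[OF z[unfolded xt]]] by (simp add: gm_def xt)
  ultimately show "dd (0, 1) gm z = (-2) *\<^sub>R Ric z"
    unfolding xt Ric_eq[OF z[unfolded xt]] using vector_derivative_unique_at by blast
qed

abbreviation lift :: "(real \<Rightarrow> 'a \<Rightarrow> real) \<Rightarrow> (real^'n) \<times> real \<Rightarrow> real" where
  "lift w \<equiv> (\<lambda>(x, t). w t (point_of c x))"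

lemma partial_lift:
  assumes w: "smooth_on V (lift w)" and z: "(x, t) \<in> V"
  shows "partial i (\<lambda>y. w t (point_of c y)) x = dd (e i) (lift w) (x, t)"
  using partial_spacetime[OF differentiable[OF w z], of i] by (simp add: e_def)

lemma partial_partial_lift:
  assumes w: "smooth_on V (lift w)" and z: "(x, t) \<in> V"
  shows "partial i (partial j (\<lambda>y. w t (point_of c y))) x = dd (e i) (dd (e j) (lift w)) (x, t)"
proof -
  have "partial i (partial j (\<lambda>y. w t (point_of c y))) x = partial i (\<lambda>y. dd (e j) (lift w) (y, t)) x"
    unfolding partial_def[of i]
    using z by (intro dd_cong[OF open_range]) (auto intro!: partial_lift[OF w] simp: V_def)
  also have "\<dots> = dd (e i) (dd (e j) (lift w)) (x, t)"
    using partial_spacetime[OF differentiable[OF smooth_D[OF w] z], of i] by (simp add: e_def)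
  finally show ?thesis .
qed

lemma laplacian_eq_lap:
  assumes w: "smooth_on V (lift w)" and z: "(x, t) \<in> V"
  shows "laplacian c (g t) (w t) (point_of c x) = lap (lift w) (x, t)"
proof -
  have x: "x \<in> range_of c" using z by (simp add: V_def)
  show ?thesis
    unfolding laplacian_def lap_eq[OF w z] coords_point[OF x] hessian_def hess_component[OF w z]
      partial_partial_lift[OF w z] partial_lift[OF w z]
    by (simp add: inverse_metric_comp_def gi_def chr_def)
qed

lemma grad_norm_sq_eq:
  assumes w: "smooth_on V (lift w)" and z: "(x, t) \<in> V"
  shows "grad_norm_sq c (g t) (w t) (point_of c x) = grad (lift w) (x, t) \<bullet> diff (lift w) (x, t)"
proof -
  have x: "x \<in> range_of c" using z by (simp add: V_def)
  have *: "gradient c (g t) (w t) (point_of c x) = grad (lift w) (x, t)"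
    unfolding gradient_def grad_def diff_def coords_point[OF x] partial_lift[OF w z] by (simp add: gi_def)
  have "gm (x, t) *v grad (lift w) (x, t) = diff (lift w) (x, t)"
    unfolding grad_def by (simp add: matrix_vector_mul_assoc gm_gi[OF z])
  then show ?thesis
    unfolding grad_norm_sq_def * by (simp add: gm_def)
qed

lemma time_deriv_eq:
  assumes w: "smooth_on V (lift w)" and z: "(x, t) \<in> V"
  shows "time_deriv T w t (point_of c x) = dd (0, 1) (lift w) (x, t)"
proof -
  have "at t within {0..T} = at t"
    using z by (intro at_within_Icc_at) (auto simp: V_def)
  then show ?thesis
    using vector_derivative_at[OF has_vector_derivative_spacetime[OF differentiable[OF w z]]]
    by (simp add: time_deriv_def)
qed

end

section \<open>The logarithm of a positive function\<close>

context metric_patch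
begin

lemma
  assumes u: "smooth_on W u" and pos: "\<And>z. z \<in> W \<Longrightarrow> 0 < u z" and z: "z \<in> W"
  shows dd_ln_smooth: "dd v (\<lambda>z. ln (u z)) z = dd v u z * inverse (u z)"
    and grad_norm_ln: "grad (\<lambda>z. ln (u z)) z \<bullet> diff (\<lambda>z. ln (u z)) z = (grad u z \<bullet> diff u z) / (u z)\<^sup>2"
    and lap_ln: "lap (\<lambda>z. ln (u z)) z = lap u z / u z - (grad u z \<bullet> diff u z) / (u z)\<^sup>2"
proof -
  let ?f = "\<lambda>z. ln (u z)"
  have f: "smooth_on W ?f"
    by (rule smooth_on_ln[OF open_W u pos])
  have iu: "smooth_on W (\<lambda>z. inverse (u z))"
    by (rule smooth_on_inverse[OF open_W u]) (use pos in force)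
  have dln: "dd v ?f y = dd v u y * inverse (u y)" if "y \<in> W" for v y
    by (rule dd_ln[OF differentiable[OF u that] pos[OF that]])
  show "dd v ?f z = dd v u z * inverse (u z)"
    by (rule dln[OF z])
  have diff_f: "diff ?f z = inverse (u z) *\<^sub>R diff u z"
    by (simp add: vec_eq_iff diff_def dln[OF z] mult.commute)
  then show "grad ?f z \<bullet> diff ?f z = (grad u z \<bullet> diff u z) / (u z)\<^sup>2"
    by (simp add: grad_def matvec.scaleR_right power2_eq_square field_simps)
  have DD: "D i (D j ?f) z = D i (D j u) z * inverse (u z) - D i u z * D j u z * (inverse (u z))\<^sup>2" for i j
  proof -
    have "D i (D j ?f) z = D i (\<lambda>z. D j u z * inverse (u z)) z"
      by (rule dd_cong[OF open_W z dln])
    also have "\<dots> = D j u z * D i (\<lambda>z. inverse (u z)) z + D i (D j u) z * inverse (u z)"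
      by (intro dd_bounded_bilinear[OF bounded_bilinear_mult] differentiable smooth_D u iu z)
    also have "D i (\<lambda>z. inverse (u z)) z = - (inverse (u z) * D i u z * inverse (u z))"
      by (intro dd_inverse differentiable u z) (use pos[OF z] in simp)
    finally show ?thesis by (simp add: power2_eq_square algebra_simps)
  qed
  have hess_f: "hess ?f i z $ j = inverse (u z) * hess u i z $ j - (inverse (u z))\<^sup>2 * (D i u z * D j u z)" for i j
    unfolding hess_component[OF f z] hess_component[OF u z] DD dln[OF z]
    by (simp add: algebra_simps sum_distrib_left)
  have "lap ?f z = (\<Sum>i\<in>UNIV. \<Sum>j\<in>UNIV. inverse (u z) * (N z $ i $ j * hess u i z $ j)
      - (inverse (u z))\<^sup>2 * (N z $ i $ j * D j u z * D i u z))"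
    unfolding lap_eq[OF f z] hess_f by (intro sum.cong refl) (simp add: algebra_simps)
  also have "\<dots> = inverse (u z) * lap u z - (inverse (u z))\<^sup>2 * (grad u z \<bullet> diff u z)"
    unfolding lap_eq[OF u z]
    by (simp add: sum_subtractf sum_distrib_left sum_distrib_right inner_vec_def grad_def matvec_component diff_def mult.assoc)
  finally show "lap ?f z = lap u z / u z - (grad u z \<bullet> diff u z) / (u z)\<^sup>2"
    by (simp add: field_simps)
qed

end

section \<open>Continuity up to the end times\<close>

context chart_flow
begin

text \<open>A spatial partial derivative is the derivative within the closed slab in a spatial
  direction, so it inherits smoothness up to the end times and the lemma can be iterated.\<close>

lemma smooth_on_spatial_derivative:
  fixes F :: "(real^'n) \<times> real \<Rightarrow> real"
  assumes F: "smooth_on (range_of c \<times> {0..T}) F"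
  shows "smooth_on (range_of c \<times> {0..T}) (\<lambda>(x, t). partial i (\<lambda>y. F (y, t)) x)"
proof (rule smooth_on_cong)
  show "smooth_on (range_of c \<times> {0..T})
      (\<lambda>z. frechet_derivative F (at z within range_of c \<times> {0..T}) (axis i 1, 0))"
    by (rule smooth_on_frechet_derivative_within[OF F])
  fix z assume "z \<in> range_of c \<times> {0..T}"
  then obtain x t where z: "z = (x, t)" "x \<in> range_of c" "t \<in> {0..T}" by blast
  have "(F has_derivative frechet_derivative F (at (x, t) within range_of c \<times> {0..T}))
      (at (x, t) within range_of c \<times> {0..T})"
    using smooth_on_imp_differentiable_within[OF F] z frechet_derivative_works by blast
  from partial_spacetime_within[OF open_range z(2,3) this]
  show "frechet_derivative F (at z within range_of c \<times> {0..T}) (axis i 1, 0)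
      = (case z of (x, t) \<Rightarrow> partial i (\<lambda>y. F (y, t)) x)"
    unfolding z(1) by simp
qed

text \<open>The product rules for smooth functions above are for open sets; on the slab with its end
  times continuity is enough and is collected for each ingredient of the Laplacian.\<close>

lemma continuous_on_partial_metric_comp:
  "continuous_on (range_of c \<times> {0..T}) (\<lambda>(x, t). partial i (metric_comp c (g t) j l) x)"
proof (rule continuous_on_eq)
  let ?S = "range_of c \<times> {0..T}"
  let ?G = "\<lambda>(x, t). g t c (point_of c x)"
  show "continuous_on ?S (\<lambda>z. frechet_derivative ?G (at z within ?S) (axis i 1, 0) $ j $ l)"
    by (intro continuous_intros smooth_on_imp_continuous_on smooth_on_frechet_derivative_within metric_smooth)
  fix z assume "z \<in> ?S"
  then obtain x t where z: "z = (x, t)" "x \<in> range_of c" "t \<in> {0..T}" by blast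
  have "(?G has_derivative frechet_derivative ?G (at (x, t) within ?S)) (at (x, t) within ?S)"
    using smooth_on_imp_differentiable_within[OF metric_smooth] z frechet_derivative_works by blast
  then have "((\<lambda>z. ?G z $ j $ l) has_derivative (\<lambda>v. frechet_derivative ?G (at (x, t) within ?S) v $ j $ l))
      (at (x, t) within ?S)"
    by (intro bounded_linear.has_derivative[OF bounded_linear_vec_nth])
  from partial_spacetime_within[OF open_range z(2,3) this]
  show "frechet_derivative ?G (at z within ?S) (axis i 1, 0) $ j $ l
      = (case z of (x, t) \<Rightarrow> partial i (metric_comp c (g t) j l) x)"
    unfolding z(1) by (simp add: metric_comp_def[abs_def])
qed

lemma continuous_on_inverse_metric_comp:
  "continuous_on (range_of c \<times> {0..T}) (\<lambda>(x, t). inverse_metric_comp c (g t) i j x)"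
proof -
  have "continuous_on (range_of c \<times> {0..T}) (\<lambda>z. matrix_inv ((\<lambda>(x, t). g t c (point_of c x)) z) $ i $ j)"
    by (rule continuous_on_matrix_inv[OF smooth_on_imp_continuous_on[OF metric_smooth]])
      (auto intro!: metric_invertible point_in_dom)
  then show ?thesis
    by (simp add: inverse_metric_comp_def case_prod_unfold)
qed

lemma continuous_on_christoffel:
  "continuous_on (range_of c \<times> {0..T}) (\<lambda>(x, t). christoffel c (g t) k i j x)"
  using continuous_on_inverse_metric_comp continuous_on_partial_metric_comp
  unfolding christoffel_def case_prod_unfold by (intro continuous_intros)

lemma continuous_on_laplacian:
  assumes w: "smooth_on (range_of c \<times> {0..T}) (lift w)"
  shows "continuous_on (range_of c \<times> {0..T}) (\<lambda>(x, t). laplacian c (g t) (w t) (point_of c x))"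
proof (rule continuous_on_eq)
  let ?S = "range_of c \<times> {0..T}"
  note d1 = smooth_on_spatial_derivative[OF w]
  have c1: "continuous_on ?S (\<lambda>(x, t). partial k (\<lambda>y. w t (point_of c y)) x)" for k
    using smooth_on_imp_continuous_on[OF d1[of k]] by simp
  have c2: "continuous_on ?S (\<lambda>(x, t). partial i (partial j (\<lambda>y. w t (point_of c y))) x)" for i j
    using smooth_on_imp_continuous_on[OF smooth_on_spatial_derivative[OF d1[of j]], of i] by simp
  show "continuous_on ?S (\<lambda>(x, t). \<Sum>i\<in>UNIV. \<Sum>j\<in>UNIV. inverse_metric_comp c (g t) i j x * hessian c (g t) (w t) i j x)"
    using c1 c2 continuous_on_christoffel continuous_on_inverse_metric_comp
    unfolding hessian_def case_prod_unfold by (intro continuous_intros)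
qed (auto simp: laplacian_def coords_point)

lemma continuous_on_grad_norm_sq:
  assumes w: "smooth_on (range_of c \<times> {0..T}) (lift w)"
  shows "continuous_on (range_of c \<times> {0..T}) (\<lambda>(x, t). grad_norm_sq c (g t) (w t) (point_of c x))"
proof (rule continuous_on_eq)
  let ?S = "range_of c \<times> {0..T}"
  let ?d = "\<lambda>k x t. partial k (\<lambda>y. w t (point_of c y)) x"
  have c1: "continuous_on ?S (\<lambda>(x, t). ?d k x t)" for k
    using smooth_on_imp_continuous_on[OF smooth_on_spatial_derivative[OF w, of k]] by simp
  show "continuous_on ?S (\<lambda>(x, t). \<Sum>i\<in>UNIV. (\<Sum>j\<in>UNIV. inverse_metric_comp c (g t) i j x * ?d j x t) * ?d i x t)"
    using c1 continuous_on_inverse_metric_comp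
    unfolding case_prod_unfold by (intro continuous_intros)
  fix z assume "z \<in> ?S"
  then obtain x t where z: "z = (x, t)" "x \<in> range_of c" "t \<in> {0..T}" by blast
  note p = point_in_dom[OF z(2)]
  have *: "g t c (point_of c x) *v gradient c (g t) (w t) (point_of c x) = (\<chi> i. ?d i x t)"
    by (simp add: gradient_def matrix_vector_mul_assoc metric_inverse[OF z(3) p] coords_point[OF z(2)])
  show "(case z of (x, t) \<Rightarrow> \<Sum>i\<in>UNIV. (\<Sum>j\<in>UNIV. inverse_metric_comp c (g t) i j x * ?d j x t) * ?d i x t)
      = (case z of (x, t) \<Rightarrow> grad_norm_sq c (g t) (w t) (point_of c x))"
    unfolding z(1) prod.case grad_norm_sq_def *
    by (simp add: gradient_def inner_vec_def matvec_component inverse_metric_comp_def coords_point[OF z(2)])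
qed

end

section \<open>Independence of the chart\<close>

lemma inner_gradient:
  fixes c :: "('a::t2_space, 'n::finite) chart"
  assumes inv: "h c p ** matrix_inv (h c p) = mat 1"
    and f: "(\<lambda>x. f (point_of c x)) differentiable (at (coords c p))"
  shows "v \<bullet> (h c p *v gradient c h f p) = dd v (\<lambda>x. f (point_of c x)) (coords c p)"
proof -
  let ?D = "\<lambda>v. dd v (\<lambda>x. f (point_of c x)) (coords c p)"
  have lin: "linear ?D"
    using f frechet_derivative_works has_derivative_linear by blast
  have "h c p *v gradient c h f p = (\<chi> i. ?D (axis i 1))"
    by (simp add: gradient_def matrix_vector_mul_assoc inv partial_def)
  then have "v \<bullet> (h c p *v gradient c h f p) = (\<Sum>i\<in>UNIV. v $ i * ?D (axis i 1))"
    by (simp add: inner_vec_def)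
  also have "\<dots> = ?D (\<Sum>i\<in>UNIV. v $ i *\<^sub>R axis i 1)"
    by (simp add: linear_sum[OF lin] linear_cmul[OF lin])
  also have "(\<Sum>i\<in>UNIV. v $ i *\<^sub>R axis i 1) = v"
    using basis_expansion[of v] by (simp add: scalar_mult_eq_scaleR)
  finally show ?thesis .
qed

text \<open>Pairing the gradient with a vector gives the differential, which obeys the chain rule.
  Therefore the Jacobian \<open>J\<close> of the transition carries one gradient to the other, and
  it is an isometry between the two coordinate metrics.\<close>

lemma grad_norm_sq_chart_independent:
  fixes c d :: "('a::t2_space, 'n::finite) chart"
  assumes "chart M c" "chart M d" and p: "p \<in> dom_of c" "p \<in> dom_of d"
    and smooth: "smooth_on (coords c ` (dom_of c \<inter> dom_of d)) (transition c d)"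
    and pos: "\<And>v. v \<noteq> 0 \<Longrightarrow> 0 < v \<bullet> (h c p *v v)"
    and inv: "h c p ** matrix_inv (h c p) = mat 1" "h d p ** matrix_inv (h d p) = mat 1"
      "matrix_inv (h d p) ** h d p = mat 1"
    and J: "\<And>v w. v \<bullet> (h c p *v w) =
      dd v (transition c d) (coords c p) \<bullet> (h d p *v dd w (transition c d) (coords c p))"
    and f: "(\<lambda>x. f (point_of d x)) differentiable (at (coords d p))"
  shows "grad_norm_sq c h f p = grad_norm_sq d h f p"
proof -
  interpret c: chart M c by fact
  interpret d: chart M d by fact
  let ?O = "coords c ` (dom_of c \<inter> dom_of d)"
  let ?J = "\<lambda>v. dd v (transition c d) (coords c p)"
  \<comment> \<open>Openness of the overlap in coordinates makes the derivative of the transition a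
    two-sided one.\<close>
  have "openin (top_of_set (dom_of c)) (dom_of c \<inter> dom_of d)"
    using d.is_chart c.dom_subset unfolding is_chart_def
    by (metis inf.absorb_iff2 inf_commute openin_subtopology_Int2 subtopology_subtopology)
  then have "openin (top_of_set (range_of c)) ?O"
    using c.is_chart homeomorphism_imp_open_map unfolding is_chart_def by blast
  then have open_O: "open ?O"
    using c.open_range openin_open_trans by blast
  have cp: "coords c p \<in> ?O" using p by blast
  have trans_p: "transition c d (coords c p) = coords d p"
    using p by (simp add: transition_def c.point_coords)
  have trans: "(transition c d has_derivative ?J) (at (coords c p))"
    by (rule smooth_on_has_derivative[OF open_O smooth cp])
  have fd: "((\<lambda>x. f (point_of d x)) has_derivative (\<lambda>v. dd v (\<lambda>x. f (point_of d x)) (coords d p)))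
      (at (transition c d (coords c p)))"
    using f frechet_derivative_works unfolding trans_p by blast
  have comp: "((\<lambda>x. f (point_of d (transition c d x))) has_derivative
      (\<lambda>v. dd (?J v) (\<lambda>x. f (point_of d x)) (coords d p))) (at (coords c p))"
    by (rule has_derivative_compose[OF trans fd])
  have fc: "((\<lambda>x. f (point_of c x)) has_derivative
      (\<lambda>v. dd (?J v) (\<lambda>x. f (point_of d x)) (coords d p))) (at (coords c p))"
  proof (rule has_derivative_transform_within_open[OF comp open_O cp])
    show "f (point_of d (transition c d x)) = f (point_of c x)" if "x \<in> ?O" for x
      using that by (auto simp: transition_def c.point_coords d.point_coords)
  qed
  have chain: "v \<bullet> (h c p *v gradient c h f p) = ?J v \<bullet> (h d p *v gradient d h f p)" for v
    using inner_gradient[of h c p f v] inner_gradient[of h d p f "?J v"] inv f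
      has_derivative_imp_dd[OF fc, of v] differentiableI[OF fc] by simp
  have lin: "linear ?J" using trans has_derivative_linear by blast
  \<comment> \<open>The pulled-back metric is positive definite, so \<open>J\<close> is injective
    and hence onto; every test vector in \<open>d\<close> then comes from \<open>c\<close>.\<close>
  have "?J v = 0 \<Longrightarrow> v = 0" for v
    using pos[of v] J[of v v] by (cases "v = 0") auto
  then have "surj ?J"
    using linear_injective_imp_surjective[OF lin] linear_injective_0[OF lin] by blast
  have "w \<bullet> (h d p *v gradient d h f p) = w \<bullet> (h d p *v ?J (gradient c h f p))" for w
  proof -
    obtain v where "w = ?J v" using \<open>surj ?J\<close> by blast
    then show ?thesis using chain[of v] J[of v "gradient c h f p"] by simp
  qed
  then have "h d p *v gradient d h f p = h d p *v ?J (gradient c h f p)"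
    using vector_eq_ldot by blast
  then have "gradient d h f p = ?J (gradient c h f p)"
    using inv(3) by (metis matrix_vector_mul_assoc matrix_vector_mul_lid)
  then show ?thesis
    unfolding grad_norm_sq_def J by simp
qed

section \<open>The maximum principle\<close>

locale log_heat_ricci_flow =
  fixes M :: "'a::t2_space set"
    and A :: "('a, 'n::finite) chart set"
    and g :: "real \<Rightarrow> ('a, 'n) bilinear_field"
    and u q :: "real \<Rightarrow> 'a \<Rightarrow> real"
    and T K \<theta> a :: real
  assumes T: "0 < T" and K: "0 \<le> K" and \<theta>: "0 \<le> \<theta>"
    and manifold: "closed_manifold M A"
    and flow: "ricci_flow A T g"
    and Ric_nonneg: "\<And>t. t \<in> {0..T} \<Longrightarrow> bilinear_le A (\<lambda>c p. 0) (ricci (g t))"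
    and Ric_le: "\<And>t. t \<in> {0..T} \<Longrightarrow> bilinear_le A (ricci (g t)) (\<lambda>c p. K *\<^sub>R g t c p)"
    and smooth_u: "smooth_on_spacetime A T u"
    and u_pos: "\<And>t p. t \<in> {0..T} \<Longrightarrow> p \<in> M \<Longrightarrow> 0 < u t p"
    and equation: "\<And>t c p. t \<in> {0..T} \<Longrightarrow> c \<in> A \<Longrightarrow> p \<in> dom_of c \<Longrightarrow>
           laplacian c (g t) (u t) p - q t p * u t p - time_deriv T u t p = a * u t p * ln (u t p)"
    and lap_q: "\<And>t c p. t \<in> {0..T} \<Longrightarrow> c \<in> A \<Longrightarrow> p \<in> dom_of c \<Longrightarrow>
           laplacian c (g t) (q t) p \<le> \<theta>"
begin

lemma chart: "c \<in> A \<Longrightarrow> chart M c"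
  using manifold unfolding closed_manifold_def smooth_atlas_def by (simp add: chart_def)

lemma chart_flow: "c \<in> A \<Longrightarrow> chart_flow M c g T"
  using flow chart
  unfolding ricci_flow_def smooth_family_of_metrics_def riemannian_metric_def
  by (simp add: chart_flow_def chart_flow_axioms_def)

lemma compact_M: "compact M"
  using manifold by (simp add: closed_manifold_def)

lemma chart_at: "p \<in> M \<Longrightarrow> \<exists>c\<in>A. p \<in> dom_of c"
  using manifold unfolding closed_manifold_def smooth_atlas_def by blast

text \<open>Minus the Laplacian of \<open>ln u\<close>, and by the equation the left-hand side of
  the estimate. This form contains only spatial derivatives of \<open>u\<close>, which are
  continuous up to the end times.\<close>

definition deficit :: "('a, 'n) chart \<Rightarrow> real \<Rightarrow> 'a \<Rightarrow> real" where
  "deficit c t p = grad_norm_sq c (g t) (u t) p / (u t p)\<^sup>2 - laplacian c (g t) (u t) p / u t p"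

lemma u_pos_chart: "c \<in> A \<Longrightarrow> p \<in> dom_of c \<Longrightarrow> t \<in> {0..T} \<Longrightarrow> 0 < u t p"
  using chart.dom_subset[OF chart] u_pos by blast

lemma deficit_eq:
  assumes "c \<in> A" "p \<in> dom_of c" "t \<in> {0..T}"
  shows "deficit c t p = grad_norm_sq c (g t) (u t) p / (u t p)\<^sup>2 - time_deriv T u t p / u t p
             - q t p - a * ln (u t p)"
proof -
  have "laplacian c (g t) (u t) p = time_deriv T u t p + q t p * u t p + a * u t p * ln (u t p)"
    using equation[OF assms(3,1,2)] by simp
  then show ?thesis
    using u_pos_chart[OF assms] by (simp add: deficit_def field_simps)
qed

lemma smooth_lift:
  "c \<in> A \<Longrightarrow> smooth_on (range_of c \<times> {0..T}) (\<lambda>(x, t). u t (point_of c x))"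
  using smooth_u by (simp add: smooth_on_spacetime_def)

lemma u_differentiable:
  assumes "c \<in> A" "p \<in> dom_of c" "t \<in> {0..T}"
  shows "(\<lambda>x. u t (point_of c x)) differentiable (at (coords c p))"
proof -
  interpret chart M c by (rule chart[OF assms(1)])
  let ?F = "\<lambda>(x, t). u t (point_of c x)" and ?S = "range_of c \<times> {0..T}"
  let ?x = "coords c p"
  note x = coords_in_range[OF assms(2)]
  obtain F' where F': "(?F has_derivative F') (at (?x, t) within ?S)"
    using smooth_on_imp_differentiable_within[OF smooth_lift[OF assms(1)]] x assms(3)
    unfolding differentiable_def by blast
  have "((\<lambda>y. (y, t)) has_derivative (\<lambda>v. (v, 0))) (at ?x within range_of c)"
    by (intro derivative_intros)
  moreover have "(?F has_derivative F') (at (?x, t) within (\<lambda>y. (y, t)) ` range_of c)"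
    using assms(3) by (intro has_derivative_subset[OF F']) auto
  ultimately have "((\<lambda>y. ?F (y, t)) has_derivative (\<lambda>v. F' (v, 0))) (at ?x within range_of c)"
    by (rule has_derivative_in_compose)
  then show ?thesis
    unfolding at_within_open[OF x open_range] by (auto intro: differentiableI)
qed

text \<open>By \<open>deficit_eq\<close> the chart enters only through the norm of the gradient, so
  the Laplacian need not be transformed.\<close>

lemma deficit_chart_independent:
  assumes c: "c \<in> A" "p \<in> dom_of c" and d: "d \<in> A" "p \<in> dom_of d" and t: "t \<in> {0..T}"
  shows "deficit c t p = deficit d t p"
proof -
  interpret c: chart_flow M c g T by (rule chart_flow[OF c(1)])
  interpret d: chart_flow M d g T by (rule chart_flow[OF d(1)])
  have "grad_norm_sq c (g t) (u t) p = grad_norm_sq d (g t) (u t) p"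
  proof (rule grad_norm_sq_chart_independent)
    show "smooth_on (coords c ` (dom_of c \<inter> dom_of d)) (transition c d)"
      using manifold c d unfolding closed_manifold_def smooth_atlas_def by blast
    show "v \<bullet> (g t c p *v w) = dd v (transition c d) (coords c p)
        \<bullet> (g t d p *v dd w (transition c d) (coords c p))" for v w
      using flow c d t
      unfolding ricci_flow_def smooth_family_of_metrics_def riemannian_metric_def Let_def by blast
  qed (use c d t in \<open>auto intro: c.chart_axioms d.chart_axioms c.metric_pos c.metric_inverse
        d.metric_inverse u_differentiable\<close>)
  then show ?thesis
    using deficit_eq[OF c t] deficit_eq[OF d t] by simp
qed

text \<open>An arbitrary chart around \<open>p\<close> is chosen, which is harmless by the preceding
  lemma; a maximum over the whole manifold needs one global function.\<close>

definition Phi :: "real \<Rightarrow> 'a \<Rightarrow> real" where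
  "Phi t p = deficit (SOME c. c \<in> A \<and> p \<in> dom_of c) t p"

lemma Phi_eq:
  assumes "c \<in> A" "p \<in> dom_of c" "t \<in> {0..T}"
  shows "Phi t p = deficit c t p"
proof -
  have "(SOME c. c \<in> A \<and> p \<in> dom_of c) \<in> A \<and> p \<in> dom_of (SOME c. c \<in> A \<and> p \<in> dom_of c)"
    using assms by (intro someI[of "\<lambda>c. c \<in> A \<and> p \<in> dom_of c"]) blast
  then show ?thesis
    unfolding Phi_def using deficit_chart_independent assms by blast
qed

lemma continuous_on_deficit:
  assumes c: "c \<in> A"
  shows "continuous_on (range_of c \<times> {0..T}) (\<lambda>(x, t). deficit c t (point_of c x))"
proof -
  interpret chart_flow M c g T by (rule chart_flow[OF c])
  have nz: "(case z of (x, t) \<Rightarrow> u t (point_of c x)) \<noteq> 0" if "z \<in> range_of c \<times> {0..T}" for z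
    using that u_pos_chart[OF c point_in_dom] by fastforce
  show ?thesis
    using continuous_on_laplacian[OF smooth_lift[OF c]] continuous_on_grad_norm_sq[OF smooth_lift[OF c]]
      smooth_on_imp_continuous_on[OF smooth_lift[OF c]] nz
    unfolding deficit_def case_prod_unfold by (intro continuous_intros) auto
qed

lemma continuous_on_Phi: "continuous_on ({0..T} \<times> M) (\<lambda>(t, p). Phi t p)"
  unfolding continuous_on_eq_continuous_within
proof
  fix z assume z: "z \<in> {0..T} \<times> M"
  then obtain c where c: "c \<in> A" "snd z \<in> dom_of c"
    using chart_at by (metis mem_Sigma_iff prod.collapse)
  interpret chart M c by (rule chart[OF c(1)])
  obtain S where S: "open S" "dom_of c = M \<inter> S"
    using is_chart unfolding is_chart_def openin_open by blast
  have "continuous_on ({0..T} \<times> dom_of c) ((\<lambda>(x, t). deficit c t (point_of c x)) \<circ> (\<lambda>z. (coords c (snd z), fst z)))"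
  proof (rule continuous_on_compose)
    have "continuous_on (dom_of c) (coords c)"
      using is_chart by (simp add: is_chart_def homeomorphism_def)
    then have "continuous_on ({0..T} \<times> dom_of c) (\<lambda>z. coords c (snd z))"
      by (rule continuous_on_compose2) (auto intro!: continuous_intros)
    then show "continuous_on ({0..T} \<times> dom_of c) (\<lambda>z. (coords c (snd z), fst z))"
      by (intro continuous_intros)
    show "continuous_on ((\<lambda>z. (coords c (snd z), fst z)) ` ({0..T} \<times> dom_of c)) (\<lambda>(x, t). deficit c t (point_of c x))"
      by (rule continuous_on_subset[OF continuous_on_deficit[OF c(1)]]) (auto intro: coords_in_range)
  qed
  then have "continuous_on ({0..T} \<times> dom_of c) (\<lambda>(t, p). Phi t p)"
    by (rule continuous_on_eq) (auto simp: point_coords Phi_eq[OF c(1)])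
  moreover have "z \<in> {0..T} \<times> dom_of c"
    using z c(2) by (simp add: mem_Times_iff)
  ultimately have "continuous (at z within {0..T} \<times> dom_of c) (\<lambda>(t, p). Phi t p)"
    unfolding continuous_on_eq_continuous_within by blast
  \<comment> \<open>The chart domain is relatively open in \<open>M\<close>, so a limit within
    \<open>M\<close> can be taken inside it.\<close>
  moreover have "at z within {0..T} \<times> M = at z within {0..T} \<times> dom_of c"
    by (rule at_within_nhd[of z "UNIV \<times> S"]) (use z c(2) S in \<open>auto simp: open_Times mem_Times_iff\<close>)
  ultimately show "continuous (at z within {0..T} \<times> M) (\<lambda>(t, p). Phi t p)"
    by simp
qed

text \<open>Two bounds for the time derivative of \<open>lap f\<close> meet: comparison in space
  bounds it below by \<open>2 x^2 / n\<close>, comparison with earlier times bounds it above by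
  \<open>x / t0\<close>. Later times play no part in the maximum.\<close>

lemma Phi_le_at_maximum:
  fixes \<kappa> :: real
  defines "\<kappa> \<equiv> CARD('n) * K + sqrt (CARD('n) * \<theta>) + CARD('n) / 2 * \<bar>a\<bar>"
  assumes t0: "0 < t0" "t0 < T" and p0: "p0 \<in> M"
    and max: "\<And>t p. 0 \<le> t \<Longrightarrow> t \<le> t0 \<Longrightarrow> p \<in> M \<Longrightarrow> t * (Phi t p - \<kappa>) \<le> t0 * (Phi t0 p0 - \<kappa>)"
  shows "t0 * (Phi t0 p0 - \<kappa>) \<le> CARD('n) / 2"
proof (cases "0 < Phi t0 p0 - \<kappa>")
  case False
  then have "t0 * (Phi t0 p0 - \<kappa>) \<le> 0"
    using t0 by (simp add: mult_nonneg_nonpos)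
  then show ?thesis using order_trans by fastforce
next
  case True
  define x where "x = Phi t0 p0 - \<kappa>"
  have x: "0 < x" using True by (simp add: x_def)
  obtain c where c: "c \<in> A" "p0 \<in> dom_of c"
    using chart_at p0 by blast
  interpret chart_flow M c g T by (rule chart_flow[OF c(1)])
  define z where "z = (coords c p0, t0)"
  have z: "z \<in> V" using coords_in_range[OF c(2)] t0 by (simp add: z_def V_def)
  have smooth_u: "smooth_on V (lift u)"
    by (rule smooth_on_subset_open[OF smooth_lift[OF c(1)] open_V V_subset])
  have pos_u: "0 < lift u z" if "z \<in> V" for z
    using that u_pos_chart[OF c(1) point_in_dom] by (auto simp: V_def)
  define f where "f = (\<lambda>z. ln (lift u z))"
  have f: "smooth_on V f"
    unfolding f_def by (rule smooth_on_ln[OF open_V smooth_u pos_u])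
  have q_eq: "lift q z = lap (lift u) z * inverse (lift u z) - dd (0, 1) (lift u) z * inverse (lift u z) - a * f z"
    if "z \<in> V" for z
  proof -
    obtain y t where yt: "z = (y, t)" by fastforce
    have y: "y \<in> range_of c" and t: "t \<in> {0..T}" using that by (auto simp: V_def yt)
    have "lap (lift u) z - lift q z * lift u z - dd (0, 1) (lift u) z = a * lift u z * f z"
      using equation[OF t c(1) point_in_dom[OF y]] laplacian_eq_lap[OF smooth_u that[unfolded yt]]
        time_deriv_eq[OF smooth_u that[unfolded yt]] by (simp add: yt f_def)
    then show ?thesis using pos_u[OF that] by (simp add: field_simps)
  qed
  \<comment> \<open>The equation expresses \<open>q\<close> through \<open>u\<close>, so
    \<open>q\<close> is jointly smooth at interior times, as the evolution equation for
    \<open>lap f\<close> requires.\<close>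
  have q: "smooth_on V (lift q)"
  proof (rule smooth_on_cong)
    have "smooth_on V (\<lambda>z. inverse (lift u z))"
      by (rule smooth_on_inverse[OF open_V smooth_u]) (use pos_u in force)
    then show "smooth_on V (\<lambda>z. lap (lift u) z * inverse (lift u z) - dd (0, 1) (lift u) z * inverse (lift u z) - a * f z)"
      by (intro smooth_on_diff smooth_on_mult smooth_on_const open_V smooth_lap smooth_D smooth_u f)
  qed (simp add: q_eq)
  have f_eq: "dd (0, 1) f y = lap f y + grad f y \<bullet> diff f y - lift q y - a * f y" if "y \<in> V" for y
    unfolding q_eq[OF that]
    using dd_ln_smooth[OF smooth_u pos_u that] lap_ln[OF smooth_u pos_u that] grad_norm_ln[OF smooth_u pos_u that]
    by (simp add: f_def divide_inverse)
  have lap_f: "lap f (y, t) = - Phi t (point_of c y)" if "(y, t) \<in> V" for y t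
  proof -
    have y: "y \<in> range_of c" and t: "t \<in> {0..T}" using that by (auto simp: V_def)
    show ?thesis
      unfolding Phi_eq[OF c(1) point_in_dom[OF y] t] deficit_def
        laplacian_eq_lap[OF smooth_u that] grad_norm_sq_eq[OF smooth_u that]
      using lap_ln[OF smooth_u pos_u that] by (simp add: f_def)
  qed
  have lap_f_z: "lap f z = - (x + \<kappa>)"
    using lap_f[of "coords c p0" t0] z by (simp add: z_def point_coords[OF c(2)] x_def)
  have t0T: "t0 \<in> {0..T}" using t0 by simp
  have Ric_z: "Ric z = ricci (g t0) c p0" and gm_z: "gm z = g t0 c p0"
    using Ric_eq z by (auto simp: z_def gm_def point_coords[OF c(2)])
  have "2 / CARD('n) * x\<^sup>2 \<le> dd (0, 1) (lap f) z"
  proof (rule harnack_critical_point[OF f q z f_eq, where K = K and \<theta> = \<theta>])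
    show "0 < v \<bullet> (gm z *v v)" if "v \<noteq> 0" for v
      unfolding gm_z by (rule metric_pos[OF t0T c(2) that])
    show "0 \<le> v \<bullet> (Ric z *v v)" for v
      unfolding Ric_z using Ric_nonneg[OF t0T] c by (simp add: bilinear_le_def)
    show "v \<bullet> (Ric z *v v) \<le> K * (v \<bullet> (gm z *v v))" for v
      unfolding Ric_z gm_z using Ric_le[OF t0T] c by (simp add: bilinear_le_def matvec.scaleR_left)
    show "lap (lift q) z \<le> \<theta>"
      using lap_q[OF t0T c] laplacian_eq_lap[OF q z[unfolded z_def]] by (simp add: z_def point_coords[OF c(2)])
    show "\<exists>d>0. \<forall>s. \<bar>s\<bar> < d \<longrightarrow> lap f z \<le> lap f (z + s *\<^sub>R (\<Sum>i\<in>UNIV. b i *\<^sub>R e i))" for b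
    proof -
      define v where "v = (\<Sum>i\<in>UNIV. b i *\<^sub>R (axis i 1 :: real^'n))"
      have "(\<Sum>i\<in>UNIV. b i *\<^sub>R e i) = (v, 0)"
        unfolding e_def v_def by (simp add: prod_eq_iff fst_sum snd_sum)
      then have line: "z + s *\<^sub>R (\<Sum>i\<in>UNIV. b i *\<^sub>R e i) = (coords c p0 + s *\<^sub>R v, t0)" for s
        by (simp add: z_def)
      have "((\<lambda>s. coords c p0 + s *\<^sub>R v) \<longlongrightarrow> coords c p0 + 0 *\<^sub>R v) (at 0)"
        by (intro tendsto_intros)
      then have "\<forall>\<^sub>F s in at 0. coords c p0 + s *\<^sub>R v \<in> range_of c"
        using open_range coords_in_range[OF c(2)] by (simp add: topological_tendstoD)
      then obtain d where d: "d > 0" "\<And>s. s \<noteq> 0 \<Longrightarrow> \<bar>s\<bar> < d \<Longrightarrow> coords c p0 + s *\<^sub>R v \<in> range_of c"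
        unfolding eventually_at by (auto simp: dist_real_def)
      have "lap f z \<le> lap f (coords c p0 + s *\<^sub>R v, t0)" if "\<bar>s\<bar> < d" for s
      proof (cases "s = 0")
        case True
        then show ?thesis by (simp add: z_def)
      next
        case False
        then have y: "coords c p0 + s *\<^sub>R v \<in> range_of c" using d(2) that by blast
        then have yV: "(coords c p0 + s *\<^sub>R v, t0) \<in> V" using t0 by (simp add: V_def)
        have "t0 * (Phi t0 (point_of c (coords c p0 + s *\<^sub>R v)) - \<kappa>) \<le> t0 * (Phi t0 p0 - \<kappa>)"
          using max[of t0] t0 point_in_dom[OF y] dom_subset by auto
        then show ?thesis
          unfolding lap_f[OF yV] lap_f_z x_def using t0 by simp
      qed
      then show ?thesis using d(1) unfolding line by blast
    qed
    show "lap f z = - (x + CARD('n) * K + sqrt (CARD('n) * \<theta>) + CARD('n) / 2 * \<bar>a\<bar>)"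
      unfolding lap_f_z \<kappa>_def by simp
  qed (use K \<theta> x in auto)
  \<comment> \<open>At \<open>p0\<close> maximality reads
    \<open>Phi s p0 - \<kappa> <= t0 * x / s\<close> for \<open>s <= t0\<close>, with equality at
    \<open>t0\<close>. Thus \<open>lap f + t0 * x / s\<close> is minimal at the right end of this
    time range and cannot have a positive derivative there.\<close>
  also have "dd (0, 1) (lap f) z \<le> x / t0"
  proof (rule ccontr)
    assume "\<not> dd (0, 1) (lap f) z \<le> x / t0"
    then have pos: "0 < dd (0, 1) (lap f) z - x / t0" by simp
    have "((\<lambda>s. lap f (coords c p0, s)) has_real_derivative dd (0, 1) (lap f) z) (at t0)"
      using has_vector_derivative_spacetime[OF differentiable[OF smooth_lap[OF f] z[unfolded z_def]]]
      by (simp add: has_real_derivative_iff_has_vector_derivative z_def)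
    moreover have "((\<lambda>s. t0 * x / s) has_real_derivative - (x / t0)) (at t0)"
      using t0 by (auto intro!: derivative_eq_intros simp: field_simps)
    ultimately have "((\<lambda>s. lap f (coords c p0, s) + t0 * x / s) has_real_derivative dd (0, 1) (lap f) z - x / t0) (at t0)"
      using DERIV_add by fastforce
    from DERIV_pos_inc_left[OF this pos] obtain d where d: "d > 0"
      "\<And>h. 0 < h \<Longrightarrow> h < d \<Longrightarrow> lap f (coords c p0, t0 - h) + t0 * x / (t0 - h) < lap f (coords c p0, t0) + t0 * x / t0"
      by blast
    \<comment> \<open>Halving keeps the step back in time below \<open>d\<close> and the time
      \<open>s\<close> positive.\<close>
    define s where "s = t0 - min d t0 / 2"
    have s: "0 < s" "s < t0" using d(1) t0 by (auto simp: s_def min_def)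
    have "lap f (coords c p0, s) + t0 * x / s < lap f z + x"
      using d(2)[of "min d t0 / 2"] d(1) t0 by (simp add: s_def z_def min_def split: if_splits)
    moreover have "(coords c p0, s) \<in> V"
      using s t0 coords_in_range[OF c(2)] by (simp add: V_def)
    ultimately have "t0 * x / s < Phi s p0 - \<kappa>"
      using lap_f[of "coords c p0" s] lap_f_z by (simp add: point_coords[OF c(2)])
    moreover have "s * (Phi s p0 - \<kappa>) \<le> t0 * x"
      using max[of s p0] s p0 by (simp add: x_def)
    ultimately show False
      using s by (simp add: field_simps)
  qed
  finally have "2 / CARD('n) * x\<^sup>2 \<le> x / t0" .
  then have "(2 / CARD('n) * x) * x \<le> 1 / t0 * x"
    by (simp add: power2_eq_square)
  then have "2 / CARD('n) * x \<le> 1 / t0"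
    using x by (rule mult_right_le_imp_le)
  then show ?thesis
    using t0 by (simp add: x_def[symmetric] field_simps)
qed

text \<open>The factor \<open>s\<close> makes the maximized function vanish at time 0, so a maximum
  there gives the bound at once, whatever the initial values of \<open>u\<close>.\<close>

lemma Phi_le_interior:
  fixes \<kappa> :: real
  defines "\<kappa> \<equiv> CARD('n) * K + sqrt (CARD('n) * \<theta>) + CARD('n) / 2 * \<bar>a\<bar>"
  assumes t: "0 < t" "t < T" and p: "p \<in> M"
  shows "Phi t p \<le> CARD('n) / (2 * t) + \<kappa>"
proof -
  let ?H = "\<lambda>(s, p). s * (Phi s p - \<kappa>)"
  have "continuous_on ({0..t} \<times> M) (\<lambda>z. fst z * ((\<lambda>(s, p). Phi s p) z - \<kappa>))"
    using t by (intro continuous_intros continuous_on_subset[OF continuous_on_Phi]) auto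
  then have cont: "continuous_on ({0..t} \<times> M) ?H"
    by (simp add: case_prod_unfold)
  have comp: "compact ({0..t} \<times> M)"
    by (intro compact_Times compact_M) simp
  have "{0..t} \<times> M \<noteq> {}"
    using t p by auto
  then obtain z where z: "z \<in> {0..t} \<times> M" "\<And>y. y \<in> {0..t} \<times> M \<Longrightarrow> ?H y \<le> ?H z"
    using continuous_attains_sup[OF comp _ cont] by blast
  obtain t0 p0 where z0: "z = (t0, p0)" by fastforce
  have le: "s * (Phi s y - \<kappa>) \<le> t0 * (Phi t0 p0 - \<kappa>)" if "0 \<le> s" "s \<le> t" "y \<in> M" for s y
    using z(2)[of "(s, y)"] that by (simp add: z0)
  have "t0 * (Phi t0 p0 - \<kappa>) \<le> CARD('n) / 2"
  proof (cases "t0 = 0")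
    case False
    then show ?thesis
      using z(1) t by (intro Phi_le_at_maximum[folded \<kappa>_def] le) (auto simp: z0)
  qed simp
  then have "t * (Phi t p - \<kappa>) \<le> CARD('n) / 2"
    using le[of t p] t p by simp
  then show ?thesis
    using t by (simp add: field_simps)
qed

lemma Phi_le:
  fixes \<kappa> :: real
  defines "\<kappa> \<equiv> CARD('n) * K + sqrt (CARD('n) * \<theta>) + CARD('n) / 2 * \<bar>a\<bar>"
  assumes t: "0 < t" "t \<le> T" and p: "p \<in> M"
  shows "Phi t p \<le> CARD('n) / (2 * t) + \<kappa>"
proof (cases "t = T")
  case True
  \<comment> \<open>Starting at \<open>T / 2\<close> keeps the term \<open>n / (2 t)\<close> away
    from its pole.\<close>
  have cont: "continuous_on {T / 2..T} (\<lambda>t. Phi t p - CARD('n) / (2 * t))"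
  proof -
    have "continuous_on {T / 2..T} (\<lambda>t. (\<lambda>(t, p). Phi t p) (t, p))"
      by (rule continuous_on_compose2[OF continuous_on_Phi]) (use T p in \<open>auto intro!: continuous_intros\<close>)
    then show ?thesis
      using T by (intro continuous_intros) auto
  qed
  have closure: "closure {T / 2<..<T} = {T / 2..T}"
    using T by (intro closure_greaterThanLessThan) simp
  have "Phi T p - CARD('n) / (2 * T) \<le> \<kappa>"
  proof (rule continuous_le_on_closure[OF cont[folded closure]])
    show "T \<in> closure {T / 2<..<T}" unfolding closure using T by simp
    show "Phi s p - CARD('n) / (2 * s) \<le> \<kappa>" if "s \<in> {T / 2<..<T}" for s
      using Phi_le_interior[of s p, folded \<kappa>_def] that T p by simp
  qed
  then show ?thesis using True by simp
next
  case False
  then show ?thesis using Phi_le_interior[folded \<kappa>_def] t p by simp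
qed

end

theorem corollary4p4:
  fixes M :: "'a::t2_space set"
    and A :: "('a, 'n::finite) chart set"
    and g :: "real \<Rightarrow> ('a, 'n) bilinear_field"
    and u q :: "real \<Rightarrow> 'a \<Rightarrow> real"
    and T K\<^sub>2 \<theta> a :: real
  assumes "0 < T" and "0 \<le> K\<^sub>2" and "0 \<le> \<theta>"
    and "closed_manifold M A"
    and "ricci_flow A T g"
    and "\<And>t. t \<in> {0..T} \<Longrightarrow> bilinear_le A (\<lambda>c p. 0) (ricci (g t))"
    and "\<And>t. t \<in> {0..T} \<Longrightarrow> bilinear_le A (ricci (g t)) (\<lambda>c p. K\<^sub>2 *\<^sub>R g t c p)"
    and "C2_space_C1_time M A T q"
    and "smooth_on_spacetime A T u"
    and "\<And>t p. t \<in> {0..T} \<Longrightarrow> p \<in> M \<Longrightarrow> 0 < u t p"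
    and "\<And>t c p. t \<in> {0..T} \<Longrightarrow> c \<in> A \<Longrightarrow> p \<in> dom_of c \<Longrightarrow>
           laplacian c (g t) (u t) p - q t p * u t p - time_deriv T u t p
             = a * u t p * ln (u t p)"
    and "\<And>t c p. t \<in> {0..T} \<Longrightarrow> c \<in> A \<Longrightarrow> p \<in> dom_of c \<Longrightarrow>
           laplacian c (g t) (q t) p \<le> \<theta>"
  shows "\<forall>t\<in>{0<..T}. \<forall>c\<in>A. \<forall>p\<in>dom_of c.
           grad_norm_sq c (g t) (u t) p / (u t p)\<^sup>2 - time_deriv T u t p / u t p
             - q t p - a * ln (u t p)
           \<le> real CARD('n) / (2 * t) + real CARD('n) * K\<^sub>2 + sqrt (real CARD('n) * \<theta>)
             + real CARD('n) / 2 * \<bar>a\<bar>"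
proof (intro ballI)
  interpret log_heat_ricci_flow M A g u q T "K\<^sub>2" \<theta> a
    using assms by unfold_locales
  fix t c p assume t: "t \<in> {0<..T}" and c: "c \<in> A" and p: "p \<in> dom_of c"
  have t': "t \<in> {0..T}" using t by simp
  have "p \<in> M" using chart.dom_subset[OF chart[OF c]] p by blast
  then have "Phi t p \<le> real CARD('n) / (2 * t) + (real CARD('n) * K\<^sub>2 + sqrt (real CARD('n) * \<theta>)
             + real CARD('n) / 2 * \<bar>a\<bar>)"
    using Phi_le t by simp
  then show "grad_norm_sq c (g t) (u t) p / (u t p)\<^sup>2 - time_deriv T u t p / u t p
             - q t p - a * ln (u t p)
           \<le> real CARD('n) / (2 * t) + real CARD('n) * K\<^sub>2 + sqrt (real CARD('n) * \<theta>)
             + real CARD('n) / 2 * \<bar>a\<bar>"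
    unfolding Phi_eq[OF c p t'] deficit_eq[OF c p t'] by simp
qed

end
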